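(* Let $m\ge1$ and let $D\in W_m$ be a derivation of $B_m$. Assume that $D$ has no non-trivial constants, i.e. $B_m^D=\mathbb{F}$. Then there exist an integer $r$ with $0\le r\le m$, a decomposition $B_m=B'\otimes B''$ with $B'\simeq B_r$ and $B''\simeq B_{m-r}$, and derivations $\mathcal{N}\in\operatorname{Der}(B')\simeq W_r$ and $\mathcal{S}\in\operatorname{Der}(B'')\simeq W_{m-r}$ satisfying the following properties: (1) $\mathcal{N}\in W_r$ is regular nilpotent and $\mathcal{S}\in W_{m-r}$ is regular semi-simple; (2) $D=\mathcal{N}\otimes\operatorname{id}_{B''}+\operatorname{id}_{B'}\otimes\mathcal{S}\in\operatorname{Der}(B'\otimes B'')$.
   Context: $\mathbb{F}$ is an algebraically closed field of characteristic $p>3$; derivations and tensor products are over $\mathbb{F}$. For $m\ge 0$, $B_m=\mathbb{F}[x_1,\dots,x_m]/(x_1^p,\dots,x_m^p)$ is the truncated polynomial ring (so $\dim B_m=p^m$ and $B_0=\mathbb{F}$), and $W_m=\operatorname{Der}(B_m)$. For $D\in W_m$, $B_m^D=\{f\in B_m: D(f)=0\}$ is the ring of $D$-constants. A derivation $D\in W_m$ is regular nilpotent if $D^{p^m-1}\ne 0$ and $D^{p^m}=0$, and regular semi-simple if $D$ has $p^m$ distinct eigenvalues as a linear map on $B_m$. A decomposition $B_m=B'\otimes B''$ means that $B',B''$ are subalgebras of $B_m$ such that the multiplication map $B'\otimes B''\to B_m$ is an isomorphism of algebras. *)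

theory Defs
  imports "HOL-Algebra.Algebraic_Closure_Type" "HOL-Algebra.QuotRing" "HOL-Algebra.Module" "HOL-Library.Poly_Mapping"
begin

text \<open>
  The ground field is a type \<open>'a\<close> of class \<^class>\<open>field\<close>; an algebra over it is a
  HOL-Algebra record \<open>A :: ('a, 'b) module\<close> whose ring of scalars is
  \<^const>\<open>ring_of_type_algebra\<close>, i.e. \<open>'a\<close> with carrier \<^const>\<open>UNIV\<close>. Maps between algebras are
  total functions of which only the values on the carrier matter.
\<close>

abbreviation ground_field :: "'a::field ring" where
  "ground_field \<equiv> ring_of_type_algebra"

definition alg_iso :: "('a::field, 'b) module \<Rightarrow> ('a, 'c) module \<Rightarrow> ('b \<Rightarrow> 'c) set" where
  "alg_iso A B =
    {h \<in> ring_iso A B. \<forall>c. \<forall>x\<in>carrier A. h (c \<odot>\<^bsub>A\<^esub> x) = c \<odot>\<^bsub>B\<^esub> h x}"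

definition subalg :: "'b set \<Rightarrow> ('a::field, 'b) module \<Rightarrow> bool" where
  "subalg H A \<longleftrightarrow> subring H A \<and> submodule H ground_field A"

abbreviation restrict_alg :: "('a::field, 'b) module \<Rightarrow> 'b set \<Rightarrow> ('a, 'b) module" where
  "restrict_alg A H \<equiv> A\<lparr>carrier := H\<rparr>"

definition quot_alg :: "('a::field, 'b) module \<Rightarrow> 'b set \<Rightarrow> ('a, 'b set) module" where
  "quot_alg A I =
    \<lparr>carrier = carrier (A Quot I), monoid.mult = (\<otimes>\<^bsub>A Quot I\<^esub>), one = \<one>\<^bsub>A Quot I\<^esub>,
     zero = \<zero>\<^bsub>A Quot I\<^esub>, add = (\<oplus>\<^bsub>A Quot I\<^esub>),
     module.smult = (\<lambda>c C. \<Union>x\<in>C. I +>\<^bsub>A\<^esub> (c \<odot>\<^bsub>A\<^esub> x))\<rparr>"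


section \<open>Truncated polynomial rings\<close>

text \<open>
  The variables are indexed by \<open>0, \<dots>, m - 1\<close>. A monomial is its finitely supported exponent
  function, so \<open>Poly_Mapping.single (Poly_Mapping.single i n) 1\<close> is the \<open>n\<close>-th power of the
  \<open>i\<close>-th variable.
\<close>

type_synonym 'a mpoly = "(nat \<Rightarrow>\<^sub>0 nat) \<Rightarrow>\<^sub>0 'a"

definition poly_alg :: "nat \<Rightarrow> ('a::field, 'a mpoly) module" where
  "poly_alg m =
    \<lparr>carrier = {f. \<forall>e\<in>Poly_Mapping.keys f. Poly_Mapping.keys e \<subseteq> {..<m}},
     monoid.mult = (*), one = 1, zero = 0, add = (+),
     module.smult = (\<lambda>c. Poly_Mapping.map ((*) c))\<rparr>"

definition trunc_poly :: "nat \<Rightarrow> ('a::field, 'a mpoly set) module" where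
  "trunc_poly m =
    quot_alg (poly_alg m)
      (genideal (poly_alg m)
        ((\<lambda>i. Poly_Mapping.single (Poly_Mapping.single i CHAR('a)) 1) ` {..<m}))"


section \<open>Derivations\<close>

definition derivations :: "('a::field, 'b) module \<Rightarrow> ('b \<Rightarrow> 'b) set" where
  "derivations A =
    {D \<in> carrier A \<rightarrow> carrier A.
      (\<forall>x\<in>carrier A. \<forall>y\<in>carrier A. D (x \<oplus>\<^bsub>A\<^esub> y) = D x \<oplus>\<^bsub>A\<^esub> D y) \<and>
      (\<forall>c. \<forall>x\<in>carrier A. D (c \<odot>\<^bsub>A\<^esub> x) = c \<odot>\<^bsub>A\<^esub> D x) \<and>
      (\<forall>x\<in>carrier A. \<forall>y\<in>carrier A.
        D (x \<otimes>\<^bsub>A\<^esub> y) = (D x \<otimes>\<^bsub>A\<^esub> y) \<oplus>\<^bsub>A\<^esub> (x \<otimes>\<^bsub>A\<^esub> D y))}"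

definition constants :: "('a::field, 'b) module \<Rightarrow> ('b \<Rightarrow> 'b) \<Rightarrow> 'b set" where
  "constants A D = {f \<in> carrier A. D f = \<zero>\<^bsub>A\<^esub>}"

definition scalars :: "('a::field, 'b) module \<Rightarrow> 'b set" where
  "scalars A = {c \<odot>\<^bsub>A\<^esub> \<one>\<^bsub>A\<^esub> | c. True}"

definition eigenvalues :: "('a::field, 'b) module \<Rightarrow> ('b \<Rightarrow> 'b) \<Rightarrow> 'a set" where
  "eigenvalues A D = {c. \<exists>v\<in>carrier A. v \<noteq> \<zero>\<^bsub>A\<^esub> \<and> D v = c \<odot>\<^bsub>A\<^esub> v}"

text \<open>
  In the next two definitions \<open>A\<close> is \<open>trunc_poly m\<close> or an isomorphic copy of it; the
  conditions are those for \<open>trunc_poly m\<close>, transported along any isomorphism.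
\<close>

definition regular_nilpotent :: "('a::field, 'b) module \<Rightarrow> nat \<Rightarrow> ('b \<Rightarrow> 'b) \<Rightarrow> bool" where
  "regular_nilpotent A m D \<longleftrightarrow>
    (\<exists>x\<in>carrier A. (D ^^ (CHAR('a) ^ m - 1)) x \<noteq> \<zero>\<^bsub>A\<^esub>) \<and>
    (\<forall>x\<in>carrier A. (D ^^ (CHAR('a) ^ m)) x = \<zero>\<^bsub>A\<^esub>)"

definition regular_semisimple :: "('a::field, 'b) module \<Rightarrow> nat \<Rightarrow> ('b \<Rightarrow> 'b) \<Rightarrow> bool" where
  "regular_semisimple A m D \<longleftrightarrow>
    finite (eigenvalues A D) \<and> card (eigenvalues A D) = CHAR('a) ^ m"


section \<open>Tensor products\<close>

text \<open>
  The tensor product of \<open>A\<close> and \<open>B\<close> is the free vector space on the set \<open>A \<times> B\<close>, with the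
  componentwise product of basis elements extended bilinearly, modulo the span of the
  bilinearity relators.
\<close>

definition free_tensor ::
    "('a::field, 'b) module \<Rightarrow> ('a, 'c) module \<Rightarrow> ('a, ('b \<times> 'c) \<Rightarrow>\<^sub>0 'a) module" where
  "free_tensor A B =
    \<lparr>carrier = {u. Poly_Mapping.keys u \<subseteq> carrier A \<times> carrier B},
     monoid.mult = (\<lambda>u v. \<Sum>k\<in>Poly_Mapping.keys u. \<Sum>l\<in>Poly_Mapping.keys v.
       Poly_Mapping.single (fst k \<otimes>\<^bsub>A\<^esub> fst l, snd k \<otimes>\<^bsub>B\<^esub> snd l)
         (Poly_Mapping.lookup u k * Poly_Mapping.lookup v l)),
     one = Poly_Mapping.single (\<one>\<^bsub>A\<^esub>, \<one>\<^bsub>B\<^esub>) 1, zero = 0, add = (+),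
     module.smult = (\<lambda>c. Poly_Mapping.map ((*) c))\<rparr>"

definition tensor_relators ::
    "('a::field, 'b) module \<Rightarrow> ('a, 'c) module \<Rightarrow> (('b \<times> 'c) \<Rightarrow>\<^sub>0 'a) set" where
  "tensor_relators A B =
    {Poly_Mapping.single (x \<oplus>\<^bsub>A\<^esub> x', y) 1 - Poly_Mapping.single (x, y) 1
        - Poly_Mapping.single (x', y) 1
      | x x' y. x \<in> carrier A \<and> x' \<in> carrier A \<and> y \<in> carrier B} \<union>
    {Poly_Mapping.single (x, y \<oplus>\<^bsub>B\<^esub> y') 1 - Poly_Mapping.single (x, y) 1
        - Poly_Mapping.single (x, y') 1
      | x y y'. x \<in> carrier A \<and> y \<in> carrier B \<and> y' \<in> carrier B} \<union>
    {Poly_Mapping.single (c \<odot>\<^bsub>A\<^esub> x, y) 1 - Poly_Mapping.single (x, y) c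
      | c x y. x \<in> carrier A \<and> y \<in> carrier B} \<union>
    {Poly_Mapping.single (x, c \<odot>\<^bsub>B\<^esub> y) 1 - Poly_Mapping.single (x, y) c
      | c x y. x \<in> carrier A \<and> y \<in> carrier B}"

definition tensor_kernel ::
    "('a::field, 'b) module \<Rightarrow> ('a, 'c) module \<Rightarrow> (('b \<times> 'c) \<Rightarrow>\<^sub>0 'a) set" where
  "tensor_kernel A B =
    (\<lambda>U. submodule U ground_field (free_tensor A B)) hull tensor_relators A B"

definition tensor ::
    "('a::field, 'b) module \<Rightarrow> ('a, 'c) module \<Rightarrow> ('a, (('b \<times> 'c) \<Rightarrow>\<^sub>0 'a) set) module" where
  "tensor A B = quot_alg (free_tensor A B) (tensor_kernel A B)"

text \<open>For linear endomorphisms \<open>f\<close> of \<open>A\<close> and \<open>g\<close> of \<open>B\<close>, the map \<open>f \<otimes> g\<close> on \<open>tensor A B\<close>.\<close>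

definition tensor_map ::
    "('a::field, 'b) module \<Rightarrow> ('a, 'c) module \<Rightarrow> ('b \<Rightarrow> 'b) \<Rightarrow> ('c \<Rightarrow> 'c) \<Rightarrow>
      (('b \<times> 'c) \<Rightarrow>\<^sub>0 'a) set \<Rightarrow> (('b \<times> 'c) \<Rightarrow>\<^sub>0 'a) set" where
  "tensor_map A B f g C =
    (\<Union>u\<in>C. tensor_kernel A B +>\<^bsub>free_tensor A B\<^esub>
      (\<Sum>k\<in>Poly_Mapping.keys u.
        Poly_Mapping.single (f (fst k), g (snd k)) (Poly_Mapping.lookup u k)))"

definition tensor_sum ::
    "('a::field, 'b) module \<Rightarrow> ('a, 'c) module \<Rightarrow> ('b \<Rightarrow> 'b) \<Rightarrow> ('c \<Rightarrow> 'c) \<Rightarrow>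
      (('b \<times> 'c) \<Rightarrow>\<^sub>0 'a) set \<Rightarrow> (('b \<times> 'c) \<Rightarrow>\<^sub>0 'a) set" where
  "tensor_sum A B f g t =
    tensor_map A B f id t \<oplus>\<^bsub>tensor A B\<^esub> tensor_map A B id g t"

text \<open>
  The multiplication map on the tensor product of two subalgebras of \<open>A\<close>, sending the class of
  \<open>x \<otimes> y\<close> to the product of \<open>x\<close> and \<open>y\<close>; it does not depend on the representative \<open>u \<in> C\<close>.
\<close>

definition mult_map :: "('a::field, 'b) module \<Rightarrow> (('b \<times> 'b) \<Rightarrow>\<^sub>0 'a) set \<Rightarrow> 'b" where
  "mult_map A C =
    the_elem
      ((\<lambda>u. \<Oplus>\<^bsub>A\<^esub>k\<in>Poly_Mapping.keys u.
          Poly_Mapping.lookup u k \<odot>\<^bsub>A\<^esub> (fst k \<otimes>\<^bsub>A\<^esub> snd k)) ` C)"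

definition tensor_decomposition ::
    "('a::field, 'b) module \<Rightarrow> 'b set \<Rightarrow> 'b set \<Rightarrow> bool" where
  "tensor_decomposition A B C \<longleftrightarrow>
    subalg B A \<and> subalg C A \<and>
    mult_map A \<in> alg_iso (tensor (restrict_alg A B) (restrict_alg A C)) A"

end

theory Submission
  imports Defs
begin

text \<open>
  Write \<open>p\<close> for the characteristic and \<open>N = p ^ m\<close> for the dimension of \<open>B_m\<close>. The derivation \<open>D\<close> is
  compared with its power \<open>\<Delta> = D ^ N\<close>. In characteristic \<open>p\<close> the Leibniz rule makes \<open>\<Delta>\<close> a
  derivation again, and \<open>(D - l) ^ N = \<Delta> - l ^ N\<close> makes \<open>\<Delta>\<close> diagonalizable: its eigenspaces \<open>E c\<close>
  are the generalized eigenspaces of \<open>D\<close>. As \<open>\<Delta>\<close> is a derivation they grade the algebra,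
  \<open>E c * E d \<subseteq> E (c + d)\<close>.

  The main point is that coordinates can be chosen compatibly with this grading. Homogeneous
  elements span \<open>B_m\<close>, so after subtraction of constants they span the maximal ideal modulo
  its square, and \<open>m\<close> of them generate the algebra (\<open>exists_generators\<close>, a form of Nakayama's
  lemma). Before the subtraction they are homogeneous, and their power products with exponents
  below \<open>p\<close> form a basis of weight vectors. The weight of a power product is additive in the
  exponents, and these matter only modulo \<open>p\<close>; hence all nonempty fibres of the weight map have
  the same size. So the nonzero \<open>E c\<close> all have dimension \<open>p ^ r\<close>, and there are \<open>p ^ (m - r)\<close> of
  them (\<open>eigenspace_dimensions\<close>).

  On \<open>E 0\<close> the derivation \<open>D\<close> is nilpotent, and its kernel consists of the constants. So \<open>D\<close> is
  a single Jordan block there, which is regular nilpotency, and every nonzero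
  \<open>D\<close>-stable subspace of \<open>E 0\<close> contains \<open>1\<close>. Consequently multiplication by an
  eigenvector \<open>u \<in> E c\<close> of \<open>D\<close> is injective on \<open>E 0\<close>, and comparing dimensions gives
  \<open>E c = E 0 * u\<close>. Let \<open>C\<close> be the span of all eigenvectors of \<open>D\<close>: it is a subalgebra on which \<open>D\<close>
  has one eigenvalue for each nonzero \<open>E c\<close>, and \<open>E 0\<close> and \<open>C\<close> together generate the algebra as
  a tensor product. Both derivations of the statement are restrictions of \<open>D\<close>.

  It remains to see that \<open>E 0\<close> and \<open>C\<close> are truncated polynomial rings. The maximal ideals of
  the two factors span the maximal ideal modulo its square, so \<open>exists_generators\<close> selects
  generators from them, at most \<open>m\<close> altogether. Elements of the maximal ideal have vanishing \<open>p\<close>-th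
  power, so \<open>a\<close> of them generate a subalgebra of dimension at most \<open>p ^ a\<close>. The dimensions
  \<open>p ^ r\<close> and \<open>p ^ (m - r)\<close> therefore leave no choice: exactly \<open>r\<close> generators lie in \<open>E 0\<close> and \<open>m - r\<close>
  in \<open>C\<close>, and they are truncated coordinates of \<open>E 0\<close> and \<open>C\<close> (\<open>splitting\<close>).

  All of this is linear algebra in a vector space with a commutative multiplication, and it is
  carried out for a subalgebra \<open>B\<close> of a ring that is a type. Such a ring is the group algebra of an
  infinite elementary abelian \<open>p\<close>-group: if \<open>g\<close> is a group element then \<open>(g - 1) ^ p = 0\<close>, so it
  contains the truncated polynomial rings in any number of variables (\<open>host_coordinates\<close>). The
  predicate \<open>represents\<close> identifies a record algebra with a subalgebra of the host; quotients
  and tensor products are recognized by the kernel of an evaluation map.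
\<close>

section \<open>Linear algebra in finitely spanned subspaces\<close>

context vector_space
begin

text \<open>
  In this section the dimension theory of \<open>finite_dimensional_vector_space\<close> is redone for
  subspaces with a finite spanning set, because the whole space will have infinite dimension.
\<close>

lemma card_le_dim_of_independent:
  assumes "independent S" "S \<subseteq> V" "V \<subseteq> span T" "finite T"
  shows "finite S \<and> card S \<le> dim V"
proof -
  obtain E where E: "E \<subseteq> V" "independent E" "V \<subseteq> span E" "card E = dim V"
    using basis_exists by blast
  have "finite E" using independent_span_bound[OF assms(4) E(2)] E assms by blast
  then show ?thesis using independent_span_bound[of E S] assms E by (metis subset_trans)
qed

lemma dim_mono_finite_span:
  assumes "V \<subseteq> W" "W \<subseteq> span T" "finite T"
  shows "dim V \<le> dim W"
  by (metis assms basis_exists card_le_dim_of_independent order_trans)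

lemma independent_of_card_le_dim:
  assumes "S \<subseteq> V" "V \<subseteq> span S" "finite S" "card S \<le> dim V"
  shows "independent S"
proof -
  obtain E where E: "E \<subseteq> S" "independent E" "S \<subseteq> span E"
    using maximal_independent_subset by blast
  have "V \<subseteq> span E" using E assms span_mono span_span by (metis subset_trans)
  then have "card E = dim V" using basis_card_eq_dim E assms by blast
  then have "E = S" using E assms by (metis card_seteq)
  then show ?thesis using E by simp
qed

lemma spans_of_dim_le_card:
  assumes "independent S" "S \<subseteq> V" "V \<subseteq> span T" "finite T" "dim V \<le> card S"
  shows "V \<subseteq> span S"
proof -
  obtain E where E: "S \<subseteq> E" "E \<subseteq> V" "independent E" "V \<subseteq> span E"
    using maximal_independent_subset_extend[OF assms(2,1)] by blast
  have "finite E" "card E \<le> dim V" using card_le_dim_of_independent E assms by blast+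
  then have "S = E" using E assms by (metis card_seteq order_trans)
  then show ?thesis using E by simp
qed

lemma subspace_eq_of_dim_le:
  assumes "subspace V" "V \<subseteq> W" "W \<subseteq> span T" "finite T" "dim W \<le> dim V"
  shows "V = W"
proof -
  obtain E where E: "E \<subseteq> V" "independent E" "V \<subseteq> span E" "card E = dim V"
    using basis_exists by blast
  have "W \<subseteq> span E" using spans_of_dim_le_card[of E W T] E assms by auto
  then show ?thesis using E assms span_minimal by blast
qed

lemma sum_scale_image:
  assumes "finite I" "inj_on b I"
  shows "(\<Sum>i\<in>I. scale (c i) (b i)) = (\<Sum>v\<in>b ` I. scale (c (inv_into I b v)) v)"
  by (subst sum.reindex[OF assms(2)]) (auto intro!: sum.cong simp: assms(2))

text \<open>
  Indexed families avoid having to treat coinciding members separately: a family whose span has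
  at least as large a dimension as its index set is automatically injective.
\<close>

lemma family_independent:
  assumes "finite I" "card I \<le> dim (span (b ` I))"
  shows "inj_on b I" "independent (b ` I)"
    and "(\<Sum>i\<in>I. scale (c i) (b i)) = 0 \<Longrightarrow> i \<in> I \<Longrightarrow> c i = 0"
proof -
  have d: "dim (span (b ` I)) \<le> card (b ` I)" using dim_le_card[of "span (b ` I)" "b ` I"] assms by auto
  then show inj: "inj_on b I"
    using assms card_image_le[OF assms(1), of b] by (intro eq_card_imp_inj_on) auto
  show ind: "independent (b ` I)"
    using independent_of_card_le_dim[of "b ` I" "span (b ` I)"] assms span_superset inj
    by (simp add: card_image)
  show "c i = 0" if s: "(\<Sum>i\<in>I. scale (c i) (b i)) = 0" and i: "i \<in> I"
  proof -
    have "c (inv_into I b (b i)) = 0"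
      by (rule independentD[OF ind, of "b ` I"])
         (use s i assms sum_scale_image[OF assms(1) inj] in auto)
    then show ?thesis using i inj by simp
  qed
qed

lemma dim_span_family:
  assumes "finite I" "\<And>c. (\<Sum>i\<in>I. scale (c i) (b i)) = 0 \<Longrightarrow> \<forall>i\<in>I. c i = 0"
  shows "dim (span (b ` I)) = card I"
proof -
  have inj: "inj_on b I"
  proof (rule inj_onI, rule ccontr)
    fix i j assume ij: "i \<in> I" "j \<in> I" "b i = b j" "i \<noteq> j"
    define c :: "'c \<Rightarrow> 'a" where "c = (\<lambda>k. if k = i then 1 else if k = j then -1 else 0)"
    have "(\<Sum>k\<in>I. scale (c k) (b k)) = (\<Sum>k\<in>{i,j}. scale (c k) (b k))"
      by (rule sum.mono_neutral_right) (use assms ij in \<open>auto simp: c_def\<close>)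
    also have "\<dots> = 0" using ij by (auto simp: c_def)
    finally show False using assms(2)[of c] ij by (auto simp: c_def)
  qed
  have "independent (b ` I)"
  proof (rule independent_if_scalars_zero)
    fix f v assume s: "(\<Sum>x\<in>b ` I. scale (f x) x) = 0" and v: "v \<in> b ` I"
    have "(\<Sum>i\<in>I. scale (f (b i)) (b i)) = 0" using s by (simp add: sum.reindex[OF inj])
    then show "f v = 0" using assms(2)[of "\<lambda>i. f (b i)"] v by auto
  qed (use assms in auto)
  then show ?thesis by (simp add: dim_eq_card_independent card_image inj)
qed

lemma span_family:
  assumes "finite I"
  shows "v \<in> span (b ` I) \<longleftrightarrow> (\<exists>c. v = (\<Sum>i\<in>I. scale (c i) (b i)))"
proof
  assume "v \<in> span (b ` I)"
  then show "\<exists>c. v = (\<Sum>i\<in>I. scale (c i) (b i))"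
  proof (induction rule: span_induct_alt)
    case base
    then show ?case by (intro exI[of _ "\<lambda>_. 0"]) auto
  next
    case (step k x y)
    then obtain c i where c: "y = (\<Sum>i\<in>I. scale (c i) (b i))" and i: "i \<in> I" "x = b i" by auto
    have *: "scale k x + y = (\<Sum>j\<in>I. scale ((if j = i then k else 0) + c j) (b j))"
    proof -
      have "(\<Sum>j\<in>I. scale (if j = i then k else 0) (b j)) = (\<Sum>j\<in>I. if j = i then scale k (b j) else 0)"
        by (rule sum.cong) auto
      then show ?thesis using i assms by (simp add: c scale_left_distrib sum.distrib)
    qed
    show ?case by (rule exI) (fact *)
  qed
qed (auto intro!: span_sum span_scale intro: span_base)

end

section \<open>Power products and truncated coordinates\<close>

abbreviation keys where "keys \<equiv> Poly_Mapping.keys"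
abbreviation lookup where "lookup \<equiv> Poly_Mapping.lookup"
abbreviation single where "single \<equiv> Poly_Mapping.single"

definition power_product :: "(nat \<Rightarrow> 'u::comm_ring_1) \<Rightarrow> (nat \<Rightarrow>\<^sub>0 nat) \<Rightarrow> 'u" where
  "power_product x e = (\<Prod>i\<in>keys e. x i ^ lookup e i)"

definition total_deg :: "(nat \<Rightarrow>\<^sub>0 nat) \<Rightarrow> nat" where
  "total_deg e = (\<Sum>i\<in>keys e. lookup e i)"

text \<open>
  The exponents of the standard monomial basis of \<open>B_m\<close>.
\<close>

definition reduced :: "nat \<Rightarrow> nat \<Rightarrow> (nat \<Rightarrow>\<^sub>0 nat) set" where
  "reduced p m = {e. keys e \<subseteq> {..<m} \<and> (\<forall>i. lookup e i < p)}"

lemma power_product_superset: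
  assumes "finite I" "keys e \<subseteq> I"
  shows "power_product x e = (\<Prod>i\<in>I. x i ^ lookup e i)"
  unfolding power_product_def
  by (rule prod.mono_neutral_left) (use assms in \<open>auto simp: in_keys_iff\<close>)

lemma total_deg_superset:
  assumes "finite I" "keys e \<subseteq> I"
  shows "total_deg e = (\<Sum>i\<in>I. lookup e i)"
  unfolding total_deg_def
  by (rule sum.mono_neutral_left) (use assms in \<open>auto simp: in_keys_iff\<close>)

lemma keys_add_nat:
  "keys (e + f :: nat \<Rightarrow>\<^sub>0 nat) = keys e \<union> keys f"
  by (auto simp: in_keys_iff lookup_add)

lemma power_product_add: "power_product x (e + f) = power_product x e * power_product x f"
proof -
  let ?I = "keys e \<union> keys f"
  show ?thesis
    by (simp add: power_product_superset[of ?I] keys_add_nat lookup_add power_add prod.distrib)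
qed

lemma total_deg_add: "total_deg (e + f) = total_deg e + total_deg f"
proof -
  let ?I = "keys e \<union> keys f"
  show ?thesis
    by (simp add: total_deg_superset[of ?I] keys_add_nat lookup_add sum.distrib)
qed

lemma power_product_0 [simp]: "power_product x 0 = 1"
  by (simp add: power_product_def)

lemma power_product_single [simp]: "power_product x (single i n) = x i ^ n"
  by (simp add: power_product_superset[of "{i}"])

lemma total_deg_single [simp]: "total_deg (single i n) = n"
  by (simp add: total_deg_superset[of "{i}"])

lemma total_deg_eq_0_iff: "total_deg e = 0 \<longleftrightarrow> e = 0"
  by (auto simp: total_deg_def in_keys_iff intro: poly_mapping_eqI)

lemma reduced_index_less: "e \<in> reduced p m \<Longrightarrow> i \<in> keys e \<Longrightarrow> i < m"
  by (auto simp: reduced_def)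

lemma keys_add_reduced:
  "e \<in> reduced p m \<Longrightarrow> f \<in> reduced q m \<Longrightarrow> keys (e + f) \<subseteq> {..<m}"
  by (auto simp: reduced_def keys_add_nat)

lemma zero_mem_reduced [simp]: "p > 0 \<Longrightarrow> 0 \<in> reduced p m"
  by (simp add: reduced_def)

lemma bij_betw_reduced_PiE:
  assumes "p > 0"
  shows "bij_betw (\<lambda>e. restrict (lookup e) {..<m}) (reduced p m) ({..<m} \<rightarrow>\<^sub>E {..<p})"
proof (rule bij_betw_byWitness[where f' = "\<lambda>f. Abs_poly_mapping (\<lambda>i. if i < m then f i else 0)"])
  have l: "lookup (Abs_poly_mapping (\<lambda>i. if i < m then f i else 0)) = (\<lambda>i. if i < m then f i else 0)"
    for f :: "nat \<Rightarrow> nat" by (rule lookup_Abs_poly_mapping) (auto intro: finite_subset[of _ "{..<m}"])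
  show "\<forall>e\<in>reduced p m. Abs_poly_mapping (\<lambda>i. if i < m then restrict (lookup e) {..<m} i else 0) = e"
  proof (intro ballI poly_mapping_eqI)
    fix e k assume "e \<in> reduced p m"
    then have "k \<ge> m \<Longrightarrow> lookup e k = 0"
      by (auto simp: reduced_def in_keys_iff subset_iff not_less)
    then show "lookup (Abs_poly_mapping (\<lambda>i. if i < m then restrict (lookup e) {..<m} i else 0)) k = lookup e k"
      by (auto simp: l)
  qed
  show "\<forall>f\<in>{..<m} \<rightarrow>\<^sub>E {..<p}. restrict (lookup (Abs_poly_mapping (\<lambda>i. if i < m then f i else 0))) {..<m} = f"
    by (auto simp: l PiE_def extensional_def restrict_def)
  show "(\<lambda>e. restrict (lookup e) {..<m}) ` reduced p m \<subseteq> {..<m} \<rightarrow>\<^sub>E {..<p}"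
    by (rule image_subsetI, rule PiE_I) (auto simp: reduced_def)
  show "(\<lambda>f. Abs_poly_mapping (\<lambda>i. if i < m then f i else 0)) ` ({..<m} \<rightarrow>\<^sub>E {..<p}) \<subseteq> reduced p m"
    using assms by (auto simp: reduced_def l in_keys_iff PiE_def Pi_def split: if_splits)
qed

lemma finite_reduced [simp]: "p > 0 \<Longrightarrow> finite (reduced p m)"
  by (simp add: bij_betw_finite[OF bij_betw_reduced_PiE] finite_PiE)

lemma card_reduced: "p > 0 \<Longrightarrow> card (reduced p m) = p ^ m"
  by (simp add: bij_betw_same_card[OF bij_betw_reduced_PiE] card_PiE)

lemma total_deg_reduced: "e \<in> reduced p m \<Longrightarrow> total_deg e \<le> m * p"
  using sum_mono[of "{..<m}" "lookup e" "\<lambda>_. p"]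
  by (auto simp: reduced_def total_deg_superset[of "{..<m}"] less_imp_le)

text \<open>
  An algebra over a field, given by its scalar multiplication on a type of commutative rings.
  Associativity and distributivity come from the type, so only compatibility is assumed.
\<close>

locale commutative_algebra = vector_space scale
  for scale :: "'a::field \<Rightarrow> 'u::comm_ring_1 \<Rightarrow> 'u" (infixr \<open>*s\<close> 75) +
  assumes scale_mult_left: "(c *s x) * y = c *s (x * y)"
begin

lemma scale_mult_right: "x * (c *s y) = c *s (x * y)"
  by (metis mult.commute scale_mult_left)

lemmas scale_mult = scale_mult_left scale_mult_right

lemma scale_power: "(c *s x) ^ n = (c ^ n) *s (x ^ n)"
  by (induction n) (simp_all add: scale_mult_left scale_mult_right)

lemma scale_prod: "(\<Prod>i\<in>I. c i *s v i) = (\<Prod>i\<in>I. c i) *s (\<Prod>i\<in>I. v i)"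
  by (induction I rule: infinite_finite_induct) (simp_all add: scale_mult)

lemma of_nat_eq_scale: "of_nat n = of_nat n *s (1::'u)"
  by (induction n) (simp_all add: scale_left_distrib)

text \<open>
  The ring contains the field, so the field's prime also governs its Frobenius map.
\<close>

lemma CHAR_eq: "CHAR('u) = CHAR('a)"
proof (rule CHAR_eqI)
  show "of_nat CHAR('a) = (0::'u)" by (subst of_nat_eq_scale) simp
  show "CHAR('a) dvd n" if "of_nat n = (0::'u)" for n
    using that by (subst (asm) of_nat_eq_scale) (simp add: of_nat_eq_0_iff_char_dvd)
qed

definition unital_subalgebra :: "'u set \<Rightarrow> bool" where
  "unital_subalgebra H \<longleftrightarrow> subspace H \<and> 1 \<in> H \<and> (\<forall>x\<in>H. \<forall>y\<in>H. x * y \<in> H)"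

lemma unital_subalgebraD:
  assumes "unital_subalgebra H"
  shows "subspace H" "1 \<in> H" "x \<in> H \<Longrightarrow> y \<in> H \<Longrightarrow> x * y \<in> H"
  using assms by (auto simp: unital_subalgebra_def)

lemma power_product_mem:
  assumes "unital_subalgebra H" "\<And>i. i \<in> keys e \<Longrightarrow> x i \<in> H"
  shows "power_product x e \<in> H"
proof -
  have pw: "a ^ n \<in> H" if "a \<in> H" for a n
    using that unital_subalgebraD[OF assms(1)] by (induction n) auto
  have "finite I \<Longrightarrow> (\<forall>i\<in>I. f i \<in> H) \<Longrightarrow> prod f I \<in> H" for I :: "nat set" and f
    by (induction I rule: finite_induct) (use unital_subalgebraD[OF assms(1)] in auto)
  then show ?thesis using assms(2) pw by (simp add: power_product_def)
qed

lemma span_mult_mem: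
  assumes "a \<in> span S" "b \<in> span T" "subspace V" "\<And>s t. s \<in> S \<Longrightarrow> t \<in> T \<Longrightarrow> s * t \<in> V"
  shows "a * b \<in> V"
  using assms(1)
proof (induction rule: span_induct_alt)
  case base
  then show ?case using assms(3) by (simp add: subspace_0)
next
  case (step c s y)
  have "s * b \<in> V" using assms(2)
  proof (induction rule: span_induct_alt)
    case base
    then show ?case using assms(3) by (simp add: subspace_0)
  next
    case (step d t z)
    then show ?case using assms(3,4) \<open>s \<in> S\<close>
      by (auto simp: distrib_left scale_mult subspace_add subspace_scale)
  qed
  then show ?case using step assms(3)
    by (auto simp: distrib_right scale_mult subspace_add subspace_scale)
qed

text \<open>
  If the \<open>q\<close>-th powers of the generators are scalars, exponents can be reduced modulo \<open>q\<close> at the cost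
  of a scalar factor. For coordinates of the maximal ideal these scalars vanish; for homogeneous
  generators, which need not lie in that ideal, they usually do not.
\<close>

lemma power_product_reduce:
  assumes "\<And>i. i < m \<Longrightarrow> \<exists>c. y i ^ q = c *s 1" "q > 0" "keys e \<subseteq> {..<m}"
  shows "power_product y e \<in> span (power_product y ` reduced q m)"
proof -
  obtain c where c: "\<And>i. i < m \<Longrightarrow> y i ^ q = c i *s 1" using assms(1) by metis
  define e' where "e' = Poly_Mapping.map (\<lambda>n. n mod q) e"
  have l: "lookup e' i = lookup e i mod q" for i
    by (cases "lookup e i = 0") (auto simp: e'_def Poly_Mapping.map.rep_eq)
  have "keys e' \<subseteq> keys e"
    by (rule subsetI) (metis in_keys_iff l mod_0)
  then have k: "keys e' \<subseteq> {..<m}" using assms(3) by blast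
  have "e' \<in> reduced q m" using k assms(2) by (auto simp: reduced_def l)
  have pw: "y i ^ n = (c i ^ (n div q)) *s y i ^ (n mod q)" if "i < m" for i n
  proof -
    have "y i ^ n = (y i ^ q) ^ (n div q) * y i ^ (n mod q)"
      by (simp flip: power_mult power_add)
    then show ?thesis using c[OF that] by (simp add: scale_power scale_mult_left)
  qed
  have "power_product y e = (\<Prod>i<m. y i ^ lookup e i)"
    using assms(3) by (simp add: power_product_superset)
  also have "\<dots> = (\<Prod>i<m. (c i ^ (lookup e i div q)) *s y i ^ lookup e' i)"
    unfolding l by (rule prod.cong[OF refl], rule pw) simp
  also have "\<dots> = (\<Prod>i<m. c i ^ (lookup e i div q)) *s power_product y e'"
    using k by (simp add: scale_prod power_product_superset[of "{..<m}"])
  finally show ?thesis using \<open>e' \<in> reduced q m\<close> by (auto intro: span_scale span_base)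
qed

lemma reduced_span_subalgebra:
  assumes "\<And>i. i < m \<Longrightarrow> \<exists>c. y i ^ q = c *s 1" "q > 0"
  shows "unital_subalgebra (span (power_product y ` reduced q m))"
    and "i < m \<Longrightarrow> y i \<in> span (power_product y ` reduced q m)"
proof -
  let ?V = "span (power_product y ` reduced q m)"
  have red: "power_product y e \<in> ?V" if "keys e \<subseteq> {..<m}" for e
    using power_product_reduce[OF assms(1,2) that] .
  have mult: "a * b \<in> ?V" if "a \<in> ?V" "b \<in> ?V" for a b
  proof (rule span_mult_mem[OF that subspace_span])
    fix s t assume "s \<in> power_product y ` reduced q m" "t \<in> power_product y ` reduced q m"
    then show "s * t \<in> ?V" using red[OF keys_add_reduced] by (auto simp: power_product_add)
  qed
  have "1 \<in> ?V" using red[of 0] by simp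
  then show "unital_subalgebra ?V"
    using mult unfolding unital_subalgebra_def by blast
  show "y i \<in> ?V" if "i < m"
  proof -
    have "keys (single i (1::nat)) \<subseteq> {..<m}" using that by simp
    from red[OF this] show ?thesis by simp
  qed
qed

lemma reduced_span_minimal:
  assumes "unital_subalgebra A" "\<And>i. i < m \<Longrightarrow> y i \<in> A"
  shows "span (power_product y ` reduced q m) \<subseteq> A"
  using assms by (intro span_minimal) (auto dest: reduced_index_less intro!: power_product_mem unital_subalgebraD(1))

lemma dim_reduced_span_le: "q > 0 \<Longrightarrow> dim (span (power_product y ` reduced q m)) \<le> q ^ m"
  by (metis card_image_le card_reduced dim_le_card finite_imageI finite_reduced order_refl order_trans)

text \<open>
  \<open>H\<close> is a truncated polynomial ring in \<open>x 0, \<dots>, x (m - 1)\<close>: the dimension forces the \<open>p ^ m\<close> reduced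
  power products, which span \<open>H\<close>, to be linearly independent.
\<close>

definition truncated_coordinates :: "nat \<Rightarrow> (nat \<Rightarrow> 'u) \<Rightarrow> 'u set \<Rightarrow> bool" where
  "truncated_coordinates m x H \<longleftrightarrow> (\<forall>i<m. x i ^ CHAR('a) = 0) \<and>
     H = span (power_product x ` reduced CHAR('a) m) \<and> dim H = CHAR('a) ^ m"

end

locale truncated_algebra = commutative_algebra scale
  for scale :: "'a::field \<Rightarrow> 'u::comm_ring_1 \<Rightarrow> 'u" (infixr \<open>*s\<close> 75) +
  fixes p m :: nat and x :: "nat \<Rightarrow> 'u" and B :: "'u set"
  assumes coordinates: "truncated_coordinates m x B"
    and p_eq: "p = CHAR('a)" and prime_p: "prime p"
begin

lemma p_pos [simp]: "p > 0"
  using prime_p prime_gt_0_nat by blast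

lemma x_power: "i < m \<Longrightarrow> x i ^ p = 0"
  and B_eq: "B = span (power_product x ` reduced p m)"
  and dim_B: "dim B = p ^ m"
  using coordinates by (auto simp: truncated_coordinates_def p_eq)

lemma B_subalgebra: "unital_subalgebra B"
  unfolding B_eq by (rule reduced_span_subalgebra(1)) (auto simp: x_power intro!: exI[of _ 0])

lemma x_mem: "i < m \<Longrightarrow> x i \<in> B"
  unfolding B_eq by (rule reduced_span_subalgebra(2)) (auto simp: x_power intro!: exI[of _ 0])

lemmas B_subspace = unital_subalgebraD(1)[OF B_subalgebra]
lemmas one_mem = unital_subalgebraD(2)[OF B_subalgebra]
lemmas mult_mem = unital_subalgebraD(3)[OF B_subalgebra]

lemma B_finite_span: obtains T where "finite T" "B \<subseteq> span T"
  by (metis B_eq finite_imageI finite_reduced order_refl p_pos)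

lemma subspace_eq: "subspace V \<Longrightarrow> subspace W \<Longrightarrow> V \<subseteq> W \<Longrightarrow> W \<subseteq> B \<Longrightarrow> dim W \<le> dim V \<Longrightarrow> V = W"
  by (metis B_finite_span order_trans subspace_eq_of_dim_le)

text \<open>
  The powers of the maximal ideal, described by the total degree in the given coordinates.
\<close>

definition filtration :: "nat \<Rightarrow> 'u set" where
  "filtration k = span (power_product x ` {e \<in> reduced p m. k \<le> total_deg e})"

lemma filtration_subspace [simp]: "subspace (filtration k)"
  by (simp add: filtration_def)

lemma filtration_0: "filtration 0 = B"
  by (simp add: filtration_def B_eq)

lemma filtration_antimono: "k \<le> l \<Longrightarrow> filtration l \<subseteq> filtration k"
  unfolding filtration_def by (intro span_mono) auto

lemma filtration_le_B: "filtration k \<subseteq> B"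
  using filtration_antimono[of 0 k] filtration_0 by simp

lemma filtration_eq_0: "k > m * p \<Longrightarrow> filtration k = {0}"
proof -
  assume "k > m * p"
  then have "{e \<in> reduced p m. k \<le> total_deg e} = {}" using total_deg_reduced[of _ p m] by fastforce
  then show ?thesis unfolding filtration_def by (simp only: image_empty span_empty)
qed

lemma power_product_mem_filtration:
  assumes "keys e \<subseteq> {..<m}" "k \<le> total_deg e"
  shows "power_product x e \<in> filtration k"
proof (cases "e \<in> reduced p m")
  case True
  then show ?thesis using assms by (auto simp: filtration_def intro: span_base)
next
  case False
  then obtain i where i: "lookup e i \<ge> p" using assms by (auto simp: reduced_def not_less)
  then have "i \<in> keys e" using p_pos by (simp add: in_keys_iff del: p_pos)
  then have "x i ^ p = 0" using assms x_power by auto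
  then have "x i ^ lookup e i = 0" using i by (metis le_iff_add mult_zero_left power_add)
  then have "power_product x e = 0"
    using \<open>i \<in> keys e\<close> unfolding power_product_def by (metis finite_keys prod_zero)
  then show ?thesis by (simp add: subspace_0)
qed

lemma filtration_mult:
  assumes "a \<in> filtration k" "b \<in> filtration l"
  shows "a * b \<in> filtration (k + l)"
  by (rule span_mult_mem[OF assms[unfolded filtration_def]])
     (auto simp flip: power_product_add simp: total_deg_add
        intro!: power_product_mem_filtration[OF keys_add_reduced])

lemma x_mem_filtration: "i < m \<Longrightarrow> x i \<in> filtration 1"
  using power_product_mem_filtration[of "single i 1" 1] by simp

lemma reduced_decompose:
  assumes "e \<in> reduced p m" "total_deg e = Suc k"
  obtains i e' where "i < m" "e = single i 1 + e'" "e' \<in> reduced p m" "total_deg e' = k"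
proof -
  have "e \<noteq> 0" using assms(2) total_deg_eq_0_iff[of e] by auto
  then obtain i where i: "lookup e i \<noteq> 0" by (metis lookup_zero poly_mapping_eqI)
  define e' where "e' = e - single i 1"
  have e: "e = single i 1 + e'"
    using i by (intro poly_mapping_eqI) (auto simp: e'_def lookup_add lookup_minus lookup_single when_def)
  have "total_deg e' = k" using assms(2) by (subst (asm) e) (simp add: total_deg_add)
  moreover have "i < m" using i assms(1) reduced_index_less by (simp add: in_keys_iff)
  moreover have "lookup e' j \<le> lookup e j" for j
    by (simp add: e'_def lookup_minus)
  then have "e' \<in> reduced p m" using assms(1)
    unfolding reduced_def by (auto simp: in_keys_iff subset_iff intro: le_less_trans) (metis less_le_trans)
  ultimately show ?thesis using that e by blast
qed

text \<open>
  The algebra is local with residue field the ground field: \<open>filtration 1\<close> is the maximal ideal.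
\<close>

lemma mem_decompose_scalar: "b \<in> B \<Longrightarrow> \<exists>c. b - c *s 1 \<in> filtration 1"
  unfolding B_eq
proof (induction rule: span_induct_alt)
  case base
  then show ?case by (auto intro!: exI[of _ 0] simp: subspace_0)
next
  case (step k v y)
  then obtain c where c: "y - c *s 1 \<in> filtration 1" by blast
  from step obtain e where e: "e \<in> reduced p m" "v = power_product x e" by auto
  show ?case
  proof (cases "e = 0")
    case True
    then show ?thesis using c e by (auto simp: algebra_simps intro!: exI[of _ "c + k"])
  next
    case False
    then have "v \<in> filtration 1" using e total_deg_eq_0_iff[of e]
      by (auto intro!: power_product_mem_filtration simp: reduced_def)
    then have "k *s v + (y - c *s 1) \<in> filtration 1" using c by (simp add: subspace_add subspace_scale)
    then show ?thesis by (auto simp: algebra_simps intro!: exI[of _ c])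
  qed
qed

text \<open>
  The Frobenius map is additive, so it is enough that it kills the monomials without constant
  term.
\<close>

lemma filtration_1_power: "a \<in> filtration 1 \<Longrightarrow> a ^ p = 0"
  unfolding filtration_def
proof (induction rule: span_induct_alt)
  case base
  then show ?case by (simp add: zero_power)
next
  case (step k v y)
  then obtain e where e: "e \<in> reduced p m" "1 \<le> total_deg e" "v = power_product x e" by auto
  then have "e \<noteq> 0" by (auto simp: total_deg_def)
  then obtain i where i: "i \<in> keys e" by (metis ex_in_conv keys_eq_empty)
  then have "i < m" "lookup e i > 0" using e reduced_index_less by (auto simp: in_keys_iff)
  then have "(x i ^ lookup e i) ^ p = 0"
    using x_power[of i] power_mult[of "x i"] mult.commute[of p] zero_power by metis
  then have "v ^ p = 0" using i unfolding e(3) power_product_def prod_power_distrib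
    by (metis (no_types, lifting) finite_keys prod_zero)
  then show ?case using step
    using freshmans_dream[of p "k *s v" y] prime_p by (simp add: scale_power CHAR_eq p_eq)
qed

end

section \<open>Choosing generators in the maximal ideal\<close>

context truncated_algebra
begin

lemma scalar_mem_filtration_1: "c *s 1 \<in> filtration 1 \<Longrightarrow> c = 0"
  using filtration_1_power[of "c *s 1"] by (simp add: scale_power)

text \<open>
  The \<open>p\<close>-th power only depends on the residue modulo the maximal ideal.
\<close>

lemma power_p_scalar: "b \<in> B \<Longrightarrow> \<exists>c. b ^ p = c *s 1"
proof -
  assume "b \<in> B"
  then obtain c where c: "b - c *s 1 \<in> filtration 1" using mem_decompose_scalar by blast
  have "b ^ p = ((b - c *s 1) + c *s 1) ^ p" by simp
  also have "\<dots> = (b - c *s 1) ^ p + (c *s 1) ^ p"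
    by (rule freshmans_dream) (use prime_p in \<open>auto simp: CHAR_eq p_eq\<close>)
  also have "\<dots> = (c ^ p) *s 1" using filtration_1_power[OF c] by (simp add: scale_power)
  finally show ?thesis by blast
qed

text \<open>
  The inductive step of Nakayama's lemma: if a subalgebra contains the maximal ideal up to its
  square, then it also contains each power of the ideal up to the next one. A monomial of degree
  \<open>k + 1\<close> is a variable times a monomial of degree \<open>k\<close>, and both factors can be replaced by
  elements of the subalgebra, with an error of higher degree.
\<close>

lemma filtration_step:
  assumes A: "unital_subalgebra A"
    and gen: "\<And>b. b \<in> filtration 1 \<Longrightarrow> \<exists>a\<in>A \<inter> filtration 1. b - a \<in> filtration 2"
    and "k \<ge> 1" "b \<in> filtration k"
  shows "\<exists>a\<in>A \<inter> filtration k. b - a \<in> filtration (Suc k)"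
  using assms(3,4)
proof (induction k arbitrary: b rule: dec_induct)
  case base
  then show ?case using gen by (simp add: numeral_2_eq_2)
next
  case (step k)
  have sA: "subspace A" using A by (rule unital_subalgebraD)
  note IH = step.IH
  from step.prems show ?case unfolding filtration_def[of "Suc k"]
  proof (induction rule: span_induct_alt)
    case base
    then show ?case using sA by (auto intro!: bexI[of _ 0] simp: subspace_0 span_zero)
  next
    case (step c v y)
    then obtain a where a: "a \<in> A" "a \<in> filtration (Suc k)" "y - a \<in> filtration (Suc (Suc k))"
      by (auto simp: filtration_def)
    from step obtain e where e: "e \<in> reduced p m" "Suc k \<le> total_deg e" "v = power_product x e" by auto
    have "\<exists>a'\<in>A \<inter> filtration (Suc k). v - a' \<in> filtration (Suc (Suc k))"
    proof (cases "total_deg e = Suc k")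
      case False
      then have "v \<in> filtration (Suc (Suc k))"
        using e by (auto intro!: power_product_mem_filtration simp: reduced_def)
      then show ?thesis using sA by (auto intro!: bexI[of _ 0] simp: subspace_0)
    next
      case True
      then obtain i e' where ie: "i < m" "e = single i 1 + e'" "e' \<in> reduced p m" "total_deg e' = k"
        using reduced_decompose e by metis
      let ?w = "power_product x e'"
      have w: "?w \<in> filtration k" using ie by (auto intro!: power_product_mem_filtration simp: reduced_def)
      then obtain a2 where a2: "a2 \<in> A" "a2 \<in> filtration k" "?w - a2 \<in> filtration (Suc k)"
        using IH by blast
      obtain a1 where a1: "a1 \<in> A" "a1 \<in> filtration 1" "x i - a1 \<in> filtration 2"
        using gen x_mem_filtration ie by blast
      have "(x i - a1) * ?w \<in> filtration (2 + k)" "a1 * (?w - a2) \<in> filtration (1 + Suc k)"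
        using filtration_mult a1 a2 w by blast+
      then have "(x i - a1) * ?w + a1 * (?w - a2) \<in> filtration (Suc (Suc k))"
        by (simp add: subspace_add numeral_2_eq_2)
      moreover have "v - a1 * a2 = (x i - a1) * ?w + a1 * (?w - a2)"
        by (simp add: e(3) ie(2) power_product_add algebra_simps)
      moreover have "a1 * a2 \<in> filtration (Suc k)" using filtration_mult[OF a1(2) a2(2)] by simp
      ultimately show ?thesis using a1 a2 unital_subalgebraD(3)[OF A] by (intro bexI[of _ "a1 * a2"]) auto
    qed
    then obtain a' where a': "a' \<in> A" "a' \<in> filtration (Suc k)" "v - a' \<in> filtration (Suc (Suc k))" by blast
    have eq: "c *s v + y - (c *s a' + a) = c *s (v - a') + (y - a)" by (simp add: algebra_simps)
    have "c *s v + y - (c *s a' + a) \<in> filtration (Suc (Suc k))"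
      unfolding eq using a a' by (simp add: subspace_add subspace_scale)
    moreover have "c *s a' + a \<in> A \<inter> filtration (Suc k)"
      using a a' sA by (simp add: subspace_add subspace_scale)
    ultimately show ?case unfolding filtration_def by blast
  qed
qed

text \<open>
  The errors in \<open>filtration_step\<close> are pushed into arbitrarily high degree, where they vanish.
\<close>

lemma generation:
  assumes A: "unital_subalgebra A"
    and gen: "\<And>b. b \<in> filtration 1 \<Longrightarrow> \<exists>a\<in>A \<inter> filtration 1. b - a \<in> filtration 2"
  shows "B \<subseteq> A"
proof
  fix b assume b: "b \<in> B"
  have sA: "subspace A" using A by (rule unital_subalgebraD)
  have "\<exists>a\<in>A. b - a \<in> filtration (Suc k)" for k
  proof (induction k)
    case 0
    obtain c where "b - c *s 1 \<in> filtration 1" using mem_decompose_scalar b by blast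
    then show ?case using unital_subalgebraD(2)[OF A] sA by (auto intro!: bexI[of _ "c *s 1"] subspace_scale)
  next
    case (Suc k)
    then obtain a where a: "a \<in> A" "b - a \<in> filtration (Suc k)" by blast
    obtain a' where a': "a' \<in> A" "b - a - a' \<in> filtration (Suc (Suc k))"
      using filtration_step[OF A gen _ a(2)] by auto
    then show ?case using a sA by (auto intro!: bexI[of _ "a + a'"] subspace_add simp: algebra_simps)
  qed
  from this[of "m * p"] show "b \<in> A" by (auto simp: filtration_eq_0)
qed

text \<open>
  From a set that spans the maximal ideal modulo its square one can select at most \<open>m\<close> elements
  that still do: extend a basis of the square by elements of the set, and note that the quotient is
  spanned by the \<open>m\<close> variables. By \<open>generation\<close> the selected elements generate the algebra.
  The lemma is used twice, once for homogeneous elements and once for the maximal ideals of the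
  two tensor factors.
\<close>

lemma exists_generators:
  assumes S: "S \<subseteq> filtration 1"
    and span: "\<And>b. b \<in> B \<Longrightarrow> \<exists>c. b - c *s 1 \<in> span (S \<union> filtration 2)"
  shows "\<exists>Z\<subseteq>S. finite Z \<and> card Z \<le> m \<and> (\<forall>A. unital_subalgebra A \<longrightarrow> Z \<subseteq> A \<longrightarrow> B \<subseteq> A)"
proof -
  have F21: "filtration 2 \<subseteq> filtration 1" by (rule filtration_antimono) simp
  have F1: "filtration 1 \<subseteq> span (S \<union> filtration 2)"
  proof
    fix b assume b: "b \<in> filtration 1"
    then obtain c where c: "b - c *s 1 \<in> span (S \<union> filtration 2)"
      using span filtration_le_B by blast
    have "span (S \<union> filtration 2) \<subseteq> filtration 1" using S F21 by (intro span_minimal) auto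
    then have "b - (b - c *s 1) \<in> filtration 1" using b c subspace_diff[OF filtration_subspace] by blast
    then have "c = 0" by (intro scalar_mem_filtration_1) simp
    then show "b \<in> span (S \<union> filtration 2)" using c by simp
  qed
  obtain T where T: "T \<subseteq> filtration 2" "independent T" "filtration 2 \<subseteq> span T" "card T = dim (filtration 2)"
    using basis_exists by blast
  obtain T' where T': "T \<subseteq> T'" "T' \<subseteq> S \<union> T" "independent T'" "S \<union> T \<subseteq> span T'"
    using maximal_independent_subset_extend[of T "S \<union> T"] T by blast
  obtain U where U: "finite U" "B \<subseteq> span U" by (rule B_finite_span)
  have fT': "finite T'" using card_le_dim_of_independent[of T' B U] U T' S T filtration_le_B by blast
  then have fT: "finite T" using T' finite_subset by blast
  have "S \<union> filtration 2 \<subseteq> span T'" using T(3) T'(1,4) span_mono by blast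
  then have F1T': "filtration 1 \<subseteq> span T'" using F1 by (metis span_mono span_span subset_trans)
  have "T' \<subseteq> filtration 1" using T' S T F21 by blast
  then have cT': "card T' = dim (filtration 1)" using F1T' T' basis_card_eq_dim by blast
  have "filtration 1 \<subseteq> span (T \<union> x ` {..<m})"
    unfolding filtration_def[of 1]
  proof (rule span_minimal, clarify)
    fix e assume e: "e \<in> reduced p m" "1 \<le> total_deg e"
    show "power_product x e \<in> span (T \<union> x ` {..<m})"
    proof (cases "total_deg e = 1")
      case True
      then obtain i e' where "i < m" "e = single i 1 + e'" "total_deg e' = 0"
        using reduced_decompose[OF e(1), of 0] unfolding One_nat_def by blast
      then have "power_product x e = x i" by (simp add: total_deg_eq_0_iff)
      then show ?thesis using \<open>i < m\<close> by (auto intro: span_base)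
    next
      case False
      then have "power_product x e \<in> filtration 2"
        using e by (intro power_product_mem_filtration) (auto simp: reduced_def)
      then show ?thesis using T(3) span_mono[of T "T \<union> x ` {..<m}"] by blast
    qed
  qed simp
  then have "dim (filtration 1) \<le> card (T \<union> x ` {..<m})" using dim_le_card fT by auto
  also have "\<dots> \<le> card T + m" using card_Un_le[of T "x ` {..<m}"] card_image_le[of "{..<m}" x] by simp
  finally have "card (T' - T) \<le> m" using cT' T' fT by (simp add: card_Diff_subset)
  moreover have "B \<subseteq> A" if A: "unital_subalgebra A" and Z: "T' - T \<subseteq> A" for A
  proof (rule generation[OF A])
    fix b assume "b \<in> filtration 1"
    then have "b \<in> span ((T' - T) \<union> T)" using F1T' T' by (metis Un_Diff_cancel2 subsetD sup.absorb1)
    then obtain a t where a: "a \<in> span (T' - T)" and t: "t \<in> span T" and b: "b = a + t"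
      unfolding span_Un by auto
    have "t \<in> filtration 2" using t T span_minimal[of T "filtration 2"] by auto
    moreover have "a \<in> A" using a Z A span_minimal unital_subalgebraD(1) by blast
    moreover have "span (T' - T) \<subseteq> filtration 1" using T' S by (intro span_minimal) auto
    ultimately show "\<exists>a\<in>A \<inter> filtration 1. b - a \<in> filtration 2"
      using a by (auto intro!: bexI[of _ a] simp: b)
  qed
  ultimately show ?thesis using T' fT' by (intro exI[of _ "T' - T"]) auto
qed

end

section \<open>Polynomials acting on a subspace\<close>

context commutative_algebra
begin

text \<open>
  Linearity is relative to \<open>V\<close> because derivations are given on a subalgebra of the host.
\<close>

definition linear_on :: "'u set \<Rightarrow> ('u \<Rightarrow> 'u) \<Rightarrow> bool" where
  "linear_on V T \<longleftrightarrow> (\<forall>a\<in>V. T a \<in> V) \<and> (\<forall>a\<in>V. \<forall>b\<in>V. T (a + b) = T a + T b) \<and>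
     (\<forall>c. \<forall>a\<in>V. T (c *s a) = c *s T a)"

lemma linear_onD:
  assumes "linear_on V T"
  shows "a \<in> V \<Longrightarrow> T a \<in> V" "a \<in> V \<Longrightarrow> b \<in> V \<Longrightarrow> T (a + b) = T a + T b"
    "a \<in> V \<Longrightarrow> T (c *s a) = c *s T a"
  using assms by (auto simp: linear_on_def)

lemma linear_on_0: "linear_on V T \<Longrightarrow> subspace V \<Longrightarrow> T 0 = 0"
  using linear_onD(3)[of V T 0 0] subspace_0 by simp

lemma linear_on_diff: "linear_on V T \<Longrightarrow> subspace V \<Longrightarrow> a \<in> V \<Longrightarrow> b \<in> V \<Longrightarrow> T (a - b) = T a - T b"
  using linear_onD(2)[of V T a "(-1) *s b"] linear_onD(3)[of V T b "-1"] by (simp add: subspace_neg)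

lemma linear_on_sum:
  assumes "linear_on V T" "subspace V" "\<And>i. i \<in> I \<Longrightarrow> f i \<in> V"
  shows "T (sum f I) = (\<Sum>i\<in>I. T (f i))"
  using assms(3)
  by (induction I rule: infinite_finite_induct)
     (simp_all add: linear_on_0[OF assms(1,2)] linear_onD[OF assms(1)] subspace_sum[OF assms(2)])

lemma linear_on_funpow: "linear_on V T \<Longrightarrow> linear_on V (T ^^ n)"
  by (induction n) (auto simp: linear_on_def)

text \<open>
  The value at \<open>v\<close> of the operator \<open>q(T)\<close>.
\<close>

definition poly_act :: "('u \<Rightarrow> 'u) \<Rightarrow> 'a poly \<Rightarrow> 'u \<Rightarrow> 'u" where
  "poly_act T q v = (\<Sum>i\<le>Polynomial.degree q. Polynomial.coeff q i *s (T ^^ i) v)"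

lemma poly_act_eq:
  assumes "Polynomial.degree q \<le> n"
  shows "poly_act T q v = (\<Sum>i\<le>n. Polynomial.coeff q i *s (T ^^ i) v)"
  unfolding poly_act_def
  by (rule sum.mono_neutral_left) (use assms in \<open>auto simp: Polynomial.coeff_eq_0\<close>)

lemma poly_act_0 [simp]: "poly_act T 0 v = 0"
  by (simp add: poly_act_def)

lemma poly_act_pCons: "poly_act T (pCons a q) v = a *s v + poly_act T q (T v)"
proof -
  have "poly_act T (pCons a q) v = (\<Sum>i\<le>Suc (Polynomial.degree q). Polynomial.coeff (pCons a q) i *s (T ^^ i) v)"
    by (rule poly_act_eq) (rule degree_pCons_le)
  also have "\<dots> = a *s v + poly_act T q (T v)"
    by (simp add: sum.atMost_Suc_shift poly_act_def funpow_swap1 del: sum.atMost_Suc)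
  finally show ?thesis .
qed

lemma poly_act_add: "poly_act T (q + r) v = poly_act T q v + poly_act T r v"
proof -
  let ?n = "max (Polynomial.degree q) (Polynomial.degree r)"
  show ?thesis
    using Polynomial.degree_add_le_max[of q r]
    by (simp add: poly_act_eq[of _ ?n] scale_left_distrib sum.distrib)
qed

lemma poly_act_smult: "poly_act T (Polynomial.smult c q) v = c *s poly_act T q v"
  by (simp add: poly_act_eq[of _ "Polynomial.degree q"] scale_sum_right)

context
  fixes V T
  assumes lin: "linear_on V T" and sub: "subspace V"
begin

lemma poly_act_mem: "v \<in> V \<Longrightarrow> poly_act T q v \<in> V"
  unfolding poly_act_def using linear_onD(1)[OF linear_on_funpow[OF lin]] sub
  by (auto intro!: subspace_sum subspace_scale)

lemma poly_act_commute: "v \<in> V \<Longrightarrow> poly_act T q (T v) = T (poly_act T q v)"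
  unfolding poly_act_def
  using linear_onD[OF linear_on_funpow[OF lin]] sub
  by (subst linear_on_sum[OF lin sub])
     (auto simp: linear_onD[OF lin] funpow_swap1 intro!: subspace_scale)

lemma poly_act_mult: "v \<in> V \<Longrightarrow> poly_act T (q * r) v = poly_act T q (poly_act T r v)"
proof (induction q arbitrary: v)
  case 0
  then show ?case by simp
next
  case (pCons a q)
  then show ?case
    by (simp add: poly_act_add poly_act_smult poly_act_pCons poly_act_commute poly_act_mem linear_onD[OF lin])
qed

end

text \<open>
  The identity \<open>(T - l) ^ N = T ^ N - l ^ N\<close> of operators, read off from polynomials, where the
  binomial theorem in characteristic \<open>p\<close> is available.
\<close>

lemma poly_act_linear_power:
  fixes l :: 'a
  assumes "prime CHAR('a)" "N = CHAR('a) ^ k"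
  shows "[:- l, 1:] ^ N = Polynomial.monom 1 N - [:l ^ N:]"
    and "poly_act T ([:- l, 1:] ^ N) v = (T ^^ N) v - (l ^ N) *s v"
proof -
  have p: "prime CHAR('a poly)" "N = CHAR('a poly) ^ k" using assms by auto
  have "[:- l, 1:] ^ N + [:l:] ^ N = ([:- l, 1:] + [:l:]) ^ N"
    by (rule freshmans_dream'[OF p, symmetric])
  also have "\<dots> = Polynomial.monom 1 N" by (simp add: Polynomial.monom_altdef)
  finally show eq: "[:- l, 1:] ^ N = Polynomial.monom 1 N - [:l ^ N:]"
    by (simp add: poly_const_pow algebra_simps)
  have "poly_act T (Polynomial.monom 1 N) v = (\<Sum>i\<le>N. (if i = N then (T ^^ i) v else 0))"
    by (subst poly_act_eq[of _ N], simp add: degree_monom_eq, rule sum.cong) auto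
  then have 1: "poly_act T (Polynomial.monom 1 N) v = (T ^^ N) v" by simp
  have "[:- l, 1:] ^ N = Polynomial.monom 1 N + Polynomial.smult (-1) [:l ^ N:]"
    using eq by simp
  then show "poly_act T ([:- l, 1:] ^ N) v = (T ^^ N) v - (l ^ N) *s v"
    by (simp only: poly_act_add poly_act_smult 1) (simp add: poly_act_pCons)
qed

text \<open>
  If a product of distinct factors \<open>T - g a\<close> kills \<open>v\<close>, then \<open>v\<close> is a sum of eigenvectors. One
  factor is split off: the image of \<open>v\<close> under it is a sum of eigenvectors by induction, each of which
  is itself in the image of the factor because \<open>g b - g a\<close> is invertible, and what remains
  is an eigenvector for \<open>g a\<close>.
\<close>

lemma eigenvector_decomposition:
  assumes lin: "linear_on V T" and sub: "subspace V" and "finite K" "inj_on g K" "v \<in> V"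
    and "poly_act T (\<Prod>a\<in>K. [:- g a, 1:]) v = 0"
  shows "\<exists>w. v = (\<Sum>a\<in>K. w a) \<and> (\<forall>a\<in>K. w a \<in> V \<and> T (w a) = g a *s w a)"
  using assms(3-6)
proof (induction K arbitrary: v rule: finite_induct)
  case empty
  then show ?case by (simp add: poly_act_def)
next
  case (insert a K)
  define u where "u = T v - g a *s v"
  have u: "u \<in> V" using insert.prems linear_onD[OF lin] sub by (simp add: u_def subspace_diff subspace_scale)
  have "u = poly_act T [:- g a, 1:] v" by (simp add: poly_act_pCons u_def)
  then have "poly_act T (\<Prod>a\<in>K. [:- g a, 1:]) u = 0"
    using insert by (simp add: mult.commute flip: poly_act_mult[OF lin sub])
  then obtain w where w: "u = sum w K" "\<And>b. b \<in> K \<Longrightarrow> w b \<in> V" "\<And>b. b \<in> K \<Longrightarrow> T (w b) = g b *s w b"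
    using insert u by auto
  \<comment> \<open>preimages of the \<open>w b\<close> under \<open>T - g a\<close>\<close>
  define w' where "w' b = inverse (g b - g a) *s w b" for b
  have w': "w' b \<in> V" "T (w' b) = g b *s w' b" "(g b - g a) *s w' b = w b" if "b \<in> K" for b
    using w that insert.prems insert.hyps linear_onD(3)[OF lin] sub
    by (auto simp: w'_def subspace_scale mult.commute inj_on_def)
  define v' where "v' = v - sum w' K"
  have v': "v' \<in> V" using w' insert.prems sub by (simp add: v'_def subspace_diff subspace_sum)
  have "T v' - g a *s v' = u - (\<Sum>b\<in>K. T (w' b) - g a *s w' b)"
    using w' insert.prems sub
    by (simp add: v'_def u_def linear_on_diff[OF lin sub] linear_on_sum[OF lin sub] subspace_sum
        sum_subtractf scale_sum_right scale_right_diff_distrib)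
  also have "(\<Sum>b\<in>K. T (w' b) - g a *s w' b) = (\<Sum>b\<in>K. w b)"
    by (rule sum.cong) (use w' in \<open>auto simp flip: scale_left_diff_distrib\<close>)
  finally have "T v' = g a *s v'" using w by simp
  moreover have "v = (\<Sum>b\<in>insert a K. (w'(a := v')) b)"
    using insert.hyps by (simp add: v'_def) (auto intro!: sum.cong)
  ultimately show ?case using v' w' insert.hyps by (intro exI[of _ "w'(a := v')"]) auto
qed

end

section \<open>The grading by generalized eigenspaces\<close>

context truncated_algebra
begin

definition derivation_on_B :: "('u \<Rightarrow> 'u) \<Rightarrow> bool" where
  "derivation_on_B D \<longleftrightarrow> linear_on B D \<and> (\<forall>a\<in>B. \<forall>b\<in>B. D (a * b) = D a * b + a * D b)"

lemma derivation_on_B_linear: "derivation_on_B D \<Longrightarrow> linear_on B D"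
  by (simp add: derivation_on_B_def)

lemma derivation_on_B_mult: "derivation_on_B D \<Longrightarrow> a \<in> B \<Longrightarrow> b \<in> B \<Longrightarrow> D (a * b) = D a * b + a * D b"
  by (simp add: derivation_on_B_def)

lemma linear_on_of_nat_mult: "linear_on B D \<Longrightarrow> a \<in> B \<Longrightarrow> D (of_nat n * a) = of_nat n * D a"
  by (simp add: of_nat_eq_scale scale_mult_left linear_onD)

lemma of_nat_mult_mem: "a \<in> B \<Longrightarrow> of_nat n * a \<in> B"
  by (simp add: of_nat_eq_scale scale_mult_left subspace_scale B_subspace)

lemma leibniz:
  assumes D: "derivation_on_B D" and "a \<in> B" "b \<in> B"
  shows "(D ^^ n) (a * b) = (\<Sum>k\<le>n. of_nat (n choose k) * ((D ^^ k) a * (D ^^ (n - k)) b))"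
proof (induction n)
  case 0
  then show ?case by simp
next
  case (Suc n)
  define f g where "f k = (D ^^ k) a" and "g k = (D ^^ k) b" for k
  note lin = derivation_on_B_linear[OF D]
  have mem: "f k \<in> B" "g k \<in> B" for k
    unfolding f_def g_def using linear_onD(1)[OF linear_on_funpow[OF lin]] assms by auto
  have step: "D (f k) = f (Suc k)" "D (g k) = g (Suc k)" for k by (simp_all add: f_def g_def)
  have "(D ^^ Suc n) (a * b) = D (\<Sum>k\<le>n. of_nat (n choose k) * (f k * g (n - k)))"
    using Suc by (simp add: f_def g_def)
  also have "\<dots> = (\<Sum>k\<le>n. of_nat (n choose k) * (f (Suc k) * g (n - k) + f k * g (Suc n - k)))"
    using mem by (subst linear_on_sum[OF lin B_subspace])
      (auto simp: of_nat_mult_mem mult_mem linear_on_of_nat_mult[OF lin] derivation_on_B_mult[OF D]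
        step Suc_diff_le intro!: sum.cong)
  also have "\<dots> = (\<Sum>k\<le>n. of_nat (n choose k) * (f (Suc k) * g (n - k)))
      + (\<Sum>k\<le>Suc n. of_nat (n choose k) * (f k * g (Suc n - k)))"
    by (simp add: algebra_simps sum.distrib binomial_eq_0)
  also have "(\<Sum>k\<le>Suc n. of_nat (n choose k) * (f k * g (Suc n - k)))
      = f 0 * g (Suc n) + (\<Sum>k\<le>n. of_nat (n choose Suc k) * (f (Suc k) * g (n - k)))"
    by (subst sum.atMost_Suc_shift) simp
  also have "(\<Sum>k\<le>n. of_nat (n choose k) * (f (Suc k) * g (n - k))) +
      (f 0 * g (Suc n) + (\<Sum>k\<le>n. of_nat (n choose Suc k) * (f (Suc k) * g (n - k))))
     = (\<Sum>k\<le>Suc n. of_nat (Suc n choose k) * (f k * g (Suc n - k)))"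
    unfolding sum.atMost_Suc_shift[of "\<lambda>k. of_nat (Suc n choose k) * (f k * g (Suc n - k))"]
    by (simp add: algebra_simps sum.distrib)
  finally show ?case by (simp add: f_def g_def)
qed

text \<open>
  In the Leibniz formula for the \<open>p\<close>-th power all inner binomial coefficients are divisible by \<open>p\<close>.
\<close>

lemma derivation_on_B_pth_power:
  assumes D: "derivation_on_B D"
  shows "derivation_on_B (D ^^ p)"
  unfolding derivation_on_B_def
proof (intro conjI ballI)
  show "linear_on B (D ^^ p)" by (rule linear_on_funpow) (rule derivation_on_B_linear[OF D])
  fix a b assume ab: "a \<in> B" "b \<in> B"
  have "of_nat (p choose k) = (0::'u)" if "0 < k" "k < p" for k
    using dvd_choose_prime[of k p] prime_p that by (simp add: of_nat_eq_0_iff_char_dvd CHAR_eq p_eq)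
  then have "(\<Sum>k\<le>p. of_nat (p choose k) * ((D ^^ k) a * (D ^^ (p - k)) b))
    = (\<Sum>k\<in>{0,p}. of_nat (p choose k) * ((D ^^ k) a * (D ^^ (p - k)) b))"
    by (intro sum.mono_neutral_right) auto
  then show "(D ^^ p) (a * b) = (D ^^ p) a * b + a * (D ^^ p) b"
    using p_pos by (simp add: leibniz[OF D ab] del: p_pos)
qed

lemma derivation_on_B_power:
  assumes D: "derivation_on_B D"
  shows "derivation_on_B (D ^^ (p ^ k))"
proof (induction k)
  case 0
  then show ?case using D by simp
next
  case (Suc k)
  then show ?case using derivation_on_B_pth_power[OF Suc] by (simp add: funpow_mult mult.commute)
qed

definition eigenspace :: "('u \<Rightarrow> 'u) \<Rightarrow> 'a \<Rightarrow> 'u set" where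
  "eigenspace T c = {b \<in> B. T b = c *s b}"

lemma eigenspace_subspace: "linear_on B T \<Longrightarrow> subspace (eigenspace T c)"
  using B_subspace
  by (auto simp: eigenspace_def subspace_def linear_onD linear_on_0 scale_right_distrib mult.commute)

lemma eigenspace_mult:
  assumes "derivation_on_B T" "a \<in> eigenspace T c" "b \<in> eigenspace T d"
  shows "a * b \<in> eigenspace T (c + d)"
  using assms by (auto simp: eigenspace_def mult_mem derivation_on_B_mult scale_mult scale_left_distrib)

lemma derivation_on_B_one: "derivation_on_B T \<Longrightarrow> T 1 = 0"
  using derivation_on_B_mult[of T 1 1] one_mem by simp

lemma one_mem_eigenspace: "derivation_on_B T \<Longrightarrow> 1 \<in> eigenspace T 0"
  by (simp add: eigenspace_def one_mem derivation_on_B_one)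

text \<open>
  The Frobenius map of a field is injective, so \<open>l\<close> can be recovered from the eigenvalue \<open>l ^ N\<close>.
\<close>

lemma power_inj:
  assumes "c ^ (p ^ k) = d ^ (p ^ k)"
  shows "c = (d::'a)"
proof -
  have "c ^ (p ^ k) = ((c - d) + d) ^ (p ^ k)" by simp
  also have "\<dots> = (c - d) ^ (p ^ k) + d ^ (p ^ k)"
    by (rule freshmans_dream') (use prime_p p_eq in auto)
  finally show ?thesis using assms by simp
qed

end

locale alg_closed_truncated_algebra = truncated_algebra scale p m x B
  for scale :: "'a::alg_closed_field \<Rightarrow> 'u::comm_ring_1 \<Rightarrow> 'u" (infixr \<open>*s\<close> 75) and p m x B +
  fixes D :: "'u \<Rightarrow> 'u"
  assumes D: "derivation_on_B D"
    and constants_D: "\<And>b. b \<in> B \<Longrightarrow> D b = 0 \<Longrightarrow> \<exists>c. b = c *s 1"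
begin

abbreviation N :: nat where "N \<equiv> p ^ m"
abbreviation \<Delta> :: "'u \<Rightarrow> 'u" where "\<Delta> \<equiv> D ^^ N"
abbreviation E :: "'a \<Rightarrow> 'u set" where "E \<equiv> eigenspace \<Delta>"

lemmas linear_D = derivation_on_B_linear[OF D]
lemmas derivation_\<Delta> = derivation_on_B_power[OF D, of m]
lemmas linear_\<Delta> = derivation_on_B_linear[OF derivation_\<Delta>]

text \<open>
  The \<open>N + 1\<close> vectors \<open>v, D v, \<dots>, D ^ N v\<close> are dependent. The bound on the degree keeps the
  multiplicities of the roots at most \<open>N\<close>.
\<close>

lemma annihilating_polynomial:
  assumes "v \<in> B"
  obtains q where "q \<noteq> 0" "Polynomial.degree q \<le> N" "poly_act D q v = 0"
proof -
  obtain T where T: "finite T" "B \<subseteq> span T" by (rule B_finite_span)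
  have "span ((\<lambda>i. (D ^^ i) v) ` {..N}) \<subseteq> B"
    using linear_onD(1)[OF linear_on_funpow[OF linear_D]] assms by (intro span_minimal B_subspace) auto
  then have "dim (span ((\<lambda>i. (D ^^ i) v) ` {..N})) \<le> dim B"
    by (rule dim_mono_finite_span[OF _ T(2,1)])
  then have "dim (span ((\<lambda>i. (D ^^ i) v) ` {..N})) \<noteq> card {..N}" unfolding dim_B by simp
  then obtain c i where c: "(\<Sum>i\<le>N. c i *s (D ^^ i) v) = 0" "i \<le> N" "c i \<noteq> 0"
    using dim_span_family[of "{..N}" "\<lambda>i. (D ^^ i) v"] by auto
  define q where "q = (\<Sum>i\<le>N. Polynomial.monom (c i) i)"
  have cq: "Polynomial.coeff q i = (if i \<le> N then c i else 0)" for i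
    by (simp add: q_def Polynomial.coeff_sum)
  have "q \<noteq> 0" using c(2,3) cq[of i] by auto
  moreover have dq: "Polynomial.degree q \<le> N" by (rule degree_le) (simp add: cq)
  moreover have "poly_act D q v = 0" using c(1) by (simp add: poly_act_eq[OF dq] cq)
  ultimately show ?thesis by (rule that)
qed

lemma poly_act_D_power:
  assumes "v \<in> B"
  shows "poly_act D (\<Prod>a\<in>K. [:- a, 1:] ^ N) v = poly_act \<Delta> (\<Prod>a\<in>K. [:- (a ^ N), 1:]) v"
  using assms
proof (induction K arbitrary: v rule: infinite_finite_induct)
  case (insert a K)
  have 1: "poly_act D ([:- a, 1:] ^ N) v = poly_act \<Delta> [:- (a ^ N), 1:] v" if "v \<in> B" for v
    using that by (subst poly_act_linear_power(2)[where k = m]) (use prime_p p_eq in \<open>auto simp: poly_act_pCons\<close>)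
  let ?R = "\<Prod>b\<in>K. [:- (b ^ N), 1:]"
  have "poly_act D (\<Prod>b\<in>insert a K. [:- b, 1:] ^ N) v = poly_act \<Delta> [:- (a ^ N), 1:] (poly_act \<Delta> ?R v)"
    using insert
    by (simp add: poly_act_mult[OF linear_D B_subspace] 1 poly_act_mem[OF linear_\<Delta> B_subspace])
  also have "\<dots> = poly_act \<Delta> ([:- (a ^ N), 1:] * ?R) v"
    by (rule poly_act_mult[OF linear_\<Delta> B_subspace, symmetric]) (rule insert.prems)
  finally show ?case by (simp only: prod.insert[OF insert.hyps])
qed (simp_all add: poly_act_def)

text \<open>
  An annihilating polynomial of \<open>v\<close> divides the product of the \<open>(X - a) ^ N\<close> over its roots, and this
  product acts like the product of the distinct factors \<open>\<Delta> - a ^ N\<close>. Taking the \<open>N\<close>-th power thus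
  removes the nilpotent part of \<open>D\<close>.
\<close>

lemma E_spans: "B \<subseteq> span (\<Union>c. E c)"
proof
  fix v assume v: "v \<in> B"
  obtain q where q: "q \<noteq> 0" "Polynomial.degree q \<le> N" "poly_act D q v = 0"
    using annihilating_polynomial[OF v] .
  obtain A where A: "size A = Polynomial.degree q"
    "q = Polynomial.smult (Polynomial.lead_coeff q) (\<Prod>x\<in>#A. [:-x, 1:])"
    using alg_closed_imp_factorization[OF q(1)] by blast
  define Q where "Q = (\<Prod>a\<in>set_mset A. [:- a, 1:] ^ N)"
  have "(\<Prod>x\<in>#A. [:-x, 1:]) dvd Q"
    unfolding image_prod_mset_multiplicity Q_def
    by (intro prod_dvd_prod le_imp_power_dvd) (metis A(1) q(2) count_le_size order_trans)
  moreover have "Polynomial.lead_coeff q \<noteq> 0" using q by simp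
  ultimately have "q dvd Q" by (subst A(2)) (simp add: smult_dvd)
  then obtain r where "Q = r * q" by (metis dvd_def mult.commute)
  then have "poly_act D Q v = 0"
    using q v by (simp add: poly_act_mult[OF linear_D B_subspace]) (simp add: poly_act_def linear_on_0[OF linear_on_funpow[OF linear_D] B_subspace])
  then have "poly_act \<Delta> (\<Prod>a\<in>set_mset A. [:- (a ^ N), 1:]) v = 0"
    unfolding Q_def by (simp add: poly_act_D_power v)
  moreover have "inj_on (\<lambda>a. a ^ N) (set_mset A)" using power_inj by (auto intro: inj_onI)
  ultimately obtain w where w: "v = sum w (set_mset A)"
    "\<And>a. a \<in> set_mset A \<Longrightarrow> w a \<in> B \<and> \<Delta> (w a) = (a ^ N) *s w a"
    using eigenvector_decomposition[OF linear_\<Delta> B_subspace, of "set_mset A" "\<lambda>a. a ^ N"] v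
    by auto
  have "w a \<in> span (\<Union>c. E c)" if "a \<in> set_mset A" for a
    using w(2)[OF that] by (intro span_base) (auto simp: eigenspace_def)
  then show "v \<in> span (\<Union>c. E c)" unfolding w(1) by (intro span_sum)
qed

text \<open>
  The elements \<open>h - c\<close> with \<open>h\<close> homogeneous and \<open>c\<close> its residue span the maximal ideal, so \<open>m\<close> of them
  generate. The corresponding \<open>h\<close> generate as well, and since their \<open>p\<close>-th powers are
  scalars their reduced power products span. The \<open>h - c\<close> themselves need not be homogeneous.
\<close>

lemma homogeneous_generators:
  obtains h \<mu> where "\<And>i. i < m \<Longrightarrow> h i \<in> E (\<mu> i)" "B = span (power_product h ` reduced p m)"
proof -
  define S where "S = {h - c *s 1 |h c \<mu>. h \<in> E \<mu> \<and> h - c *s 1 \<in> filtration 1}"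
  have EB: "E c \<subseteq> B" for c by (auto simp: eigenspace_def)
  have "\<exists>c. b - c *s 1 \<in> span S" if "b \<in> B" for b
  proof -
    have "b \<in> span (\<Union>c. E c)" using E_spans that by blast
    then show ?thesis
    proof (induction rule: span_induct_alt)
      case base
      then show ?case by (intro exI[of _ 0]) (simp add: span_zero)
    next
      case (step k v y)
      then obtain c d \<mu> where c: "y - c *s 1 \<in> span S" and v: "v \<in> E \<mu>" "v - d *s 1 \<in> filtration 1"
        using mem_decompose_scalar EB by blast
      then have "v - d *s 1 \<in> span S" by (auto simp: S_def intro!: span_base)
      then have "k *s (v - d *s 1) + (y - c *s 1) \<in> span S" using c by (intro span_add span_scale)
      then show ?case by (intro exI[of _ "k * d + c"]) (simp add: algebra_simps)
    qed
  qed
  then have "\<exists>c. b - c *s 1 \<in> span (S \<union> filtration 2)" if "b \<in> B" for b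
    using that span_mono[of S "S \<union> filtration 2"] by blast
  moreover have "S \<subseteq> filtration 1" by (auto simp: S_def)
  ultimately obtain Z where Z: "Z \<subseteq> S" "finite Z" "card Z \<le> m"
    and gen: "\<And>A. unital_subalgebra A \<Longrightarrow> Z \<subseteq> A \<Longrightarrow> B \<subseteq> A"
    using exists_generators by metis
  obtain z where z: "bij_betw z {..<card Z} Z"
    using ex_bij_betw_nat_finite[OF Z(2)] atLeast0LessThan by metis
  have "\<exists>h c \<mu>. z i = h - c *s 1 \<and> h \<in> E \<mu>" if "i < card Z" for i
    using bij_betwE[OF z] that Z(1) unfolding S_def by blast
  then obtain h c \<mu> where h: "\<And>i. i < card Z \<Longrightarrow> z i = h i - c i *s 1" "\<And>i. i < card Z \<Longrightarrow> h i \<in> E (\<mu> i)"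
    by metis
  let ?A = "span (power_product h ` reduced p (card Z))"
  have pw: "\<exists>c. h i ^ p = c *s 1" if "i < card Z" for i using h(2)[OF that] EB power_p_scalar by blast
  have A: "unital_subalgebra ?A" using reduced_span_subalgebra(1)[of "card Z" h p] pw by simp
  have "h i \<in> ?A" if "i < card Z" for i using reduced_span_subalgebra(2)[of "card Z" h p] pw that by simp
  then have "z i \<in> ?A" if "i < card Z" for i
    using that h(1) unital_subalgebraD(2)[OF A] by (auto intro!: span_diff span_scale)
  then have "Z \<subseteq> ?A" using bij_betw_imp_surj_on[OF z] by (metis image_subsetI lessThan_iff)
  then have BA: "B \<subseteq> ?A" using gen[OF A] by simp
  have "?A \<subseteq> B" by (rule reduced_span_minimal[OF B_subalgebra]) (use h(2) EB in blast)
  then have "B = ?A" using BA by simp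
  then have "p ^ m \<le> p ^ card Z" using dim_reduced_span_le[of p h "card Z"] dim_B by simp
  then have "m \<le> card Z" using prime_gt_1_nat[OF prime_p] by simp
  then have "card Z = m" using Z(3) by simp
  then show ?thesis using that[of h \<mu>] h(2) \<open>B = ?A\<close> by simp
qed

definition weight :: "(nat \<Rightarrow> 'a) \<Rightarrow> (nat \<Rightarrow>\<^sub>0 nat) \<Rightarrow> 'a" where
  "weight \<mu> e = (\<Sum>i<m. of_nat (lookup e i) * \<mu> i)"

lemma power_product_mem_eigenspace:
  assumes h: "\<And>i. i < m \<Longrightarrow> h i \<in> E (\<mu> i)" and e: "keys e \<subseteq> {..<m}"
  shows "power_product h e \<in> E (weight \<mu> e)"
proof -
  have pw: "a ^ n \<in> E (of_nat n * c)" if "a \<in> E c" for a n c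
  proof (induction n)
    case 0
    then show ?case using one_mem_eigenspace[OF derivation_\<Delta>] by simp
  next
    case (Suc n)
    then show ?case using eigenspace_mult[OF derivation_\<Delta> that Suc] by (simp add: algebra_simps)
  qed
  have pr: "finite I \<Longrightarrow> (\<And>i. i \<in> I \<Longrightarrow> f i \<in> E (c i)) \<Longrightarrow> prod f I \<in> E (sum c I)" for I :: "nat set" and f c
    by (induction I rule: finite_induct)
       (auto simp: one_mem_eigenspace[OF derivation_\<Delta>] intro!: eigenspace_mult[OF derivation_\<Delta>])
  have "power_product h e = (\<Prod>i<m. h i ^ lookup e i)"
    using e by (simp add: power_product_superset)
  also have "\<dots> \<in> E (weight \<mu> e)" unfolding weight_def by (rule pr) (auto intro: pw h)
  finally show ?thesis .
qed

lemma E_subset: "E c \<subseteq> B"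
  by (auto simp: eigenspace_def)

text \<open>
  The reduced power products of homogeneous generators are a basis of eigenvectors of \<open>\<Delta>\<close>, so an
  eigenspace is spanned by those of its weight.
\<close>

lemma eigenspace_eq_span:
  assumes h: "\<And>i. i < m \<Longrightarrow> h i \<in> E (\<mu> i)" and B: "B = span (power_product h ` reduced p m)"
  shows "E c = span (power_product h ` {e \<in> reduced p m. weight \<mu> e = c})"
    and "dim (E c) = card {e \<in> reduced p m. weight \<mu> e = c}"
proof -
  let ?R = "{e \<in> reduced p m. weight \<mu> e = c}"
  have mem: "power_product h e \<in> E (weight \<mu> e)" if "e \<in> reduced p m" for e
    using power_product_mem_eigenspace[OF h] that by (simp add: reduced_def)
  have ind: "inj_on (power_product h) (reduced p m)" "independent (power_product h ` reduced p m)"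
    "\<And>f e. (\<Sum>e\<in>reduced p m. f e *s power_product h e) = 0 \<Longrightarrow> e \<in> reduced p m \<Longrightarrow> f e = 0"
    using family_independent[of "reduced p m" "power_product h"] dim_B by (auto simp: card_reduced simp flip: B)
  show span: "E c = span (power_product h ` ?R)"
  proof
    show "span (power_product h ` ?R) \<subseteq> E c"
      by (rule span_minimal) (use mem eigenspace_subspace[OF linear_\<Delta>] in auto)
    show "E c \<subseteq> span (power_product h ` ?R)"
    proof
      fix b assume b: "b \<in> E c"
      then have "b \<in> span (power_product h ` reduced p m)" using E_subset B by auto
      then obtain f where f: "b = (\<Sum>e\<in>reduced p m. f e *s power_product h e)"
        using span_family[of "reduced p m"] by auto
      have "\<Delta> b = (\<Sum>e\<in>reduced p m. \<Delta> (f e *s power_product h e))"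
        unfolding f by (rule linear_on_sum[OF linear_\<Delta> B_subspace])
          (use mem E_subset B_subspace in \<open>blast intro: subspace_scale\<close>)
      also have "\<dots> = (\<Sum>e\<in>reduced p m. f e *s weight \<mu> e *s power_product h e)"
        by (rule sum.cong) (use mem in \<open>auto simp: eigenspace_def linear_onD[OF linear_\<Delta>]\<close>)
      finally have "(\<Sum>e\<in>reduced p m. (f e * (weight \<mu> e - c)) *s power_product h e) = \<Delta> b - c *s b"
        by (simp add: f scale_sum_right sum_subtractf scale_left_diff_distrib right_diff_distrib mult.commute)
      also have "\<dots> = 0" using b by (simp add: eigenspace_def)
      finally have "f e * (weight \<mu> e - c) = 0" if "e \<in> reduced p m" for e by (rule ind(3)) (rule that)
      then have "b = (\<Sum>e\<in>?R. f e *s power_product h e)"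
        unfolding f by (intro sum.mono_neutral_right) auto
      then show "b \<in> span (power_product h ` ?R)"
        by (auto intro!: span_sum span_scale intro: span_base)
    qed
  qed
  have "independent (power_product h ` ?R)" by (rule independent_mono[OF ind(2)]) auto
  then show "dim (E c) = card ?R"
    unfolding span by (simp add: dim_eq_card_independent card_image inj_on_subset[OF ind(1)])
qed

text \<open>
  Translation by \<open>f\<close> in the group of exponents modulo \<open>p\<close>.
\<close>

definition shift :: "(nat \<Rightarrow>\<^sub>0 nat) \<Rightarrow> (nat \<Rightarrow>\<^sub>0 nat) \<Rightarrow> (nat \<Rightarrow>\<^sub>0 nat)" where
  "shift f e = Poly_Mapping.map (\<lambda>n. n mod p) (e + f)"

lemma lookup_shift: "lookup (shift f e) i = (lookup e i + lookup f i) mod p"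
  by (cases "lookup (e + f) i = 0") (auto simp: shift_def Poly_Mapping.map.rep_eq lookup_add)

lemma of_nat_mod_p: "of_nat (n mod p) = (of_nat n :: 'a)"
proof -
  have "(of_nat n :: 'a) = of_nat (p * (n div p) + n mod p)" by simp
  also have "\<dots> = of_nat (n mod p)" unfolding of_nat_add of_nat_mult by (simp add: p_eq)
  finally show ?thesis by simp
qed

lemma weight_shift: "weight \<mu> (shift f e) = weight \<mu> e + weight \<mu> f"
  by (simp add: weight_def lookup_shift of_nat_mod_p algebra_simps sum.distrib)

lemma shift_reduced:
  assumes "e \<in> reduced p m" "f \<in> reduced p m"
  shows "shift f e \<in> reduced p m"
proof -
  have "keys (shift f e) \<subseteq> keys (e + f)"
    by (rule subsetI) (metis in_keys_iff lookup_shift lookup_add mod_0)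
  then show ?thesis using keys_add_reduced[OF assms] p_pos
    by (auto simp: reduced_def lookup_shift simp del: p_pos)
qed

lemma inj_on_shift: "inj_on (shift f) (reduced p m)"
proof (rule inj_onI, rule poly_mapping_eqI)
  fix e e' i assume e: "e \<in> reduced p m" "e' \<in> reduced p m" "shift f e = shift f e'"
  then have "(lookup e i + lookup f i) mod p = (lookup e' i + lookup f i) mod p"
    by (metis lookup_shift)
  then obtain q q' where "lookup e i + lookup f i + p * q
      = lookup e' i + lookup f i + p * q'"
    unfolding nat_mod_eq_iff by blast
  then have "lookup e i + p * q = lookup e' i + p * q'" by simp
  then have "lookup e i mod p = lookup e' i mod p"
    unfolding nat_mod_eq_iff by blast
  then show "lookup e i = lookup e' i"
    using e by (auto simp: reduced_def)
qed

text \<open>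
  Translation by \<open>f\<close> maps the fibre over \<open>0\<close> injectively into the fibre over the weight of \<open>f\<close>, and
  translation by the inverse of \<open>f\<close> goes back.
\<close>

lemma card_weight_fibre:
  assumes f: "f \<in> reduced p m"
  shows "card {e \<in> reduced p m. weight \<mu> e = weight \<mu> f} = card {e \<in> reduced p m. weight \<mu> e = 0}"
proof -
  have le: "card {e \<in> reduced p m. weight \<mu> e = c} \<le> card {e \<in> reduced p m. weight \<mu> e = c + weight \<mu> f}"
    if "f \<in> reduced p m" for f c
    by (rule card_inj_on_le[where f = "shift f"])
       (use that in \<open>auto intro: inj_on_subset[OF inj_on_shift] shift_reduced simp: weight_shift\<close>)
  \<comment> \<open>the inverse of \<open>f\<close> in the group of exponents modulo \<open>p\<close>\<close>
  define f' where "f' = Poly_Mapping.map (\<lambda>n. (p - n) mod p) f"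
  have l: "lookup f' i = (p - lookup f i) mod p" for i
    by (cases "lookup f i = 0") (auto simp: f'_def Poly_Mapping.map.rep_eq)
  have "keys f' \<subseteq> keys f"
    by (rule subsetI) (metis in_keys_iff l diff_zero mod_self)
  then have f': "f' \<in> reduced p m" using f p_pos by (auto simp: reduced_def l simp del: p_pos)
  have "of_nat (lookup f' i) = - (of_nat (lookup f i) :: 'a)" for i
  proof -
    have "lookup f i \<le> p" using f by (simp add: reduced_def less_imp_le)
    then show ?thesis unfolding l of_nat_mod_p by (simp add: of_nat_diff) (simp add: p_eq)
  qed
  then have "weight \<mu> f' = - weight \<mu> f" by (simp add: weight_def sum_negf)
  then show ?thesis using le[OF f, of 0] le[OF f', of "weight \<mu> f"] by simp
qed

text \<open>
  The sizes of the fibres are equal and add up to \<open>p ^ m\<close>, so both their number and their common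
  size are powers of \<open>p\<close>.
\<close>

proposition eigenspace_dimensions:
  obtains \<Lambda> r where "finite \<Lambda>" "0 \<in> \<Lambda>" "r \<le> m" "card \<Lambda> = p ^ (m - r)"
    "\<And>c. c \<in> \<Lambda> \<Longrightarrow> dim (E c) = p ^ r" "\<And>c. c \<notin> \<Lambda> \<Longrightarrow> E c = {0}"
proof -
  obtain h \<mu> where h: "\<And>i. i < m \<Longrightarrow> h i \<in> E (\<mu> i)" and B: "B = span (power_product h ` reduced p m)"
    using homogeneous_generators by blast
  define \<Lambda> where "\<Lambda> = weight \<mu> ` reduced p m"
  define n where "n = card {e \<in> reduced p m. weight \<mu> e = 0}"
  have n: "card {e \<in> reduced p m. weight \<mu> e = c} = n" if "c \<in> \<Lambda>" for c
    using that card_weight_fibre by (auto simp: \<Lambda>_def n_def)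
  have "p ^ m = card (reduced p m)" by (simp add: card_reduced)
  also have "reduced p m = (\<Union>c\<in>\<Lambda>. {e \<in> reduced p m. weight \<mu> e = c})" by (auto simp: \<Lambda>_def)
  also have "card \<dots> = (\<Sum>c\<in>\<Lambda>. n)"
    by (subst card_UN_disjoint) (auto simp: n \<Lambda>_def)
  finally have pm: "p ^ m = card \<Lambda> * n" by simp
  then obtain r where r: "r \<le> m" "n = p ^ r"
    using divides_primepow_nat[OF prime_p, of n m] by auto
  have "p ^ m = p ^ (m - r) * p ^ r" using r by (simp flip: power_add)
  then have "card \<Lambda> = p ^ (m - r)" using pm r p_pos by (simp del: p_pos)
  moreover have "0 \<in> \<Lambda>" by (auto simp: \<Lambda>_def weight_def intro!: image_eqI[of _ _ 0])
  moreover have "dim (E c) = p ^ r" if "c \<in> \<Lambda>" for c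
    using eigenspace_eq_span(2)[OF h B] n[OF that] r by simp
  moreover have "E c = {0}" if "c \<notin> \<Lambda>" for c
  proof -
    have "{e \<in> reduced p m. weight \<mu> e = c} = {}" using that by (auto simp: \<Lambda>_def)
    then show ?thesis using eigenspace_eq_span(1)[OF h B, of c] by (simp only: image_empty span_empty)
  qed
  ultimately show ?thesis using that[of \<Lambda> r] r by (simp add: \<Lambda>_def)
qed

end

section \<open>The splitting\<close>

context alg_closed_truncated_algebra
begin

lemma D_mem: "b \<in> B \<Longrightarrow> D b \<in> B" and D_pow_mem: "b \<in> B \<Longrightarrow> (D ^^ n) b \<in> B"
  using linear_onD(1)[OF linear_on_funpow[OF linear_D]] linear_onD(1)[OF linear_D] by auto

lemma E_subspace: "subspace (E c)"
  by (rule eigenspace_subspace[OF linear_\<Delta>])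

lemma D_mem_E: "b \<in> E c \<Longrightarrow> D b \<in> E c"
  by (auto simp: eigenspace_def D_mem linear_onD[OF linear_D] simp flip: funpow_swap1)

lemma D_pow_mem_E: "b \<in> E c \<Longrightarrow> (D ^^ n) b \<in> E c"
  by (induction n) (auto simp: D_mem_E)

lemma E_0_subalgebra: "unital_subalgebra (E 0)"
  using E_subspace one_mem_eigenspace[OF derivation_\<Delta>] eigenspace_mult[OF derivation_\<Delta>, of _ 0 _ 0]
  by (auto simp: unital_subalgebra_def)

lemma last_nonzero_iterate:
  fixes v :: 'u
  assumes "v \<noteq> 0" "(T ^^ n) v = (0::'u)"
  shows "\<exists>k. (T ^^ k) v \<noteq> 0 \<and> (T ^^ Suc k) v = 0"
  using assms(2)
proof (induction n)
  case 0
  then show ?case using assms(1) by simp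
next
  case (Suc n)
  then show ?case by (cases "(T ^^ n) v = 0") blast+
qed

text \<open>
  The last nonzero vector among \<open>v, D v, D ^ 2 v, \<dots>\<close> is a constant, hence a nonzero scalar.
\<close>

lemma E_0_simple:
  assumes J: "J \<subseteq> E 0" "\<And>f. f \<in> J \<Longrightarrow> D f \<in> J" "\<And>c f. f \<in> J \<Longrightarrow> c *s f \<in> J" "v \<in> J" "v \<noteq> 0"
  shows "1 \<in> J"
proof -
  have "\<Delta> v = 0" using J by (auto simp: eigenspace_def)
  then obtain k where k: "(D ^^ k) v \<noteq> 0" "(D ^^ Suc k) v = 0"
    using last_nonzero_iterate[OF J(5)] by blast
  have kJ: "(D ^^ k) v \<in> J" by (induction k) (use J in auto)
  then have "(D ^^ k) v \<in> B" using J(1) E_subset by blast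
  then obtain c where c: "(D ^^ k) v = c *s 1" using constants_D k(2) by auto
  then have "inverse c *s (c *s 1) \<in> J" "c \<noteq> 0" using J(3)[OF kJ, of "inverse c"] k by auto
  then show ?thesis by simp
qed

text \<open>
  The annihilator of \<open>u\<close> in \<open>E 0\<close> is stable under \<open>D\<close> and does not contain \<open>1\<close>.
\<close>

lemma E_0_torsion_free:
  assumes u: "u \<in> B" "u \<noteq> 0" "D u = l *s u" and f: "f \<in> E 0" "f * u = 0"
  shows "f = 0"
proof (rule ccontr)
  assume "f \<noteq> 0"
  have "1 \<in> {f \<in> E 0. f * u = 0}"
  proof (rule E_0_simple)
    fix g assume g: "g \<in> {f \<in> E 0. f * u = 0}"
    then have "D (g * u) = D g * u + g * D u" using derivation_on_B_mult[OF D] u E_subset by blast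
    then have "D g * u = 0" using g u linear_on_0[OF linear_D B_subspace] by (simp add: scale_mult)
    then show "D g \<in> {f \<in> E 0. f * u = 0}" using g D_mem_E by simp
  qed (use f \<open>f \<noteq> 0\<close> subspace_scale[OF E_subspace] in \<open>auto simp: scale_mult\<close>)
  then show False using u by simp
qed

lemma eigenvector_mem_E:
  assumes "u \<in> B" "D u = l *s u"
  shows "u \<in> E (l ^ N)"
proof -
  have "(D ^^ n) u = (l ^ n) *s u" for n
    by (induction n) (use assms in \<open>auto simp: linear_onD[OF linear_D] mult.commute\<close>)
  then show ?thesis using assms by (simp add: eigenspace_def)
qed

text \<open>
  On \<open>E c\<close> the operator \<open>D - l\<close> is nilpotent, where \<open>l\<close> is the \<open>N\<close>-th root of \<open>c\<close>.
\<close>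

lemma exists_eigenvector:
  assumes "E c \<noteq> {0}"
  obtains l u where "l ^ N = c" "u \<in> E c" "u \<noteq> 0" "D u = l *s u"
proof -
  obtain l where l: "l ^ N = c" using nth_root_exists[of N c] by auto
  obtain v where v: "v \<in> E c" "v \<noteq> 0" using assms subspace_0[OF E_subspace] by blast
  define T where "T = (\<lambda>b. D b - l *s b)"
  have T: "T b \<in> E c" if "b \<in> E c" for b
    using that by (auto simp: T_def D_mem_E intro!: subspace_diff[OF E_subspace] subspace_scale[OF E_subspace])
  have Tn: "(T ^^ n) v \<in> E c" for n by (induction n) (use v T in auto)
  have "poly_act D ([:- l, 1:] ^ n) v = (T ^^ n) v" for n
  proof (induction n)
    case 0
    then show ?case by (simp add: poly_act_def)
  next
    case (Suc n)
    then show ?case using v E_subset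
      by (subst power_Suc, subst poly_act_mult[OF linear_D B_subspace]) (auto simp: T_def poly_act_pCons)
  qed
  then have "(T ^^ N) v = \<Delta> v - (l ^ N) *s v"
    using poly_act_linear_power(2)[where N = N and k = m and l = l and T = D and v = v] prime_p p_eq by simp
  then have "(T ^^ N) v = 0" using v l by (simp add: eigenspace_def)
  then obtain k where k: "(T ^^ k) v \<noteq> 0" "(T ^^ Suc k) v = 0"
    using last_nonzero_iterate[OF v(2)] by blast
  show ?thesis by (rule that[OF l Tn k(1)]) (use k(2) in \<open>simp add: T_def\<close>)
qed

text \<open>
  Multiplication by \<open>u\<close> embeds \<open>E 0\<close> into \<open>E c\<close>, and the dimensions agree.
\<close>

lemma E_eq_multiples:
  assumes u: "u \<in> E c" "u \<noteq> 0" "D u = l *s u" and dim: "dim (E c) \<le> dim (E 0)" and b: "b \<in> E c"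
  shows "\<exists>f\<in>E 0. b = f * u"
proof -
  obtain K where K: "K \<subseteq> E 0" "independent K" "E 0 \<subseteq> span K" "card K = dim (E 0)"
    using basis_exists by blast
  obtain T where T: "finite T" "B \<subseteq> span T" by (rule B_finite_span)
  have fK: "finite K" using card_le_dim_of_independent[of K B T] K T E_subset by blast
  have "dim (span ((\<lambda>f. f * u) ` K)) = card K"
  proof (rule dim_span_family[OF fK])
    fix c :: "'u \<Rightarrow> 'a" assume "(\<Sum>f\<in>K. c f *s (f * u)) = 0"
    then have "(\<Sum>f\<in>K. c f *s f) * u = 0" by (simp add: sum_distrib_right scale_mult_left)
    moreover have "(\<Sum>f\<in>K. c f *s f) \<in> E 0"
      using K E_subspace by (auto intro!: subspace_sum subspace_scale)
    ultimately have "(\<Sum>f\<in>K. c f *s f) = 0" using E_0_torsion_free[of u l] u E_subset by blast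
    then show "\<forall>f\<in>K. c f = 0" using independentD[OF K(2) fK subset_refl] by blast
  qed
  moreover have "f * u \<in> E c" if "f \<in> E 0" for f
    using eigenspace_mult[OF derivation_\<Delta> that u(1)] by simp
  then have "span ((\<lambda>f. f * u) ` K) \<subseteq> E c"
    using K by (intro span_minimal E_subspace) auto
  ultimately have "span ((\<lambda>f. f * u) ` K) = E c"
    using dim K(4) E_subset by (intro subspace_eq E_subspace) auto
  then have "b \<in> span ((\<lambda>f. f * u) ` K)" using b by simp
  then show ?thesis
  proof (induction rule: span_induct_alt)
    case base
    then show ?case using subspace_0[OF E_subspace] by (intro bexI[of _ 0]) auto
  next
    case (step k v y)
    then obtain f g where "g \<in> E 0" "y = g * u" "f \<in> E 0" "v = f * u" using K by auto
    then show ?case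
      by (intro bexI[of _ "k *s f + g"])
         (auto simp: scale_mult distrib_right intro!: subspace_add[OF E_subspace] subspace_scale[OF E_subspace])
  qed
qed

text \<open>
  The semisimple tensor factor. Products of eigenvectors of a derivation are eigenvectors, so
  this span is a subalgebra.
\<close>

definition C :: "'u set" where
  "C = span {v \<in> B. \<exists>l. D v = l *s v}"

lemma C_subset: "C \<subseteq> B"
  unfolding C_def by (intro span_minimal B_subspace) auto

lemma C_subalgebra: "unital_subalgebra C"
  unfolding unital_subalgebra_def
proof (intro conjI ballI)
  show "subspace C" by (simp add: C_def)
  have "D 1 = 0 *s 1" using derivation_on_B_one[OF D] by simp
  then show "1 \<in> C" unfolding C_def using one_mem by (intro span_base CollectI conjI exI[of _ 0]) auto
  fix a b assume "a \<in> C" "b \<in> C"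
  then show "a * b \<in> C" unfolding C_def
  proof (rule span_mult_mem)
    fix s t assume "s \<in> {v \<in> B. \<exists>l. D v = l *s v}" "t \<in> {v \<in> B. \<exists>l. D v = l *s v}"
    then obtain k l where "s \<in> B" "t \<in> B" "D s = k *s s" "D t = l *s t" by blast
    then have "s * t \<in> B" "D (s * t) = (k + l) *s (s * t)"
      by (auto simp: mult_mem derivation_on_B_mult[OF D] scale_mult scale_left_distrib)
    then show "s * t \<in> span {v \<in> B. \<exists>l. D v = l *s v}" by (intro span_base) blast
  qed simp
qed

lemma D_mem_C: "b \<in> C \<Longrightarrow> D b \<in> C"
proof -
  assume "b \<in> C"
  then have "b \<in> B \<and> D b \<in> C" unfolding C_def
  proof (induction rule: span_induct_alt)
    case base
    then show ?case
      by (simp add: linear_on_0[OF linear_D B_subspace] span_zero subspace_0[OF B_subspace])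
  next
    case (step k v y)
    then obtain l where l: "v \<in> B" "D v = l *s v" by blast
    have kv: "k *s v \<in> B" using l by (intro subspace_scale[OF B_subspace]) auto
    have "D (k *s v + y) = (k * l) *s v + D y"
      using step kv l by (simp add: linear_onD[OF linear_D])
    moreover have "(k * l) *s v \<in> span {v \<in> B. \<exists>l. D v = l *s v}"
      using step by (intro span_scale span_base)
    ultimately show ?case using step kv subspace_add[OF B_subspace] by (simp add: span_add)
  qed
  then show ?thesis ..
qed

text \<open>
  A nilpotent operator with one-dimensional kernel is a single Jordan block: if \<open>n\<close> is the last
  exponent with \<open>D ^ n \<noteq> 0\<close> on \<open>E 0\<close> and \<open>D ^ n v \<noteq> 0\<close>, then \<open>v, D v, \<dots>, D ^ n v\<close> is a basis.
\<close>

lemma nilpotent_cyclic: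
  shows "\<exists>n v. v \<in> E 0 \<and> (D ^^ n) v \<noteq> 0 \<and> (\<forall>w\<in>E 0. (D ^^ Suc n) w = 0) \<and> dim (E 0) = Suc n"
proof -
  let ?P = "\<lambda>n. \<forall>w\<in>E 0. (D ^^ n) w = 0"
  have "?P N" by (auto simp: eigenspace_def)
  then have P: "?P (Least ?P)" by (rule LeastI)
  have one: "1 \<in> E 0" using unital_subalgebraD(2)[OF E_0_subalgebra] .
  then have "Least ?P \<noteq> 0" using P by (metis funpow_0 zero_neq_one)
  then obtain n where n: "Least ?P = Suc n" by (cases "Least ?P") auto
  then have nil: "\<And>w. w \<in> E 0 \<Longrightarrow> (D ^^ Suc n) w = 0" using P by simp
  have "\<not> ?P n" using not_less_Least[of n ?P] n by simp
  then obtain v where v: "v \<in> E 0" "(D ^^ n) v \<noteq> 0" by blast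
  have nil': "(D ^^ k) v = 0" if "k > n" for k
  proof -
    have "(D ^^ k) v = (D ^^ Suc n) ((D ^^ (k - Suc n)) v)"
      using that by (simp flip: funpow_add comp_apply[of "D ^^ _"] del: funpow.simps)
    then show ?thesis using nil D_pow_mem_E v by simp
  qed
  have EB: "w \<in> E 0 \<Longrightarrow> (D ^^ k) w \<in> B" for w k using E_subset D_pow_mem by blast
  obtain d where d: "(D ^^ n) v = d *s 1"
    using constants_D[OF EB[OF v(1)]] nil[OF v(1)] by auto
  have lin: "linear_on B (D ^^ k)" for k by (rule linear_on_funpow[OF linear_D])
  let ?b = "\<lambda>i. (D ^^ i) v"
  have bE: "?b i \<in> E 0" for i using D_pow_mem_E v by simp
  have bB: "?b i \<in> B" for i using EB v by simp
  have "dim (span (?b ` {..n})) = card {..n}"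
  proof (rule dim_span_family)
    fix c :: "nat \<Rightarrow> 'a" assume s: "(\<Sum>i\<le>n. c i *s ?b i) = 0"
    have "c i = 0" if "i \<le> n" for i
      using that
    proof (induction i rule: less_induct)
      case (less i)
      have "0 = (D ^^ (n - i)) (\<Sum>j\<le>n. c j *s ?b j)" by (simp only: s linear_on_0[OF lin B_subspace])
      also have "\<dots> = (\<Sum>j\<le>n. c j *s (D ^^ (n - i + j)) v)"
        using bB
        by (subst linear_on_sum[OF lin B_subspace])
           (auto simp: linear_onD[OF lin] funpow_add intro!: subspace_scale[OF B_subspace] sum.cong)
      also have "\<dots> = (\<Sum>j\<in>{i}. c j *s (D ^^ (n - i + j)) v)"
      proof (rule sum.mono_neutral_right)
        show "\<forall>j\<in>{..n} - {i}. c j *s (D ^^ (n - i + j)) v = 0"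
        proof
          fix j assume j: "j \<in> {..n} - {i}"
          show "c j *s (D ^^ (n - i + j)) v = 0"
          proof (cases "j < i")
            case True
            then show ?thesis using less by simp
          next
            case False
            then have "n < n - i + j" using j less.prems by auto
            then show ?thesis using nil' by simp
          qed
        qed
      qed (use less.prems in auto)
      finally show "c i = 0" using v(2) less.prems by simp
    qed
    then show "\<forall>i\<in>{..n}. c i = 0" by simp
  qed simp
  moreover have "E 0 \<subseteq> span (?b ` {..n})"
  proof -
    have "w \<in> span (?b ` {..n})" if "k \<le> Suc n" "w \<in> E 0" "(D ^^ k) w = 0" for k w
      using that
    proof (induction k arbitrary: w)
      case 0
      then show ?case by (simp add: span_zero)
    next
      case (Suc k)
      obtain c where c: "(D ^^ k) w = c *s 1"
        using constants_D[OF EB[OF Suc.prems(2)]] Suc.prems by auto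
      \<comment> \<open>the basis vector whose \<open>k\<close>-th image is a nonzero scalar, scaled to match \<open>w\<close>\<close>
      let ?t = "(c / d) *s ?b (n - k)"
      have "d \<noteq> 0" using d v by auto
      have "(D ^^ k) ?t = (c / d) *s (D ^^ n) v"
        using Suc.prems bE E_subset
        by (subst linear_onD(3)[OF lin]) (auto simp flip: funpow_add comp_apply[of "D ^^ _"])
      then have "(D ^^ k) (w - ?t) = 0"
        using Suc.prems bE E_subset c d \<open>d \<noteq> 0\<close>
        by (subst linear_on_diff[OF lin B_subspace]) (auto intro!: subspace_scale[OF B_subspace])
      moreover have "w - ?t \<in> E 0"
        using Suc.prems bE by (intro subspace_diff[OF E_subspace] subspace_scale[OF E_subspace]) auto
      ultimately have "w - ?t \<in> span (?b ` {..n})" using Suc by simp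
      moreover have "?t \<in> span (?b ` {..n})" by (intro span_scale span_base) auto
      ultimately have "(w - ?t) + ?t \<in> span (?b ` {..n})" by (rule span_add)
      then show ?case by simp
    qed
    then show ?thesis using nil by blast
  qed
  moreover have "span (?b ` {..n}) \<subseteq> E 0" by (rule span_minimal[OF _ E_subspace]) (use bE in auto)
  ultimately have "dim (E 0) = Suc n" by (metis card_atMost subset_antisym)
  then show ?thesis using v nil by blast
qed

text \<open>
  The decomposition inside the host. The tensor factors are \<open>B0 = E 0\<close> and \<open>B1 = C\<close>; what has to be
  added to the previous results is that both have truncated coordinates.
\<close>

proposition splitting:
  obtains r B0 B1 y z where "r \<le> m"
    "truncated_coordinates r y B0" "truncated_coordinates (m - r) z B1"
    "unital_subalgebra B0" "unital_subalgebra B1" "B0 \<subseteq> B" "B1 \<subseteq> B"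
    "\<And>b. b \<in> B0 \<Longrightarrow> D b \<in> B0" "\<And>b. b \<in> B1 \<Longrightarrow> D b \<in> B1"
    "B \<subseteq> span {f * g |f g. f \<in> B0 \<and> g \<in> B1}"
    "\<And>b. b \<in> B0 \<Longrightarrow> (D ^^ (p ^ r)) b = 0" "\<exists>b\<in>B0. (D ^^ (p ^ r - 1)) b \<noteq> 0"
    "finite {l. \<exists>v\<in>B1. v \<noteq> 0 \<and> D v = l *s v}"
    "card {l. \<exists>v\<in>B1. v \<noteq> 0 \<and> D v = l *s v} = p ^ (m - r)"
proof -
  obtain \<Lambda> r where \<Lambda>: "finite \<Lambda>" "0 \<in> \<Lambda>" "r \<le> m" "card \<Lambda> = p ^ (m - r)"
    "\<And>c. c \<in> \<Lambda> \<Longrightarrow> dim (E c) = p ^ r" "\<And>c. c \<notin> \<Lambda> \<Longrightarrow> E c = {0}"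
    using eigenspace_dimensions by blast
  have nz: "E c \<noteq> {0}" if "c \<in> \<Lambda>" for c
  proof
    assume "E c = {0}"
    then have "dim (E c) \<le> card ({} :: 'u set)" by (intro dim_le_card) auto
    then show False using \<Lambda>(5)[OF that] prime_p by (simp add: prime_gt_0_nat)
  qed
  have "\<forall>c\<in>\<Lambda>. \<exists>l u. l ^ N = c \<and> u \<in> E c \<and> u \<noteq> 0 \<and> D u = l *s u"
  proof
    fix c assume "c \<in> \<Lambda>"
    then show "\<exists>l u. l ^ N = c \<and> u \<in> E c \<and> u \<noteq> 0 \<and> D u = l *s u"
      using exists_eigenvector[OF nz] by blast
  qed
  then obtain l where "\<forall>c\<in>\<Lambda>. \<exists>u. l c ^ N = c \<and> u \<in> E c \<and> u \<noteq> 0 \<and> D u = l c *s u"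
    using bchoice[of \<Lambda> "\<lambda>c l. \<exists>u. l ^ N = c \<and> u \<in> E c \<and> u \<noteq> 0 \<and> D u = l *s u"] by blast
  then obtain u where lu: "\<And>c. c \<in> \<Lambda> \<Longrightarrow> l c ^ N = c \<and> u c \<in> E c \<and> u c \<noteq> 0 \<and> D (u c) = l c *s u c"
    using bchoice[of \<Lambda> "\<lambda>c u. l c ^ N = c \<and> u \<in> E c \<and> u \<noteq> 0 \<and> D u = l c *s u"] by blast
  have mult: "\<exists>f\<in>E 0. b = f * u c" if "c \<in> \<Lambda>" "b \<in> E c" for b c
    using E_eq_multiples[of "u c" c "l c" b] lu[OF that(1)] \<Lambda>(2,5) that by simp
  have eigen: "k ^ N \<in> \<Lambda>" "k = l (k ^ N)" "v \<in> span {u (k ^ N)}"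
    if v: "v \<in> B" "v \<noteq> 0" "D v = k *s v" for v k
  proof -
    have vE: "v \<in> E (k ^ N)" using eigenvector_mem_E v by blast
    then show k: "k ^ N \<in> \<Lambda>" using \<Lambda>(6) v(2) by blast
    let ?u = "u (k ^ N)"
    have "l (k ^ N) ^ N = k ^ N" using lu[OF k] by blast
    then show lk: "k = l (k ^ N)" by (rule power_inj[symmetric])
    then have u: "?u \<in> B" "?u \<noteq> 0" "D ?u = k *s ?u" using lu[OF k] E_subset by auto
    obtain f where f: "f \<in> E 0" "v = f * ?u" using mult[OF k vE] by blast
    have fB: "f \<in> B" using f E_subset by blast
    have "D f * ?u + f * D ?u = k *s v" using derivation_on_B_mult[OF D fB u(1)] f v by simp
    then have "D f * ?u = 0" using f u by (simp add: scale_mult)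
    then have "D f = 0" using E_0_torsion_free[OF u D_mem_E[OF f(1)]] by blast
    then obtain c where "f = c *s 1" using constants_D[OF fB] by blast
    then show "v \<in> span {?u}" using f by (auto simp: scale_mult intro: span_scale span_base)
  qed
  have uC: "u c \<in> C" if "c \<in> \<Lambda>" for c
    unfolding C_def using lu[OF that] E_subset by (intro span_base) blast
  have "C \<subseteq> span (u ` \<Lambda>)"
    unfolding C_def
  proof (intro span_minimal subspace_span subsetI)
    fix v assume "v \<in> {v \<in> B. \<exists>l. D v = l *s v}"
    then obtain k where v: "v \<in> B" "D v = k *s v" by blast
    show "v \<in> span (u ` \<Lambda>)"
    proof (cases "v = 0")
      case False
      then show ?thesis using eigen[OF v(1) False v(2)] span_mono[of "{u (k ^ N)}" "u ` \<Lambda>"] by blast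
    qed (simp add: span_zero)
  qed
  then have dimC: "dim C \<le> p ^ (m - r)"
    using dim_le_card[of C "u ` \<Lambda>"] card_image_le[of \<Lambda> u] \<Lambda>(1,4) by simp
  have ev: "{k. \<exists>v\<in>C. v \<noteq> 0 \<and> D v = k *s v} = l ` \<Lambda>"
  proof
    show "{k. \<exists>v\<in>C. v \<noteq> 0 \<and> D v = k *s v} \<subseteq> l ` \<Lambda>" using eigen(1,2) C_subset by blast
    show "l ` \<Lambda> \<subseteq> {k. \<exists>v\<in>C. v \<noteq> 0 \<and> D v = k *s v}" using lu uC by blast
  qed
  have "inj_on l \<Lambda>"
  proof (rule inj_onI)
    fix c d assume cd: "c \<in> \<Lambda>" "d \<in> \<Lambda>" "l c = l d"
    have "c = l c ^ N" using lu cd(1) by simp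
    also have "\<dots> = l d ^ N" using cd(3) by simp
    also have "\<dots> = d" using lu cd(2) by simp
    finally show "c = d" .
  qed
  then have ev_card: "card {k. \<exists>v\<in>C. v \<noteq> 0 \<and> D v = k *s v} = p ^ (m - r)"
    unfolding ev by (simp add: card_image \<Lambda>(4))
  let ?P = "{f * g |f g. f \<in> E 0 \<and> g \<in> C}"
  have spanP: "B \<subseteq> span ?P"
  proof -
    have "(\<Union>c. E c) \<subseteq> span ?P"
    proof
      fix b assume "b \<in> (\<Union>c. E c)"
      then obtain c where c: "b \<in> E c" by blast
      show "b \<in> span ?P"
      proof (cases "c \<in> \<Lambda>")
        case True
        then obtain f where "f \<in> E 0" "b = f * u c" using mult c by blast
        then show ?thesis using uC[OF True] by (intro span_base) blast
      qed (use \<Lambda>(6) c in \<open>auto simp: span_zero\<close>)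
    qed
    then show ?thesis using E_spans span_minimal[OF _ subspace_span] by blast
  qed

  \<comment> \<open>The maximal ideals of the two factors span the maximal ideal modulo its square, since
    \<open>f * g - a * b = (f - a) * (g - b) + a * (g - b) + b * (f - a)\<close> for residues \<open>a\<close> and \<open>b\<close>.\<close>
  define S where "S = filtration 1 \<inter> E 0 \<union> filtration 1 \<inter> C"
  have "\<exists>c. b - c *s 1 \<in> span (S \<union> filtration 2)" if "b \<in> B" for b
  proof -
    have "b \<in> span ?P" using that spanP by blast
    then show ?thesis
    proof (induction rule: span_induct_alt)
      case base
      then show ?case by (intro exI[of _ 0]) (simp add: span_zero)
    next
      case (step k v y)
      then obtain d where d: "y - d *s 1 \<in> span (S \<union> filtration 2)" by blast
      from step obtain f g where fg: "f \<in> E 0" "g \<in> C" "v = f * g" by blast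
      obtain a where a: "f - a *s 1 \<in> filtration 1" using mem_decompose_scalar fg E_subset by blast
      obtain b where b: "g - b *s 1 \<in> filtration 1" using mem_decompose_scalar fg C_subset by blast
      have "f - a *s 1 \<in> S" "g - b *s 1 \<in> S"
        using a b fg unital_subalgebraD[OF E_0_subalgebra] unital_subalgebraD[OF C_subalgebra]
        by (auto simp: S_def intro!: subspace_diff subspace_scale)
      then have "f - a *s 1 \<in> span (S \<union> filtration 2)" "g - b *s 1 \<in> span (S \<union> filtration 2)"
        by (auto intro: span_base)
      moreover have "(f - a *s 1) * (g - b *s 1) \<in> span (S \<union> filtration 2)"
        using filtration_mult[OF a b] by (auto intro: span_base simp: numeral_2_eq_2)
      ultimately have "k *s ((f - a *s 1) * (g - b *s 1) + a *s (g - b *s 1) + b *s (f - a *s 1)) + (y - d *s 1)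
          \<in> span (S \<union> filtration 2)"
        using d by (intro span_add span_scale)
      also have "k *s ((f - a *s 1) * (g - b *s 1) + a *s (g - b *s 1) + b *s (f - a *s 1)) + (y - d *s 1)
          = k *s v + y - (k * (a * b) + d) *s 1"
        by (simp add: fg(3) algebra_simps scale_mult)
      finally show ?case by blast
    qed
  qed
  moreover have "S \<subseteq> filtration 1" by (auto simp: S_def)
  ultimately obtain Z where Z: "Z \<subseteq> S" "finite Z" "card Z \<le> m"
    and gen: "\<And>A. unital_subalgebra A \<Longrightarrow> Z \<subseteq> A \<Longrightarrow> B \<subseteq> A"
    using exists_generators by metis
  define Z0 Z1 where "Z0 = Z \<inter> E 0" and "Z1 = Z - E 0"
  have fin: "finite Z0" "finite Z1" using Z by (auto simp: Z0_def Z1_def)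
  have card01: "card Z0 + card Z1 \<le> m"
    using Z(2,3) card_Un_disjoint[OF fin] by (simp add: Z0_def Z1_def Int_Diff_Un Int_Diff_disjoint)
  obtain y where y: "bij_betw y {..<card Z0} Z0"
    using ex_bij_betw_nat_finite[OF fin(1)] atLeast0LessThan by metis
  obtain z where z: "bij_betw z {..<card Z1} Z1"
    using ex_bij_betw_nat_finite[OF fin(2)] atLeast0LessThan by metis
  have yS: "y i \<in> filtration 1 \<inter> E 0" if "i < card Z0" for i
    using bij_betwE[OF y] that Z(1) by (auto simp: Z0_def S_def)
  have zS: "z i \<in> filtration 1 \<inter> C" if "i < card Z1" for i
    using bij_betwE[OF z] that Z(1) by (auto simp: Z1_def S_def)
  define P0 where "P0 = span (power_product y ` reduced p (card Z0))"
  define P1 where "P1 = span (power_product z ` reduced p (card Z1))"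
  have py: "\<exists>c. y i ^ p = c *s 1" if "i < card Z0" for i
    using yS[OF that] filtration_1_power by (intro exI[of _ 0]) simp
  have pz: "\<exists>c. z i ^ p = c *s 1" if "i < card Z1" for i
    using zS[OF that] filtration_1_power by (intro exI[of _ 0]) simp
  have P0: "unital_subalgebra P0" "\<And>i. i < card Z0 \<Longrightarrow> y i \<in> P0"
    unfolding P0_def using reduced_span_subalgebra[of "card Z0" y p] py by auto
  have P1: "unital_subalgebra P1" "\<And>i. i < card Z1 \<Longrightarrow> z i \<in> P1"
    unfolding P1_def using reduced_span_subalgebra[of "card Z1" z p] pz by auto
  have P0E: "P0 \<subseteq> E 0" unfolding P0_def using reduced_span_minimal[OF E_0_subalgebra] yS by blast
  have P1C: "P1 \<subseteq> C" unfolding P1_def using reduced_span_minimal[OF C_subalgebra] zS by blast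
  obtain T where T: "finite T" "B \<subseteq> span T" by (rule B_finite_span)
  obtain K0 where K0: "K0 \<subseteq> P0" "independent K0" "P0 \<subseteq> span K0" "card K0 = dim P0"
    using basis_exists by blast
  obtain K1 where K1: "K1 \<subseteq> P1" "independent K1" "P1 \<subseteq> span K1" "card K1 = dim P1"
    using basis_exists by blast
  have fK: "finite K0" "finite K1"
    using card_le_dim_of_independent[of K0 P0 T] card_le_dim_of_independent[of K1 P1 T]
      K0 K1 T P0E P1C E_subset C_subset by blast+
  define Q where "Q = span ((\<lambda>(f, g). f * g) ` (K0 \<times> K1))"
  have PQ: "f * g \<in> Q" if "f \<in> P0" "g \<in> P1" for f g
    by (rule span_mult_mem[of f K0 g K1]) (use that K0 K1 in \<open>auto simp: Q_def intro: span_base\<close>)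
  have "unital_subalgebra Q"
    unfolding unital_subalgebra_def
  proof (intro conjI ballI)
    show "subspace Q" by (simp add: Q_def)
    show "1 \<in> Q" using PQ[of 1 1] unital_subalgebraD P0(1) P1(1) by simp
    fix a b assume "a \<in> Q" "b \<in> Q"
    then show "a * b \<in> Q" unfolding Q_def
    proof (rule span_mult_mem)
      fix s t assume "s \<in> (\<lambda>(f, g). f * g) ` (K0 \<times> K1)" "t \<in> (\<lambda>(f, g). f * g) ` (K0 \<times> K1)"
      then obtain f g f' g' where "f \<in> K0" "g \<in> K1" "f' \<in> K0" "g' \<in> K1" "s = f * g" "t = f' * g'"
        by auto
      then have "f \<in> P0" "g \<in> P1" "f' \<in> P0" "g' \<in> P1" "s = f * g" "t = f' * g'"
        using K0(1) K1(1) by auto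
      moreover from this have st: "s * t = (f * f') * (g * g')" by (simp add: algebra_simps)
      ultimately show "s * t \<in> span ((\<lambda>(f, g). f * g) ` (K0 \<times> K1))"
        using PQ[of "f * f'" "g * g'"] unital_subalgebraD(3) P0(1) P1(1) unfolding Q_def st by blast
    qed simp
  qed
  moreover have "Z \<subseteq> Q"
  proof
    fix a assume "a \<in> Z"
    then consider "a \<in> Z0" | "a \<in> Z1" by (auto simp: Z0_def Z1_def)
    then show "a \<in> Q"
    proof cases
      case 1
      then obtain i where "i < card Z0" "a = y i" using bij_betw_imp_surj_on[OF y] by blast
      then have "a \<in> P0" using P0(2) by simp
      then show ?thesis using PQ[of a 1] unital_subalgebraD(2)[OF P1(1)] by simp
    next
      case 2
      then obtain i where "i < card Z1" "a = z i" using bij_betw_imp_surj_on[OF z] by blast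
      then have "a \<in> P1" using P1(2) by simp
      then show ?thesis using PQ[of 1 a] unital_subalgebraD(2)[OF P0(1)] by simp
    qed
  qed
  ultimately have BQ: "B \<subseteq> Q" by (rule gen)
  \<comment> \<open>Counting dimensions: \<open>P0\<close> and \<open>P1\<close> cannot be smaller than \<open>E 0\<close> and \<open>C\<close>.\<close>
  have "dim B \<le> card ((\<lambda>(f, g). f * g) ` (K0 \<times> K1))"
    using BQ fK unfolding Q_def by (intro dim_le_card) auto
  also have "\<dots> \<le> dim P0 * dim P1"
    using card_image_le[of "K0 \<times> K1" "\<lambda>(f, g). f * g"] fK K0 K1 by (simp add: card_cartesian_product)
  finally have prod: "p ^ r * p ^ (m - r) \<le> dim P0 * dim P1"
    using \<Lambda>(3) by (simp add: dim_B flip: power_add)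
  have d0: "dim P0 \<le> p ^ card Z0" and d1: "dim P1 \<le> p ^ card Z1"
    unfolding P0_def P1_def by (rule dim_reduced_span_le, simp)+
  have d0': "dim P0 \<le> p ^ r" using dim_mono_finite_span[OF P0E _ T(1)] E_subset T(2) \<Lambda>(2,5) by auto
  have d1': "dim P1 \<le> p ^ (m - r)"
    using dim_mono_finite_span[OF P1C _ T(1)] C_subset T(2) dimC by (metis order_trans)
  have "p ^ r * p ^ (m - r) \<le> p ^ card Z0 * p ^ (m - r)"
    using prod mult_le_mono[OF d0 d1'] by linarith
  then have "r \<le> card Z0" using prime_gt_1_nat[OF prime_p] by simp
  have "p ^ r * p ^ (m - r) \<le> p ^ r * p ^ card Z1"
    using prod mult_le_mono[OF d0' d1] by linarith
  then have "m - r \<le> card Z1" using prime_gt_1_nat[OF prime_p] by simp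
  then have cards: "card Z0 = r" "card Z1 = m - r" using \<open>r \<le> card Z0\<close> card01 \<Lambda>(3) by auto
  have "p ^ r * p ^ (m - r) \<le> dim P0 * p ^ (m - r)"
    using prod mult_le_mono2[OF d1', of "dim P0"] by linarith
  then have dimP0: "dim P0 = p ^ r" using d0' prime_gt_0_nat[OF prime_p] by simp
  have "p ^ r * p ^ (m - r) \<le> p ^ r * dim P1"
    using prod mult_le_mono1[OF d0', of "dim P1"] by linarith
  then have dimP1: "dim P1 = p ^ (m - r)" using d1' prime_gt_0_nat[OF prime_p] by simp
  have P0_eq: "P0 = E 0"
    using subspace_eq[OF _ E_subspace P0E E_subset] unital_subalgebraD(1)[OF P0(1)] dimP0 \<Lambda>(2,5) by simp
  have P1_eq: "P1 = C"
    using subspace_eq[OF _ _ P1C C_subset] unital_subalgebraD(1)[OF P1(1)]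
      unital_subalgebraD(1)[OF C_subalgebra] dimP1 dimC by simp
  have "truncated_coordinates r y (E 0)"
    using yS filtration_1_power dimP0 P0_def
    unfolding truncated_coordinates_def cards P0_eq by (auto simp: p_eq)
  moreover have "truncated_coordinates (m - r) z C"
    using zS filtration_1_power dimP1 P1_def
    unfolding truncated_coordinates_def cards P1_eq by (auto simp: p_eq)
  moreover obtain n v where nv: "v \<in> E 0" "(D ^^ n) v \<noteq> 0" "\<And>w. w \<in> E 0 \<Longrightarrow> (D ^^ Suc n) w = 0"
    "p ^ r = Suc n"
    using nilpotent_cyclic \<Lambda>(2,5) by metis
  moreover have "\<exists>b\<in>E 0. (D ^^ (p ^ r - 1)) b \<noteq> 0" using nv(1,2,4) by auto
  ultimately show ?thesis
    using \<Lambda>(3) E_0_subalgebra C_subalgebra E_subset C_subset D_mem_E D_mem_C spanP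
      ev_card finite_imageI[OF \<Lambda>(1), of l, folded ev]
    by (intro that[of r y "E 0" z C]) simp_all
qed

end

section \<open>Record algebras and their quotients\<close>

context commutative_algebra
begin

text \<open>
  The record \<open>A\<close> is a copy of the subalgebra \<open>H\<close>, with \<open>\<phi>\<close> as the isomorphism. The conditions speak of
  the operations that occur in \<^const>\<open>alg_iso\<close>; all laws of an algebra are inherited from \<open>H\<close>.
\<close>

definition represents :: "('a, 'b) module \<Rightarrow> ('b \<Rightarrow> 'u) \<Rightarrow> 'u set \<Rightarrow> bool" where
  "represents A \<phi> H \<longleftrightarrow> bij_betw \<phi> (carrier A) H \<and> unital_subalgebra H \<and>
     (\<forall>a\<in>carrier A. \<forall>b\<in>carrier A. a \<oplus>\<^bsub>A\<^esub> b \<in> carrier A \<and> \<phi> (a \<oplus>\<^bsub>A\<^esub> b) = \<phi> a + \<phi> b) \<and>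
     (\<forall>a\<in>carrier A. \<forall>b\<in>carrier A. a \<otimes>\<^bsub>A\<^esub> b \<in> carrier A \<and> \<phi> (a \<otimes>\<^bsub>A\<^esub> b) = \<phi> a * \<phi> b) \<and>
     (\<forall>c. \<forall>a\<in>carrier A. c \<odot>\<^bsub>A\<^esub> a \<in> carrier A \<and> \<phi> (c \<odot>\<^bsub>A\<^esub> a) = c *s \<phi> a) \<and>
     \<zero>\<^bsub>A\<^esub> \<in> carrier A \<and> \<phi> \<zero>\<^bsub>A\<^esub> = 0 \<and> \<one>\<^bsub>A\<^esub> \<in> carrier A \<and> \<phi> \<one>\<^bsub>A\<^esub> = 1"

context
  fixes A :: "('a, 'b) module" and \<phi> :: "'b \<Rightarrow> 'u" and H :: "'u set"
  assumes rep: "represents A \<phi> H"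
begin

lemma represents_simps:
  "a \<in> carrier A \<Longrightarrow> b \<in> carrier A \<Longrightarrow> a \<oplus>\<^bsub>A\<^esub> b \<in> carrier A"
  "a \<in> carrier A \<Longrightarrow> b \<in> carrier A \<Longrightarrow> \<phi> (a \<oplus>\<^bsub>A\<^esub> b) = \<phi> a + \<phi> b"
  "a \<in> carrier A \<Longrightarrow> b \<in> carrier A \<Longrightarrow> a \<otimes>\<^bsub>A\<^esub> b \<in> carrier A"
  "a \<in> carrier A \<Longrightarrow> b \<in> carrier A \<Longrightarrow> \<phi> (a \<otimes>\<^bsub>A\<^esub> b) = \<phi> a * \<phi> b"
  "a \<in> carrier A \<Longrightarrow> c \<odot>\<^bsub>A\<^esub> a \<in> carrier A"
  "a \<in> carrier A \<Longrightarrow> \<phi> (c \<odot>\<^bsub>A\<^esub> a) = c *s \<phi> a"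
  "\<zero>\<^bsub>A\<^esub> \<in> carrier A" "\<phi> \<zero>\<^bsub>A\<^esub> = 0" "\<one>\<^bsub>A\<^esub> \<in> carrier A" "\<phi> \<one>\<^bsub>A\<^esub> = 1"
  using rep by (auto simp: represents_def)

lemma represents_subalgebra: "unital_subalgebra H"
  using rep by (simp add: represents_def)

lemma represents_mem: "a \<in> carrier A \<Longrightarrow> \<phi> a \<in> H"
  using rep by (auto simp: represents_def bij_betw_def)

lemma represents_inj: "a \<in> carrier A \<Longrightarrow> b \<in> carrier A \<Longrightarrow> \<phi> a = \<phi> b \<Longrightarrow> a = b"
  using rep by (auto simp: represents_def bij_betw_def inj_on_def)

lemma represents_surj: "h \<in> H \<Longrightarrow> \<exists>a\<in>carrier A. \<phi> a = h"
  using rep by (auto simp: represents_def bij_betw_def)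

lemma represents_eq_zero_iff: "a \<in> carrier A \<Longrightarrow> \<phi> a = 0 \<longleftrightarrow> a = \<zero>\<^bsub>A\<^esub>"
  using represents_inj[of a "\<zero>\<^bsub>A\<^esub>"] represents_simps by metis

lemma represents_minus: "a \<in> carrier A \<Longrightarrow> \<exists>b\<in>carrier A. \<phi> b = - \<phi> a"
  using represents_surj subspace_neg[OF unital_subalgebraD(1)[OF represents_subalgebra]] represents_mem by blast

lemma represents_abelian_group: "abelian_group A"
proof (rule abelian_groupI)
  fix a b c assume *: "a \<in> carrier A" "b \<in> carrier A" "c \<in> carrier A"
  show "a \<oplus>\<^bsub>A\<^esub> b \<oplus>\<^bsub>A\<^esub> c = a \<oplus>\<^bsub>A\<^esub> (b \<oplus>\<^bsub>A\<^esub> c)"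
    by (rule represents_inj) (use * in \<open>auto simp: represents_simps\<close>)
next
  fix a b assume *: "a \<in> carrier A" "b \<in> carrier A"
  show "a \<oplus>\<^bsub>A\<^esub> b = b \<oplus>\<^bsub>A\<^esub> a"
    by (rule represents_inj) (use * in \<open>auto simp: represents_simps\<close>)
next
  fix a assume *: "a \<in> carrier A"
  show "\<zero>\<^bsub>A\<^esub> \<oplus>\<^bsub>A\<^esub> a = a" by (rule represents_inj) (use * in \<open>auto simp: represents_simps\<close>)
  obtain b where b: "b \<in> carrier A" "\<phi> b = - \<phi> a" using represents_minus * by blast
  have "b \<oplus>\<^bsub>A\<^esub> a = \<zero>\<^bsub>A\<^esub>" by (rule represents_inj) (use * b in \<open>auto simp: represents_simps\<close>)
  then show "\<exists>b\<in>carrier A. b \<oplus>\<^bsub>A\<^esub> a = \<zero>\<^bsub>A\<^esub>" using b by blast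
qed (auto simp: represents_simps)

lemma represents_a_inv:
  assumes "a \<in> carrier A"
  shows "m_inv (add_monoid A) a \<in> carrier A" "\<phi> (m_inv (add_monoid A) a) = - \<phi> a"
proof -
  interpret abelian_group A by (rule represents_abelian_group)
  have e: "m_inv (add_monoid A) a = \<ominus>\<^bsub>A\<^esub> a" by (simp add: a_inv_def)
  show m: "m_inv (add_monoid A) a \<in> carrier A" using assms unfolding e by simp
  have "\<phi> (\<ominus>\<^bsub>A\<^esub> a \<oplus>\<^bsub>A\<^esub> a) = 0" using assms l_neg represents_simps by simp
  then show "\<phi> (m_inv (add_monoid A) a) = - \<phi> a"
    using assms represents_simps(2)[of "\<ominus>\<^bsub>A\<^esub> a" a] unfolding e by (simp add: eq_neg_iff_add_eq_0)
qed

lemma represents_finsum: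
  assumes "finite I" "\<And>i. i \<in> I \<Longrightarrow> f i \<in> carrier A"
  shows "finsum A f I \<in> carrier A" "\<phi> (finsum A f I) = (\<Sum>i\<in>I. \<phi> (f i))"
proof -
  interpret abelian_group A by (rule represents_abelian_group)
  have "finsum A f I \<in> carrier A \<and> \<phi> (finsum A f I) = (\<Sum>i\<in>I. \<phi> (f i))"
    using assms
  proof (induction I rule: finite_induct)
    case (insert i I)
    then have "finsum A f (insert i I) = f i \<oplus>\<^bsub>A\<^esub> finsum A f I" by (intro finsum_insert) auto
    then show ?case using insert by (simp add: represents_simps)
  qed (simp add: represents_simps)
  then show "finsum A f I \<in> carrier A" "\<phi> (finsum A f I) = (\<Sum>i\<in>I. \<phi> (f i))" by auto
qed

lemma represents_restrict:
  assumes "unital_subalgebra H'" "H' \<subseteq> H"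
  shows "represents (restrict_alg A {a \<in> carrier A. \<phi> a \<in> H'}) \<phi> H'"
proof -
  have "bij_betw \<phi> {a \<in> carrier A. \<phi> a \<in> H'} H'"
    using represents_surj assms(2) unfolding bij_betw_def
    by (auto intro!: inj_onI represents_inj simp: image_iff)
  then show ?thesis
    using assms(1) unital_subalgebraD[OF assms(1)]
    by (auto simp: represents_def represents_simps subspace_add subspace_scale subspace_0)
qed

lemma represents_subalg:
  assumes "unital_subalgebra H'"
  shows "subalg {a \<in> carrier A. \<phi> a \<in> H'} A"
  using unital_subalgebraD[OF assms]
  by (auto simp: subalg_def subring_def submonoid_def submodule_def submodule_axioms_def subgroup_def
      represents_simps represents_a_inv subspace_add subspace_scale subspace_0 subspace_neg)

end

lemma alg_iso_if_represents:
  assumes A: "represents A \<phi> H" and T: "represents T \<psi> H"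
    and h: "\<And>t. t \<in> carrier T \<Longrightarrow> h t \<in> carrier A \<and> \<phi> (h t) = \<psi> t"
  shows "h \<in> alg_iso T A"
proof -
  have eq: "h s = a" if "s \<in> carrier T" "a \<in> carrier A" "\<phi> a = \<psi> s" for s a
    using represents_inj[OF A] h that by metis
  have "bij_betw h (carrier T) (carrier A)"
    unfolding bij_betw_def
  proof (intro conjI inj_onI subset_antisym subsetI)
    fix s t assume st: "s \<in> carrier T" "t \<in> carrier T" "h s = h t"
    have "\<psi> s = \<phi> (h s)" using h[OF st(1)] by simp
    also have "\<dots> = \<psi> t" using h[OF st(2)] st(3) by simp
    finally show "s = t" by (rule represents_inj[OF T st(1,2)])
  next
    fix a assume a: "a \<in> carrier A"
    then obtain t where "t \<in> carrier T" "\<psi> t = \<phi> a" using represents_surj[OF T] represents_mem[OF A] by metis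
    then show "a \<in> h ` carrier T" using eq[of t a] a by auto
  qed (use h in auto)
  then show ?thesis
    unfolding alg_iso_def ring_iso_def ring_hom_def
    using h by (auto simp: represents_simps[OF A] represents_simps[OF T] intro!: eq)
qed

lemma alg_iso_nonempty:
  assumes A: "represents A \<phi> H" and T: "represents T \<psi> H"
  shows "alg_iso T A \<noteq> {}"
proof -
  have "\<forall>t\<in>carrier T. \<exists>a. a \<in> carrier A \<and> \<phi> a = \<psi> t"
    using represents_surj[OF A] represents_mem[OF T] by blast
  then obtain h where "\<forall>t\<in>carrier T. h t \<in> carrier A \<and> \<phi> (h t) = \<psi> t" by metis
  then have "h \<in> alg_iso T A" by (intro alg_iso_if_represents[OF A T]) auto
  then show ?thesis by blast
qed

end

text \<open>
  A record whose addition is that of a type, with a multiplicative linear map \<open>ev\<close> to the host.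
  Both polynomial algebras and the free vector spaces underlying tensor products have this form.
  The laws of a ring come from the host: the quotient by the kernel of \<open>ev\<close> is a copy of the image
  of \<open>ev\<close>.
\<close>

locale evaluation = commutative_algebra scale
  for scale :: "'a::field \<Rightarrow> 'u::comm_ring_1 \<Rightarrow> 'u" (infixr \<open>*s\<close> 75) +
  fixes R :: "('a, 'q::ab_group_add) module" and ev :: "'q \<Rightarrow> 'u"
  assumes add_eq: "x \<oplus>\<^bsub>R\<^esub> y = x + y" and zero_eq: "\<zero>\<^bsub>R\<^esub> = 0"
    and zero_closed: "0 \<in> carrier R"
    and diff_closed: "x \<in> carrier R \<Longrightarrow> y \<in> carrier R \<Longrightarrow> x - y \<in> carrier R"
    and mult_closed: "x \<in> carrier R \<Longrightarrow> y \<in> carrier R \<Longrightarrow> x \<otimes>\<^bsub>R\<^esub> y \<in> carrier R"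
    and one_closed: "\<one>\<^bsub>R\<^esub> \<in> carrier R"
    and smult_closed: "x \<in> carrier R \<Longrightarrow> c \<odot>\<^bsub>R\<^esub> x \<in> carrier R"
    and ev_add: "x \<in> carrier R \<Longrightarrow> y \<in> carrier R \<Longrightarrow> ev (x + y) = ev x + ev y"
    and ev_mult: "x \<in> carrier R \<Longrightarrow> y \<in> carrier R \<Longrightarrow> ev (x \<otimes>\<^bsub>R\<^esub> y) = ev x * ev y"
    and ev_one: "ev \<one>\<^bsub>R\<^esub> = 1"
    and ev_smult: "x \<in> carrier R \<Longrightarrow> ev (c \<odot>\<^bsub>R\<^esub> x) = c *s ev x"
begin

lemma uminus_closed: "x \<in> carrier R \<Longrightarrow> - x \<in> carrier R"
  using diff_closed[OF zero_closed] by simp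

lemma add_closed: "x \<in> carrier R \<Longrightarrow> y \<in> carrier R \<Longrightarrow> x + y \<in> carrier R"
  using diff_closed[of x "- y"] uminus_closed by simp

lemma ev_0: "ev 0 = 0"
  using ev_add[OF zero_closed zero_closed] by simp

lemma ev_uminus: "x \<in> carrier R \<Longrightarrow> ev (- x) = - ev x"
  using ev_add[of x "- x"] uminus_closed ev_0 by (simp add: eq_neg_iff_add_eq_0 add.commute)

lemma ev_diff: "x \<in> carrier R \<Longrightarrow> y \<in> carrier R \<Longrightarrow> ev (x - y) = ev x - ev y"
  using ev_add[of x "- y"] uminus_closed ev_uminus by simp

lemma m_inv_eq: "x \<in> carrier R \<Longrightarrow> m_inv (add_monoid R) x = - x"
  unfolding m_inv_def
  by (rule the_equality) (auto simp: add_eq zero_eq uminus_closed, metis eq_neg_iff_add_eq_0)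

definition kernel :: "'q set" where
  "kernel = {x \<in> carrier R. ev x = 0}"

definition fibre :: "'u \<Rightarrow> 'q set" where
  "fibre h = {x \<in> carrier R. ev x = h}"

lemma subgroup_addI:
  assumes "U \<subseteq> carrier R" "0 \<in> U" "\<And>x y. x \<in> U \<Longrightarrow> y \<in> U \<Longrightarrow> x - y \<in> U"
  shows "subgroup U (add_monoid R)"
proof -
  have m: "- x \<in> U" if "x \<in> U" for x using assms(3)[OF assms(2) that] by simp
  have "x + y \<in> U" if "x \<in> U" "y \<in> U" for x y using assms(3)[OF that(1) m[OF that(2)]] by simp
  then show ?thesis
    using assms(1,2) m m_inv_eq by (intro subgroup.intro) (auto simp: add_eq zero_eq subset_iff)
qed

lemma subgroup_addD:
  assumes "subgroup U (add_monoid R)"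
  shows "U \<subseteq> carrier R" "0 \<in> U" "x \<in> U \<Longrightarrow> y \<in> U \<Longrightarrow> x + y \<in> U" "x \<in> U \<Longrightarrow> - x \<in> U"
proof -
  interpret subgroup U "add_monoid R" by fact
  show s: "U \<subseteq> carrier R" using subset by simp
  show "0 \<in> U" using one_closed by (simp add: zero_eq)
  show "x \<in> U \<Longrightarrow> y \<in> U \<Longrightarrow> x + y \<in> U" using m_closed[of x y] by (simp add: add_eq)
  show "x \<in> U \<Longrightarrow> - x \<in> U" using m_inv_closed[of x] m_inv_eq[of x] s by (metis subsetD)
qed

lemma kernel_subgroup: "subgroup kernel (add_monoid R)"
  by (rule subgroup_addI) (auto simp: kernel_def zero_closed ev_0 diff_closed ev_diff)

lemma coset_kernel: "x \<in> carrier R \<Longrightarrow> kernel +>\<^bsub>R\<^esub> x = fibre (ev x)"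
proof -
  assume x: "x \<in> carrier R"
  have "y \<in> kernel +>\<^bsub>R\<^esub> x" if "y \<in> fibre (ev x)" for y
  proof -
    have "y - x \<in> kernel" using that x by (simp add: fibre_def kernel_def diff_closed ev_diff)
    then show ?thesis unfolding a_r_coset_def' add_eq by (auto intro!: bexI[of _ "y - x"])
  qed
  moreover have "kernel +>\<^bsub>R\<^esub> x \<subseteq> fibre (ev x)"
    using x by (auto simp: a_r_coset_def' add_eq kernel_def fibre_def add_closed ev_add)
  ultimately show ?thesis by blast
qed

lemma ev_fibre:
  assumes "h \<in> ev ` carrier R"
  shows "the_elem (ev ` fibre h) = h"
proof -
  have "ev ` fibre h = {h}" using assms by (auto simp: fibre_def)
  then show ?thesis by simp
qed

lemma fibre_add:
  assumes "h \<in> ev ` carrier R" "k \<in> ev ` carrier R"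
  shows "fibre h <+>\<^bsub>R\<^esub> fibre k = fibre (h + k)"
proof -
  obtain x where x: "x \<in> carrier R" "ev x = h" using assms by auto
  have "y \<in> fibre h <+>\<^bsub>R\<^esub> fibre k" if y: "y \<in> fibre (h + k)" for y
  proof -
    have "x \<in> fibre h" "y - x \<in> fibre k" using x y by (auto simp: fibre_def diff_closed ev_diff)
    then have "x + (y - x) \<in> fibre h <+>\<^bsub>R\<^esub> fibre k" unfolding set_add_def' add_eq by blast
    then show ?thesis by simp
  qed
  moreover have "fibre h <+>\<^bsub>R\<^esub> fibre k \<subseteq> fibre (h + k)"
    by (auto simp: set_add_def' add_eq fibre_def add_closed ev_add)
  ultimately show ?thesis by blast
qed

lemma quotient_carrier: "carrier (quot_alg R kernel) = fibre ` (ev ` carrier R)"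
  by (auto simp: quot_alg_def FactRing_def A_RCOSETS_def' coset_kernel)

lemma quotient_add:
  assumes "h \<in> ev ` carrier R" "k \<in> ev ` carrier R"
  shows "fibre h \<oplus>\<^bsub>quot_alg R kernel\<^esub> fibre k = fibre (h + k)"
  using fibre_add[OF assms] by (simp add: quot_alg_def FactRing_def)

text \<open>
  The cosets of the kernel are the fibres of \<open>ev\<close>, and the operations on cosets, which are unions
  over all representatives, become the operations of the host on the values.
\<close>

lemma represents_quotient:
  "represents (quot_alg R kernel) (\<lambda>t. the_elem (ev ` t)) (ev ` carrier R)"
proof -
  let ?H = "ev ` carrier R"
  let ?Q = "quot_alg R kernel"
  have H: "unital_subalgebra ?H"
    unfolding unital_subalgebra_def subspace_def
  proof (intro conjI ballI allI)
    show "0 \<in> ?H" using zero_closed ev_0 by force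
    show "1 \<in> ?H" using one_closed ev_one by force
    show "h + k \<in> ?H" "h * k \<in> ?H" if "h \<in> ?H" "k \<in> ?H" for h k
      using that by (auto simp flip: ev_add ev_mult simp: add_closed mult_closed)
    show "c *s h \<in> ?H" if "h \<in> ?H" for c h
      using that by (auto simp flip: ev_smult simp: smult_closed)
  qed
  have ne: "fibre h \<noteq> {}" if "h \<in> ?H" for h using that by (auto simp: fibre_def)
  have mult: "fibre h \<otimes>\<^bsub>?Q\<^esub> fibre k = fibre (h * k)" if h: "h \<in> ?H" "k \<in> ?H" for h k
  proof -
    have "fibre h \<otimes>\<^bsub>?Q\<^esub> fibre k = (\<Union>a\<in>fibre h. \<Union>b\<in>fibre k. kernel +>\<^bsub>R\<^esub> (a \<otimes>\<^bsub>R\<^esub> b))"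
      by (simp add: quot_alg_def FactRing_def rcoset_mult_def)
    also have "\<dots> = (\<Union>a\<in>fibre h. \<Union>b\<in>fibre k. fibre (h * k))"
      by (intro SUP_cong refl) (auto simp: coset_kernel fibre_def mult_closed ev_mult)
    also have "\<dots> = fibre (h * k)" using ne[OF h(1)] ne[OF h(2)] by simp
    finally show ?thesis .
  qed
  have smult: "c \<odot>\<^bsub>?Q\<^esub> fibre h = fibre (c *s h)" if h: "h \<in> ?H" for c h
  proof -
    have "c \<odot>\<^bsub>?Q\<^esub> fibre h = (\<Union>x\<in>fibre h. kernel +>\<^bsub>R\<^esub> (c \<odot>\<^bsub>R\<^esub> x))"
      by (simp add: quot_alg_def)
    also have "\<dots> = (\<Union>x\<in>fibre h. fibre (c *s h))"
      by (intro SUP_cong refl) (auto simp: coset_kernel fibre_def smult_closed ev_smult)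
    also have "\<dots> = fibre (c *s h)" using ne[OF h] by simp
    finally show ?thesis .
  qed
  have zero: "\<zero>\<^bsub>?Q\<^esub> = fibre 0" by (simp add: quot_alg_def FactRing_def kernel_def fibre_def)
  have one: "\<one>\<^bsub>?Q\<^esub> = fibre 1" by (simp add: quot_alg_def FactRing_def coset_kernel one_closed ev_one)
  have "bij_betw (\<lambda>t. the_elem (ev ` t)) (carrier ?Q) ?H"
    unfolding quotient_carrier
    by (rule bij_betw_byWitness[where f' = fibre]) (auto simp: ev_fibre)
  moreover have "h + k \<in> ?H" "h * k \<in> ?H" "c *s h \<in> ?H" if "h \<in> ?H" "k \<in> ?H" for h k c
    using that unital_subalgebraD[OF H] by (auto intro: subspace_add subspace_scale)
  ultimately show ?thesis
    using H subspace_0[OF unital_subalgebraD(1)[OF H]] unital_subalgebraD(2)[OF H]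
    unfolding represents_def quotient_carrier zero one
    by (simp add: ball_simps(9) mult smult quotient_add ev_fibre del: image_image)
qed

end

section \<open>Truncated polynomial rings\<close>

lemma lookup_map_mult: "lookup (Poly_Mapping.map ((*) c) f) k = c * lookup f k"
  for c :: "'a::mult_zero"
  by (cases "lookup f k = 0") (auto simp: Poly_Mapping.map.rep_eq)

lemma map_mult_diff: "Poly_Mapping.map ((*) c) (f - g) = Poly_Mapping.map ((*) c) f - Poly_Mapping.map ((*) c) g"
  for c :: "'a::ring"
  by (rule poly_mapping_eqI) (simp add: lookup_map_mult lookup_minus right_diff_distrib)

lemma map_mult_sum: "Poly_Mapping.map ((*) c) (sum f I) = (\<Sum>i\<in>I. Poly_Mapping.map ((*) c) (f i))"
  for c :: "'a::semiring_0"
  by (rule poly_mapping_eqI) (simp add: lookup_map_mult lookup_sum sum_distrib_left)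

lemma sum_singles: "(\<Sum>k\<in>keys f. single k (lookup f k)) = f"
  by (rule poly_mapping_eqI) (auto simp: lookup_sum lookup_single when_def in_keys_iff)

lemma keys_diff_subset: "keys f \<subseteq> S \<Longrightarrow> keys g \<subseteq> S \<Longrightarrow> keys (f - g) \<subseteq> S"
  for f g :: "'k \<Rightarrow>\<^sub>0 'a::ab_group_add"
  by (auto simp: in_keys_iff subset_iff lookup_minus) (metis diff_self)

lemma keys_sum_subset: "(\<And>i. i \<in> I \<Longrightarrow> keys (f i) \<subseteq> S) \<Longrightarrow> keys (sum f I) \<subseteq> S"
  for f :: "'i \<Rightarrow> 'k \<Rightarrow>\<^sub>0 'a::comm_monoid_add"
  by (induction I rule: infinite_finite_induct) (auto dest!: subsetD[OF Poly_Mapping.keys_add])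

lemma keys_map_mult_subset: "keys (Poly_Mapping.map ((*) c) f) \<subseteq> keys f"
  for c :: "'a::mult_zero"
  by (auto simp: in_keys_iff lookup_map_mult)

context commutative_algebra
begin

text \<open>
  The linear extension of \<open>b\<close> to the free vector space on its domain.
\<close>

definition lin_ext :: "('k \<Rightarrow> 'u) \<Rightarrow> ('k \<Rightarrow>\<^sub>0 'a) \<Rightarrow> 'u" where
  "lin_ext b f = (\<Sum>k\<in>keys f. lookup f k *s b k)"

lemma lin_ext_superset:
  assumes "finite I" "keys f \<subseteq> I"
  shows "lin_ext b f = (\<Sum>k\<in>I. lookup f k *s b k)"
  unfolding lin_ext_def
  by (rule sum.mono_neutral_left) (use assms in \<open>auto simp: in_keys_iff\<close>)

lemma lin_ext_0 [simp]: "lin_ext b 0 = 0"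
  by (simp add: lin_ext_def)

lemma lin_ext_add: "lin_ext b (f + g) = lin_ext b f + lin_ext b g"
  using Poly_Mapping.keys_add[of f g]
  by (simp add: lin_ext_superset[of "keys f \<union> keys g"] lookup_add
      scale_left_distrib sum.distrib)

lemma lin_ext_diff: "lin_ext b (f - g) = lin_ext b f - lin_ext b g"
  using lin_ext_add[of b "f - g" g] by simp

lemma lin_ext_sum: "lin_ext b (sum f I) = (\<Sum>i\<in>I. lin_ext b (f i))"
  by (induction I rule: infinite_finite_induct) (auto simp: lin_ext_add)

lemma lin_ext_single [simp]: "lin_ext b (single k c) = c *s b k"
  by (simp add: lin_ext_superset[of "{k}"])

lemma lin_ext_map_mult: "lin_ext b (Poly_Mapping.map ((*) c) f) = c *s lin_ext b f"
  using keys_map_mult_subset[of c f]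
  by (simp add: lin_ext_superset[of "keys f"] lookup_map_mult scale_sum_right)

lemma lin_ext_mult:
  assumes "\<And>k l. b (k + l) = b k * b l"
  shows "lin_ext b (f * g) = lin_ext b f * lin_ext b g"
proof -
  have "f * g = (\<Sum>k\<in>keys f. \<Sum>l\<in>keys g.
      single (k + l) (lookup f k * lookup g l))"
    by (subst (1 2) sum_singles[symmetric]) (simp add: sum_product mult_single)
  then have "lin_ext b (f * g) = (\<Sum>k\<in>keys f. \<Sum>l\<in>keys g.
      (lookup f k *s b k) * (lookup g l *s b l))"
    by (simp add: lin_ext_sum assms scale_mult mult.commute)
  then show ?thesis by (simp add: lin_ext_def sum_product)
qed

end

lemma poly_alg_simps:
  "carrier (poly_alg m) = {f. \<forall>e\<in>keys f. keys e \<subseteq> {..<m}}"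
  "f \<otimes>\<^bsub>poly_alg m\<^esub> g = f * g" "f \<oplus>\<^bsub>poly_alg m\<^esub> g = f + g"
  "\<zero>\<^bsub>poly_alg m\<^esub> = 0" "\<one>\<^bsub>poly_alg m\<^esub> = 1" "c \<odot>\<^bsub>poly_alg m\<^esub> f = Poly_Mapping.map ((*) c) f"
  by (simp_all add: poly_alg_def)

lemma poly_alg_closed:
  "0 \<in> carrier (poly_alg m)" "1 \<in> carrier (poly_alg m)"
  "f \<in> carrier (poly_alg m) \<Longrightarrow> g \<in> carrier (poly_alg m) \<Longrightarrow> f + g \<in> carrier (poly_alg m)"
  "f \<in> carrier (poly_alg m) \<Longrightarrow> g \<in> carrier (poly_alg m) \<Longrightarrow> f - g \<in> carrier (poly_alg m)"
  "f \<in> carrier (poly_alg m) \<Longrightarrow> g \<in> carrier (poly_alg m) \<Longrightarrow> f * g \<in> carrier (poly_alg m)"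
  "f \<in> carrier (poly_alg m) \<Longrightarrow> Poly_Mapping.map ((*) c) f \<in> carrier (poly_alg m)"
proof -
  let ?P = "{e. keys e \<subseteq> {..<m}}"
  have c: "carrier (poly_alg m) = {f. keys f \<subseteq> ?P}" by (auto simp: poly_alg_simps)
  show "0 \<in> carrier (poly_alg m)" "1 \<in> carrier (poly_alg m)" by (auto simp: poly_alg_simps)
  show "f + g \<in> carrier (poly_alg m)" if "f \<in> carrier (poly_alg m)" "g \<in> carrier (poly_alg m)"
    using that Poly_Mapping.keys_add[of f g] unfolding c by blast
  show "f - g \<in> carrier (poly_alg m)" if "f \<in> carrier (poly_alg m)" "g \<in> carrier (poly_alg m)"
    using that keys_diff_subset[of f ?P g] unfolding c by blast
  show "f * g \<in> carrier (poly_alg m)" if "f \<in> carrier (poly_alg m)" "g \<in> carrier (poly_alg m)"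
  proof -
    have "a + b \<in> ?P" if "a \<in> ?P" "b \<in> ?P" for a b :: "nat \<Rightarrow>\<^sub>0 nat" using that by (auto simp: keys_add_nat)
    then show ?thesis using that Poly_Mapping.keys_mult[of f g] unfolding c by blast
  qed
  show "Poly_Mapping.map ((*) c) f \<in> carrier (poly_alg m)" if "f \<in> carrier (poly_alg m)"
    using that keys_map_mult_subset[of c f] unfolding c by blast
qed

lemma poly_alg_cring: "cring (poly_alg m :: ('a::field, 'a mpoly) module)"
proof (rule cringI)
  show "abelian_group (poly_alg m :: ('a, 'a mpoly) module)"
  proof (rule abelian_groupI)
    fix f :: "'a mpoly" assume f: "f \<in> carrier (poly_alg m)"
    have "- f \<in> carrier (poly_alg m)" using poly_alg_closed(4)[OF poly_alg_closed(1) f] by simp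
    then show "\<exists>g\<in>carrier (poly_alg m). g \<oplus>\<^bsub>poly_alg m\<^esub> f = \<zero>\<^bsub>poly_alg m\<^esub>"
      by (intro bexI[of _ "- f"]) (auto simp: poly_alg_simps(2-))
  qed (auto simp: poly_alg_simps(2-) poly_alg_closed add.assoc add.commute)
  show "Group.comm_monoid (poly_alg m :: ('a, 'a mpoly) module)"
    by (rule comm_monoidI) (auto simp: poly_alg_simps(2-) poly_alg_closed mult.assoc mult.commute)
qed (auto simp: poly_alg_simps(2-) distrib_right)

context commutative_algebra
begin

lemma poly_evaluation: "evaluation scale (poly_alg m) (lin_ext (power_product x))"
  by unfold_locales
    (auto simp: poly_alg_simps(2-) poly_alg_closed lin_ext_add lin_ext_mult power_product_add
      lin_ext_map_mult lin_ext_superset[of "{0}"])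

end

context truncated_algebra
begin

lemma family_independent_power_product:
  "(\<Sum>e\<in>reduced p m. c e *s power_product x e) = 0 \<Longrightarrow> e \<in> reduced p m \<Longrightarrow> c e = 0"
  using family_independent(3)[of "reduced p m" "power_product x"] dim_B
  by (auto simp: card_reduced simp flip: B_eq)

text \<open>
  A polynomial vanishing at the coordinates involves no reduced monomial, because the reduced power
  products are linearly independent; and every other monomial is a multiple of the \<open>p\<close>-th power of a
  variable.
\<close>

lemma kernel_eq_genideal:
  "{f \<in> carrier (poly_alg m). lin_ext (power_product x) f = 0} =
    genideal (poly_alg m) ((\<lambda>i. single (single i p) 1) ` {..<m})"
    (is "?K = genideal ?R ?S")
proof -
  interpret P: evaluation scale "poly_alg m" "lin_ext (power_product x)" by (rule poly_evaluation)
  interpret R: cring ?R by (rule poly_alg_cring)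
  have K: "P.kernel = ?K" by (simp add: P.kernel_def)
  have "ideal ?K ?R"
    by (rule idealI[OF R.ring_axioms P.kernel_subgroup[unfolded K]])
       (auto simp: P.mult_closed P.ev_mult)
  moreover have "?S \<subseteq> ?K" using x_power by (auto simp: poly_alg_simps split: if_splits)
  moreover have "f \<in> J" if J: "ideal J ?R" "?S \<subseteq> J" and f: "f \<in> ?K" for J f
  proof -
    interpret J: ideal J ?R by fact
    have nonreduced: "power_product x e = 0 \<and> single e c \<in> J"
      if e: "keys e \<subseteq> {..<m}" "e \<notin> reduced p m" for e c
    proof -
      obtain i where i: "lookup e i \<ge> p" using e by (auto simp: reduced_def not_less)
      then have "i \<in> keys e" using p_pos by (simp add: in_keys_iff del: p_pos)
      then have im: "i < m" using e by auto
      define e' where "e' = e - single i p"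
      have ee: "e = single i p + e'"
        using i by (intro poly_mapping_eqI) (auto simp: e'_def lookup_add lookup_minus lookup_single when_def)
      have "power_product x e = 0" using x_power[OF im] by (simp add: ee power_product_add)
      moreover have "keys e' \<subseteq> {..<m}" using e by (auto simp: ee keys_add_nat)
      then have "single e' c \<in> carrier ?R" by (auto simp: poly_alg_simps)
      then have "single (single i p) 1 \<otimes>\<^bsub>?R\<^esub> single e' c \<in> J"
        using J(2) im by (intro J.I_r_closed) auto
      then have "single e c \<in> J" by (simp add: poly_alg_simps ee mult_single)
      ultimately show ?thesis by blast
    qed
    have keys: "keys e \<subseteq> {..<m}" if "e \<in> keys f" for e
      using that f by (auto simp: poly_alg_simps)
    let ?I = "keys f \<union> reduced p m"
    have "0 = (\<Sum>e\<in>?I. lookup f e *s power_product x e)"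
      using f lin_ext_superset[of ?I f "power_product x"] by simp
    also have "\<dots> = (\<Sum>e\<in>reduced p m. lookup f e *s power_product x e)"
      by (rule sum.mono_neutral_right) (use nonreduced keys in auto)
    finally have "lookup f e = 0" if "e \<in> reduced p m" for e
      using family_independent_power_product[of "lookup f"] that by simp
    then have "e \<notin> reduced p m" if "e \<in> keys f" for e
      using that by (auto simp: in_keys_iff)
    then have s: "single e (lookup f e) \<in> J" if "e \<in> keys f" for e
      using nonreduced keys that by blast
    have "finite I \<Longrightarrow> (\<And>e. e \<in> I \<Longrightarrow> g e \<in> J) \<Longrightarrow> sum g I \<in> J" for I and g :: "(nat \<Rightarrow>\<^sub>0 nat) \<Rightarrow> 'a mpoly"
      by (induction I rule: finite_induct)
         (use J.zero_closed J.a_closed in \<open>auto simp: poly_alg_simps\<close>)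
    then have "(\<Sum>e\<in>keys f. single e (lookup f e)) \<in> J"
      using s by simp
    then show ?thesis by (simp add: sum_singles)
  qed
  ultimately show ?thesis unfolding genideal_def by blast
qed

proposition trunc_poly_represents: "\<exists>\<phi>. represents (trunc_poly m) \<phi> B"
proof -
  interpret P: evaluation scale "poly_alg m" "lin_ext (power_product x)" by (rule poly_evaluation)
  have "trunc_poly m = quot_alg (poly_alg m) P.kernel"
    unfolding trunc_poly_def P.kernel_def kernel_eq_genideal by (simp add: p_eq)
  moreover have "lin_ext (power_product x) ` carrier (poly_alg m) = B"
  proof
    show "lin_ext (power_product x) ` carrier (poly_alg m) \<subseteq> B"
      unfolding lin_ext_def
      by (auto simp: poly_alg_simps intro!: subspace_sum[OF B_subspace] subspace_scale[OF B_subspace]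
          power_product_mem[OF B_subalgebra] x_mem)
    have "subspace (lin_ext (power_product x) ` carrier (poly_alg m))"
      using unital_subalgebraD(1)[OF represents_subalgebra[OF P.represents_quotient]] .
    then show "B \<subseteq> lin_ext (power_product x) ` carrier (poly_alg m)"
      unfolding B_eq
    proof (rule span_minimal[rotated], safe)
      fix e assume "e \<in> reduced p m"
      then show "power_product x e \<in> lin_ext (power_product x) ` carrier (poly_alg m)"
        by (intro image_eqI[of _ _ "single e 1"]) (auto simp: poly_alg_simps reduced_def)
    qed
  qed
  ultimately show ?thesis using P.represents_quotient by metis
qed

end

section \<open>The kernel of the tensor product\<close>

lemma free_tensor_simps:
  "carrier (free_tensor A A') = {u. keys u \<subseteq> carrier A \<times> carrier A'}"
  "u \<oplus>\<^bsub>free_tensor A A'\<^esub> v = u + v" "\<zero>\<^bsub>free_tensor A A'\<^esub> = 0"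
  "\<one>\<^bsub>free_tensor A A'\<^esub> = single (\<one>\<^bsub>A\<^esub>, \<one>\<^bsub>A'\<^esub>) 1"
  "c \<odot>\<^bsub>free_tensor A A'\<^esub> u = Poly_Mapping.map ((*) c) u"
  "u \<otimes>\<^bsub>free_tensor A A'\<^esub> v = (\<Sum>k\<in>keys u. \<Sum>l\<in>keys v.
       single (fst k \<otimes>\<^bsub>A\<^esub> fst l, snd k \<otimes>\<^bsub>A'\<^esub> snd l)
         (lookup u k * lookup v l))"
  by (simp_all add: free_tensor_def)

lemma tensor_relatorsI:
  assumes "x \<in> carrier A" "y \<in> carrier B"
  shows "x' \<in> carrier A \<Longrightarrow> single (x \<oplus>\<^bsub>A\<^esub> x', y) 1 - single (x, y) 1
        - single (x', y) 1 \<in> tensor_relators A B"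
    and "y' \<in> carrier B \<Longrightarrow> single (x, y \<oplus>\<^bsub>B\<^esub> y') 1 - single (x, y) 1
        - single (x, y') 1 \<in> tensor_relators A B"
    and "single (c \<odot>\<^bsub>A\<^esub> x, y) 1 - single (x, y) c \<in> tensor_relators A B"
    and "single (x, c \<odot>\<^bsub>B\<^esub> y) 1 - single (x, y) c \<in> tensor_relators A B"
proof -
  show "x' \<in> carrier A \<Longrightarrow> single (x \<oplus>\<^bsub>A\<^esub> x', y) 1 - single (x, y) 1
        - single (x', y) 1 \<in> tensor_relators A B"
    unfolding tensor_relators_def by (rule UnI1, rule UnI1, rule UnI1, rule CollectI, (rule exI)+, rule conjI, rule refl) (simp add: assms)
  show "y' \<in> carrier B \<Longrightarrow> single (x, y \<oplus>\<^bsub>B\<^esub> y') 1 - single (x, y) 1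
        - single (x, y') 1 \<in> tensor_relators A B"
    unfolding tensor_relators_def by (rule UnI1, rule UnI1, rule UnI2, rule CollectI, (rule exI)+, rule conjI, rule refl) (simp add: assms)
  show "single (c \<odot>\<^bsub>A\<^esub> x, y) 1 - single (x, y) c \<in> tensor_relators A B"
    unfolding tensor_relators_def by (rule UnI1, rule UnI2, rule CollectI, (rule exI)+, rule conjI, rule refl) (simp add: assms)
  show "single (x, c \<odot>\<^bsub>B\<^esub> y) 1 - single (x, y) c \<in> tensor_relators A B"
    unfolding tensor_relators_def by (rule UnI2, rule CollectI, (rule exI)+, rule conjI, rule refl) (simp add: assms)
qed

context commutative_algebra
begin

text \<open>
  A map \<open>g\<close> that is linear modulo \<open>U\<close> respects linear combinations modulo \<open>U\<close>. It is applied to the two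
  slots of an elementary tensor.
\<close>

lemma linear_combination_modulo:
  fixes g :: "'b \<Rightarrow> ('k \<Rightarrow>\<^sub>0 'a)"
  assumes rep: "represents A \<phi> H"
    and U: "\<And>u v. u \<in> U \<Longrightarrow> v \<in> U \<Longrightarrow> u + v \<in> U" "\<And>u. u \<in> U \<Longrightarrow> - u \<in> U"
    and add: "\<And>a b. a \<in> carrier A \<Longrightarrow> b \<in> carrier A \<Longrightarrow> g (a \<oplus>\<^bsub>A\<^esub> b) - g a - g b \<in> U"
    and smult: "\<And>c a. a \<in> carrier A \<Longrightarrow> g (c \<odot>\<^bsub>A\<^esub> a) - Poly_Mapping.map ((*) c) (g a) \<in> U"
    and "finite I" "\<And>i. i \<in> I \<Longrightarrow> f i \<in> carrier A" "a \<in> carrier A"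
    and "\<phi> a = (\<Sum>i\<in>I. s i *s \<phi> (f i))"
  shows "g a - (\<Sum>i\<in>I. Poly_Mapping.map ((*) (s i)) (g (f i))) \<in> U"
  using assms(6-9)
proof (induction I arbitrary: a rule: finite_induct)
  case empty
  then have "a = \<zero>\<^bsub>A\<^esub>" using represents_eq_zero_iff[OF rep] by simp
  then have "a \<oplus>\<^bsub>A\<^esub> a = a" using represents_inj[OF rep] represents_simps[OF rep] by simp
  then show ?case using U(2)[OF add[of a a]] empty by simp
next
  case (insert j I)
  note simps = represents_simps[OF rep]
  have H: "subspace H" using unital_subalgebraD(1)[OF represents_subalgebra[OF rep]] .
  have "(\<Sum>i\<in>I. s i *s \<phi> (f i)) \<in> H"
    using insert.prems represents_mem[OF rep] by (intro subspace_sum subspace_scale H) auto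
  then obtain b where b: "b \<in> carrier A" "\<phi> b = (\<Sum>i\<in>I. s i *s \<phi> (f i))"
    using represents_surj[OF rep] by blast
  have j: "f j \<in> carrier A" "s j \<odot>\<^bsub>A\<^esub> f j \<in> carrier A" using insert.prems simps by auto
  have a: "a = s j \<odot>\<^bsub>A\<^esub> f j \<oplus>\<^bsub>A\<^esub> b"
    by (rule represents_inj[OF rep]) (use insert b j simps in auto)
  have 1: "g b - (\<Sum>i\<in>I. Poly_Mapping.map ((*) (s i)) (g (f i))) \<in> U" using insert b by simp
  have 2: "g a - g (s j \<odot>\<^bsub>A\<^esub> f j) - g b \<in> U" unfolding a by (rule add) (use j b in auto)
  have 3: "g (s j \<odot>\<^bsub>A\<^esub> f j) - Poly_Mapping.map ((*) (s j)) (g (f j)) \<in> U" by (rule smult) (rule j)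
  show ?case using U(1)[OF U(1)[OF 1 2] 3] insert.hyps
    by (simp add: algebra_simps del: mult.commute)
qed

lemma tensor_evaluation:
  assumes A: "represents A \<phi> H" and A': "represents A' \<psi> H'"
  shows "evaluation scale (free_tensor A A') (lin_ext (\<lambda>k. \<phi> (fst k) * \<psi> (snd k)))"
proof unfold_locales
  let ?R = "free_tensor A A'" and ?w = "\<lambda>k. \<phi> (fst k) * \<psi> (snd k)"
  note sA = represents_simps[OF A] and sA' = represents_simps[OF A']
  fix u v c
  show "u \<oplus>\<^bsub>?R\<^esub> v = u + v" "\<zero>\<^bsub>?R\<^esub> = 0" "0 \<in> carrier ?R" "\<one>\<^bsub>?R\<^esub> \<in> carrier ?R"
    "lin_ext ?w \<one>\<^bsub>?R\<^esub> = 1" "lin_ext ?w (u + v) = lin_ext ?w u + lin_ext ?w v"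
    "lin_ext ?w (c \<odot>\<^bsub>?R\<^esub> u) = c *s lin_ext ?w u"
    by (simp_all add: free_tensor_simps sA sA' lin_ext_add lin_ext_map_mult)
  assume u: "u \<in> carrier ?R"
  show "c \<odot>\<^bsub>?R\<^esub> u \<in> carrier ?R"
    using u keys_map_mult_subset[of c u] by (auto simp: free_tensor_simps)
  assume v: "v \<in> carrier ?R"
  show "u - v \<in> carrier ?R" using u v keys_diff_subset[of u _ v] by (simp add: free_tensor_simps)
  have mem: "fst k \<in> carrier A \<and> snd k \<in> carrier A'" if "k \<in> keys u \<or> k \<in> keys v" for k
    using u v that by (auto simp: free_tensor_simps)
  show "u \<otimes>\<^bsub>?R\<^esub> v \<in> carrier ?R"
    unfolding free_tensor_simps
    by (intro CollectI keys_sum_subset) (use mem in \<open>auto simp: sA sA'\<close>)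
  show "lin_ext ?w (u \<otimes>\<^bsub>?R\<^esub> v) = lin_ext ?w u * lin_ext ?w v"
    unfolding free_tensor_simps lin_ext_sum lin_ext_single
    unfolding lin_ext_def sum_product
    by (intro sum.cong refl) (use mem in \<open>simp add: sA sA' scale_mult ac_simps\<close>)
qed

lemma tensor_kernel_closed:
  assumes A: "represents A \<phi> H" and A': "represents A' \<psi> H'"
  shows "tensor_relators A A' \<subseteq> tensor_kernel A A'"
    and "0 \<in> tensor_kernel A A'"
    and "u \<in> tensor_kernel A A' \<Longrightarrow> v \<in> tensor_kernel A A' \<Longrightarrow> u + v \<in> tensor_kernel A A'"
    and "u \<in> tensor_kernel A A' \<Longrightarrow> - u \<in> tensor_kernel A A'"
    and "u \<in> tensor_kernel A A' \<Longrightarrow> Poly_Mapping.map ((*) c) u \<in> tensor_kernel A A'"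
proof -
  interpret T: evaluation scale "free_tensor A A'" "lin_ext (\<lambda>k. \<phi> (fst k) * \<psi> (snd k))"
    by (rule tensor_evaluation[OF A A'])
  have U: "0 \<in> U" "\<And>u v. u \<in> U \<Longrightarrow> v \<in> U \<Longrightarrow> u + v \<in> U" "\<And>u. u \<in> U \<Longrightarrow> - u \<in> U"
    "\<And>c u. u \<in> U \<Longrightarrow> Poly_Mapping.map ((*) c) u \<in> U"
    if "submodule U ground_field (free_tensor A A')" for U
    using T.subgroup_addD[OF submodule.axioms(1)[OF that]] submodule.smult_closed[OF that]
    by (auto simp: free_tensor_simps ring_of_type_algebra_def)
  show "tensor_relators A A' \<subseteq> tensor_kernel A A'" by (simp add: tensor_kernel_def hull_subset)
  show "0 \<in> tensor_kernel A A'" using U(1) by (auto simp: tensor_kernel_def hull_def)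
  show "u + v \<in> tensor_kernel A A'" if "u \<in> tensor_kernel A A'" "v \<in> tensor_kernel A A'"
    using that U(2) by (auto simp: tensor_kernel_def hull_def)
  show "- u \<in> tensor_kernel A A'" if "u \<in> tensor_kernel A A'"
    using that U(3) by (auto simp: tensor_kernel_def hull_def)
  show "Poly_Mapping.map ((*) c) u \<in> tensor_kernel A A'" if "u \<in> tensor_kernel A A'"
    using that U(4) by (auto simp: tensor_kernel_def hull_def)
qed

text \<open>
  The universal property of the tensor product: a bilinear map kills the relators, and the hull is
  the least submodule containing them.
\<close>

lemma bilinear_vanishes_on_tensor_kernel:
  assumes A: "represents A \<phi> H" and A': "represents A' \<psi> H'"
    and w: "\<And>a b c. a \<in> carrier A \<Longrightarrow> b \<in> carrier A \<Longrightarrow> c \<in> carrier A' \<Longrightarrow> w (a \<oplus>\<^bsub>A\<^esub> b, c) = w (a, c) + w (b, c)"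
      "\<And>a b c. a \<in> carrier A \<Longrightarrow> b \<in> carrier A' \<Longrightarrow> c \<in> carrier A' \<Longrightarrow> w (a, b \<oplus>\<^bsub>A'\<^esub> c) = w (a, b) + w (a, c)"
      "\<And>s a b. a \<in> carrier A \<Longrightarrow> b \<in> carrier A' \<Longrightarrow> w (s \<odot>\<^bsub>A\<^esub> a, b) = s *s w (a, b)"
      "\<And>s a b. a \<in> carrier A \<Longrightarrow> b \<in> carrier A' \<Longrightarrow> w (a, s \<odot>\<^bsub>A'\<^esub> b) = s *s w (a, b)"
  shows "tensor_kernel A A' \<subseteq> {u \<in> carrier (free_tensor A A'). lin_ext w u = 0}"
proof -
  interpret T: evaluation scale "free_tensor A A'" "lin_ext (\<lambda>k. \<phi> (fst k) * \<psi> (snd k))"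
    by (rule tensor_evaluation[OF A A'])
  let ?U = "{u \<in> carrier (free_tensor A A'). lin_ext w u = 0}"
  have "submodule ?U ground_field (free_tensor A A')"
  proof (intro submodule.intro submodule_axioms.intro T.subgroup_addI)
    show "s \<odot>\<^bsub>free_tensor A A'\<^esub> u \<in> ?U" if "u \<in> ?U" for s u
      using that T.smult_closed[of u s] by (simp add: free_tensor_simps(5) lin_ext_map_mult)
  qed (auto simp: T.zero_closed T.diff_closed lin_ext_diff)
  moreover have single: "single (a, b) c \<in> carrier (free_tensor A A')"
    if "a \<in> carrier A" "b \<in> carrier A'" for a b c
    using that by (auto simp: free_tensor_simps)
  have "tensor_relators A A' \<subseteq> ?U"
    unfolding tensor_relators_def
    by (auto simp: lin_ext_diff w represents_simps[OF A] represents_simps[OF A'] intro!: T.diff_closed single)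
  ultimately show ?thesis unfolding tensor_kernel_def by (intro hull_minimal) auto
qed

text \<open>
  Modulo the relators every element of the free vector space is a combination of the elementary
  tensors of spanning sets \<open>K\<close> and \<open>K'\<close>. The dimension hypothesis makes the products of members of \<open>K\<close>
  and \<open>K'\<close> linearly independent, so a combination with vanishing product is zero.
\<close>

lemma tensor_kernel_eq_kernel:
  assumes A: "represents A \<phi> H" and A': "represents A' \<psi> H'"
    and K: "finite K" "K \<subseteq> H" "H \<subseteq> span K" and K': "finite K'" "K' \<subseteq> H'" "H' \<subseteq> span K'"
    and dim: "card (K \<times> K') \<le> dim (span ((\<lambda>k. fst k * snd k) ` (K \<times> K')))"
  shows "tensor_kernel A A' = evaluation.kernel (free_tensor A A') (lin_ext (\<lambda>k. \<phi> (fst k) * \<psi> (snd k)))"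
proof -
  interpret T: evaluation scale "free_tensor A A'" "lin_ext (\<lambda>k. \<phi> (fst k) * \<psi> (snd k))"
    by (rule tensor_evaluation[OF A A'])
  let ?w = "\<lambda>k. \<phi> (fst k) * \<psi> (snd k)"
  let ?U = "tensor_kernel A A'"
  note sA = represents_simps[OF A] and sA' = represents_simps[OF A']
  note closed = tensor_kernel_closed[OF A A']
  have sub: "?U \<subseteq> T.kernel"
    unfolding T.kernel_def
    by (rule bilinear_vanishes_on_tensor_kernel[OF A A'])
       (auto simp: sA sA' scale_mult distrib_left distrib_right)
  obtain f where f: "\<And>x. x \<in> K \<Longrightarrow> f x \<in> carrier A \<and> \<phi> (f x) = x"
    using represents_surj[OF A] K(2) by (metis subsetD)
  obtain f' where f': "\<And>x. x \<in> K' \<Longrightarrow> f' x \<in> carrier A' \<and> \<psi> (f' x) = x"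
    using represents_surj[OF A'] K'(2) by (metis subsetD)
  define G where "G = {u. \<exists>\<gamma>. u - (\<Sum>k\<in>K \<times> K'. single (f (fst k), f' (snd k)) (\<gamma> k)) \<in> ?U}"
  have G_add: "u + v \<in> G" if "u \<in> G" "v \<in> G" for u v
  proof -
    from that obtain \<gamma> \<delta> where
      "u - (\<Sum>k\<in>K \<times> K'. single (f (fst k), f' (snd k)) (\<gamma> k)) \<in> ?U"
      "v - (\<Sum>k\<in>K \<times> K'. single (f (fst k), f' (snd k)) (\<delta> k)) \<in> ?U"
      unfolding G_def by blast
    from closed(3)[OF this] have "u + v - (\<Sum>k\<in>K \<times> K'. single (f (fst k), f' (snd k)) (\<gamma> k + \<delta> k)) \<in> ?U"
      by (simp add: single_add sum.distrib algebra_simps)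
    then show ?thesis unfolding G_def by (intro CollectI exI[of _ "\<lambda>k. \<gamma> k + \<delta> k"])
  qed
  have G_single: "single (a, b) c \<in> G" if a: "a \<in> carrier A" and b: "b \<in> carrier A'" for a b c
  proof -
    obtain s where s: "\<phi> a = (\<Sum>x\<in>K. s x *s x)"
      using span_family[OF K(1), of "\<phi> a" id] represents_mem[OF A a] K(3) by auto
    obtain t where t: "\<psi> b = (\<Sum>y\<in>K'. t y *s y)"
      using span_family[OF K'(1), of "\<psi> b" id] represents_mem[OF A' b] K'(3) by auto
    have 1: "single (a, b) 1 - (\<Sum>x\<in>K. Poly_Mapping.map ((*) (s x)) (single (f x, b) 1)) \<in> ?U"
    proof (rule linear_combination_modulo[OF A, where g = "\<lambda>a. single (a, b) 1"])
      show "\<phi> a = (\<Sum>x\<in>K. s x *s \<phi> (f x))" unfolding s by (intro sum.cong refl) (use f in auto)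
      show "single (a \<oplus>\<^bsub>A\<^esub> a', b) 1 - single (a, b) 1 - single (a', b) 1 \<in> ?U"
        if "a \<in> carrier A" "a' \<in> carrier A" for a a'
        using closed(1) tensor_relatorsI(1)[OF that(1) b that(2)] by blast
      show "single (c \<odot>\<^bsub>A\<^esub> a, b) 1 - Poly_Mapping.map ((*) c) (single (a, b) 1) \<in> ?U"
        if "a \<in> carrier A" for c a
      proof -
        have "single (c \<odot>\<^bsub>A\<^esub> a, b) 1 - single (a, b) c \<in> tensor_relators A A'"
          by (rule tensor_relatorsI(3)[OF that b])
        then show ?thesis using closed(1) by (auto simp: map_single)
      qed
    qed (use K f a closed in auto)
    have 2: "single (f x, b) 1 - (\<Sum>y\<in>K'. Poly_Mapping.map ((*) (t y)) (single (f x, f' y) 1)) \<in> ?U"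
      if x: "x \<in> K" for x
    proof (rule linear_combination_modulo[OF A', where g = "\<lambda>b. single (f x, b) 1"])
      show "\<psi> b = (\<Sum>y\<in>K'. t y *s \<psi> (f' y))" unfolding t by (intro sum.cong refl) (use f' in auto)
      show "single (f x, b \<oplus>\<^bsub>A'\<^esub> b') 1 - single (f x, b) 1 - single (f x, b') 1 \<in> ?U"
        if "b \<in> carrier A'" "b' \<in> carrier A'" for b b'
        using closed(1) tensor_relatorsI(2)[OF conjunct1[OF f[OF x]] that] by blast
      show "single (f x, c \<odot>\<^bsub>A'\<^esub> b) 1 - Poly_Mapping.map ((*) c) (single (f x, b) 1) \<in> ?U"
        if "b \<in> carrier A'" for c b
      proof -
        have "single (f x, c \<odot>\<^bsub>A'\<^esub> b) 1 - single (f x, b) c \<in> tensor_relators A A'"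
          by (rule tensor_relatorsI(4)[OF conjunct1[OF f[OF x]] that])
        then show ?thesis using closed(1) by (auto simp: map_single)
      qed
    qed (use K' f' b closed in auto)
    have sumU: "finite I \<Longrightarrow> (\<And>i. i \<in> I \<Longrightarrow> g i \<in> ?U) \<Longrightarrow> sum g I \<in> ?U" for I :: "'u set" and g
      by (induction I rule: finite_induct) (auto intro: closed)
    have 3: "(\<Sum>x\<in>K. Poly_Mapping.map ((*) (s x)) (single (f x, b) 1
        - (\<Sum>y\<in>K'. Poly_Mapping.map ((*) (t y)) (single (f x, f' y) 1)))) \<in> ?U"
      by (rule sumU[OF K(1)]) (intro closed(5) 2)
    have "(\<Sum>x\<in>K. \<Sum>y\<in>K'. single (f x, f' y) (s x * t y))
        = (\<Sum>k\<in>K \<times> K'. single (f (fst k), f' (snd k)) (s (fst k) * t (snd k)))"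
      by (subst sum.cartesian_product) (simp add: case_prod_unfold)
    then have "single (a, b) 1
        - (\<Sum>k\<in>K \<times> K'. single (f (fst k), f' (snd k)) (s (fst k) * t (snd k))) \<in> ?U"
      using closed(3)[OF 1 3] by (simp add: map_mult_diff map_mult_sum map_single sum_subtractf)
    from closed(5)[OF this, of c] have "single (a, b) c
        - (\<Sum>k\<in>K \<times> K'. single (f (fst k), f' (snd k)) (c * (s (fst k) * t (snd k)))) \<in> ?U"
      by (simp add: map_mult_diff map_mult_sum map_single)
    then show ?thesis unfolding G_def by (intro CollectI exI[of _ "\<lambda>k. c * (s (fst k) * t (snd k))"])
  qed
  have "u \<in> ?U" if u: "u \<in> T.kernel" for u
  proof -
    have G0: "0 \<in> G" unfolding G_def by (intro CollectI exI[of _ "\<lambda>_. 0"]) (simp add: closed)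
    have "finite I \<Longrightarrow> (\<And>i. i \<in> I \<Longrightarrow> g i \<in> G) \<Longrightarrow> sum g I \<in> G" for I :: "('b \<times> 'c) set" and g
      by (induction I rule: finite_induct) (auto intro: G_add G0)
    moreover have "single k (lookup u k) \<in> G" if "k \<in> keys u" for k
      using u that G_single[of "fst k" "snd k"] by (auto simp: T.kernel_def free_tensor_simps)
    ultimately have "u \<in> G" using sum_singles[of u] by (metis finite_keys)
    then obtain \<gamma> where g: "u - (\<Sum>k\<in>K \<times> K'. single (f (fst k), f' (snd k)) (\<gamma> k)) \<in> ?U"
      unfolding G_def by blast
    then have "lin_ext ?w (u - (\<Sum>k\<in>K \<times> K'. single (f (fst k), f' (snd k)) (\<gamma> k))) = 0"
      using sub by (auto simp: T.kernel_def)
    then have "(\<Sum>k\<in>K \<times> K'. \<gamma> k *s (\<phi> (f (fst k)) * \<psi> (f' (snd k)))) = 0"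
      using u by (simp add: lin_ext_diff lin_ext_sum T.kernel_def)
    also have "(\<Sum>k\<in>K \<times> K'. \<gamma> k *s (\<phi> (f (fst k)) * \<psi> (f' (snd k)))) = (\<Sum>k\<in>K \<times> K'. \<gamma> k *s (fst k * snd k))"
      by (intro sum.cong refl) (use f f' in auto)
    finally have "\<gamma> k = 0" if "k \<in> K \<times> K'" for k
      using family_independent(3)[OF _ dim] K K' that by simp
    then show ?thesis using g by simp
  qed
  then show ?thesis using sub by blast
qed

end

section \<open>Decompositions into tensor products\<close>

context commutative_algebra
begin

definition transport :: "('a, 'b) module \<Rightarrow> ('b \<Rightarrow> 'u) \<Rightarrow> ('b \<Rightarrow> 'b) \<Rightarrow> 'u \<Rightarrow> 'u" where
  "transport A \<phi> D h = \<phi> (D (inv_into (carrier A) \<phi> h))"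

context
  fixes A :: "('a, 'b) module" and \<phi> H D
  assumes A: "represents A \<phi> H" and D: "D \<in> derivations A"
begin

lemma derivation_closed: "a \<in> carrier A \<Longrightarrow> D a \<in> carrier A"
  using D by (auto simp: derivations_def)

lemma derivation_simps:
  "a \<in> carrier A \<Longrightarrow> b \<in> carrier A \<Longrightarrow> D (a \<oplus>\<^bsub>A\<^esub> b) = D a \<oplus>\<^bsub>A\<^esub> D b"
  "a \<in> carrier A \<Longrightarrow> D (c \<odot>\<^bsub>A\<^esub> a) = c \<odot>\<^bsub>A\<^esub> D a"
  "a \<in> carrier A \<Longrightarrow> b \<in> carrier A \<Longrightarrow> D (a \<otimes>\<^bsub>A\<^esub> b) = (D a \<otimes>\<^bsub>A\<^esub> b) \<oplus>\<^bsub>A\<^esub> (a \<otimes>\<^bsub>A\<^esub> D b)"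
  using D by (auto simp: derivations_def)

lemma transport_eq: "a \<in> carrier A \<Longrightarrow> transport A \<phi> D (\<phi> a) = \<phi> (D a)"
  using A by (simp add: transport_def represents_def bij_betw_def inv_into_f_f)

lemma transport_funpow: "a \<in> carrier A \<Longrightarrow> (D ^^ n) a \<in> carrier A \<and> (transport A \<phi> D ^^ n) (\<phi> a) = \<phi> ((D ^^ n) a)"
  by (induction n) (auto simp: derivation_closed transport_eq)

lemma transport_linear: "linear_on H (transport A \<phi> D)"
proof -
  note sA = represents_simps[OF A]
  have "transport A \<phi> D h \<in> H" if "h \<in> H" for h
    using represents_surj[OF A that] represents_mem[OF A] by (auto simp: transport_eq derivation_closed)
  moreover have "transport A \<phi> D (h + k) = transport A \<phi> D h + transport A \<phi> D k" if hk: "h \<in> H" "k \<in> H" for h k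
  proof -
    obtain a b where ab: "a \<in> carrier A" "\<phi> a = h" "b \<in> carrier A" "\<phi> b = k"
      using represents_surj[OF A] hk by meson
    then have "h + k = \<phi> (a \<oplus>\<^bsub>A\<^esub> b)" by (simp add: sA)
    then show ?thesis using ab transport_eq[of "a \<oplus>\<^bsub>A\<^esub> b"] transport_eq[of a] transport_eq[of b]
      by (simp add: derivation_simps derivation_closed sA)
  qed
  moreover have "transport A \<phi> D (c *s h) = c *s transport A \<phi> D h" if h: "h \<in> H" for c h
  proof -
    obtain a where a: "a \<in> carrier A" "\<phi> a = h" using represents_surj[OF A h] by blast
    then have "c *s h = \<phi> (c \<odot>\<^bsub>A\<^esub> a)" by (simp add: sA)
    then show ?thesis using a transport_eq[of "c \<odot>\<^bsub>A\<^esub> a"] transport_eq[of a]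
      by (simp add: derivation_simps derivation_closed sA)
  qed
  ultimately show ?thesis by (simp add: linear_on_def)
qed

lemma transport_leibniz:
  assumes "h \<in> H" "k \<in> H"
  shows "transport A \<phi> D (h * k) = transport A \<phi> D h * k + h * transport A \<phi> D k"
proof -
  note sA = represents_simps[OF A]
  obtain a b where ab: "a \<in> carrier A" "\<phi> a = h" "b \<in> carrier A" "\<phi> b = k"
    using represents_surj[OF A] assms by meson
  then have "h * k = \<phi> (a \<otimes>\<^bsub>A\<^esub> b)" by (simp add: sA)
  then show ?thesis using ab transport_eq[of "a \<otimes>\<^bsub>A\<^esub> b"] transport_eq[of a] transport_eq[of b]
    by (simp add: derivation_simps derivation_closed sA)
qed

end

text \<open>
  The tensor map of two linear maps sends a class to a single class, because the bilinear map
  \<open>f a * g b\<close> factors through the tensor product.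
\<close>

lemma tensor_map_fibre:
  assumes A: "represents A \<phi> H" and A': "represents A' \<psi> H'"
    and kernel: "tensor_kernel A A' = evaluation.kernel (free_tensor A A') (lin_ext (\<lambda>k. \<phi> (fst k) * \<psi> (snd k)))"
    and f: "\<And>a. a \<in> carrier A \<Longrightarrow> f a \<in> carrier A"
      "\<And>a b. a \<in> carrier A \<Longrightarrow> b \<in> carrier A \<Longrightarrow> f (a \<oplus>\<^bsub>A\<^esub> b) = f a \<oplus>\<^bsub>A\<^esub> f b"
      "\<And>c a. a \<in> carrier A \<Longrightarrow> f (c \<odot>\<^bsub>A\<^esub> a) = c \<odot>\<^bsub>A\<^esub> f a"
    and g: "\<And>a. a \<in> carrier A' \<Longrightarrow> g a \<in> carrier A'"
      "\<And>a b. a \<in> carrier A' \<Longrightarrow> b \<in> carrier A' \<Longrightarrow> g (a \<oplus>\<^bsub>A'\<^esub> b) = g a \<oplus>\<^bsub>A'\<^esub> g b"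
      "\<And>c a. a \<in> carrier A' \<Longrightarrow> g (c \<odot>\<^bsub>A'\<^esub> a) = c \<odot>\<^bsub>A'\<^esub> g a"
    and u: "u \<in> evaluation.fibre (free_tensor A A') (lin_ext (\<lambda>k. \<phi> (fst k) * \<psi> (snd k))) h"
  shows "tensor_map A A' f g (evaluation.fibre (free_tensor A A') (lin_ext (\<lambda>k. \<phi> (fst k) * \<psi> (snd k))) h) =
    evaluation.fibre (free_tensor A A') (lin_ext (\<lambda>k. \<phi> (fst k) * \<psi> (snd k)))
      (lin_ext (\<lambda>k. \<phi> (f (fst k)) * \<psi> (g (snd k))) u)"
    and "lin_ext (\<lambda>k. \<phi> (f (fst k)) * \<psi> (g (snd k))) u \<in>
      lin_ext (\<lambda>k. \<phi> (fst k) * \<psi> (snd k)) ` carrier (free_tensor A A')"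
proof -
  let ?w = "\<lambda>k. \<phi> (fst k) * \<psi> (snd k)" and ?v = "\<lambda>k. \<phi> (f (fst k)) * \<psi> (g (snd k))"
  interpret T: evaluation scale "free_tensor A A'" "lin_ext ?w" by (rule tensor_evaluation[OF A A'])
  note sA = represents_simps[OF A] and sA' = represents_simps[OF A']
  define F where "F u = (\<Sum>k\<in>keys u. single (f (fst k), g (snd k)) (lookup u k))"
    for u :: "('b \<times> 'c) \<Rightarrow>\<^sub>0 'a"
  have F: "F u \<in> carrier (free_tensor A A')" "lin_ext ?w (F u) = lin_ext ?v u"
    if u: "u \<in> carrier (free_tensor A A')" for u
  proof -
    have "fst k \<in> carrier A \<and> snd k \<in> carrier A'" if "k \<in> keys u" for k
      using u that by (auto simp: free_tensor_simps)
    then show "F u \<in> carrier (free_tensor A A')"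
      unfolding free_tensor_simps F_def by (intro CollectI keys_sum_subset) (auto simp: f g)
    show "lin_ext ?w (F u) = lin_ext ?v u"
      unfolding F_def lin_ext_sum lin_ext_single by (simp add: lin_ext_def)
  qed
  have "T.kernel \<subseteq> {u \<in> carrier (free_tensor A A'). lin_ext ?v u = 0}"
    unfolding kernel[symmetric]
    by (rule bilinear_vanishes_on_tensor_kernel[OF A A'])
       (auto simp: f g sA sA' scale_mult distrib_left distrib_right)
  then have const: "lin_ext ?v u' = lin_ext ?v u" if u': "u' \<in> T.fibre h" for u'
  proof -
    have "u' - u \<in> T.kernel"
      using u u' by (simp add: T.fibre_def T.kernel_def T.diff_closed T.ev_diff)
    then have "lin_ext ?v (u' - u) = 0"
      using \<open>T.kernel \<subseteq> {u \<in> carrier (free_tensor A A'). lin_ext ?v u = 0}\<close> by blast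
    then show ?thesis by (simp add: lin_ext_diff)
  qed
  have "tensor_map A A' f g (T.fibre h) = (\<Union>u\<in>T.fibre h. T.kernel +>\<^bsub>free_tensor A A'\<^esub> F u)"
    by (simp add: tensor_map_def F_def kernel)
  also have "\<dots> = (\<Union>u'\<in>T.fibre h. T.fibre (lin_ext ?v u))"
  proof (rule SUP_cong[OF refl])
    fix u' assume u': "u' \<in> T.fibre h"
    then have "u' \<in> carrier (free_tensor A A')" by (simp add: T.fibre_def)
    then show "T.kernel +>\<^bsub>free_tensor A A'\<^esub> F u' = T.fibre (lin_ext ?v u)"
      using T.coset_kernel[OF F(1)] F(2) const[OF u'] by simp
  qed
  also have "\<dots> = T.fibre (lin_ext ?v u)" using u by auto
  finally show "tensor_map A A' f g (T.fibre h) = T.fibre (lin_ext ?v u)" .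
  have "u \<in> carrier (free_tensor A A')" using u by (simp add: T.fibre_def)
  then show "lin_ext ?v u \<in> lin_ext ?w ` carrier (free_tensor A A')"
    by (intro image_eqI[of _ _ "F u"]) (simp_all add: F)
qed

text \<open>
  Two subalgebras whose products span, with the right dimensions, form a tensor decomposition; and a
  derivation preserving both acts on the tensor product by its two restrictions, by the
  Leibniz rule on elementary tensors.
\<close>

proposition tensor_decomposition_of_subalgebras:
  assumes A: "represents A \<phi> B"
    and H: "unital_subalgebra H" "H \<subseteq> B" and H': "unital_subalgebra H'" "H' \<subseteq> B"
    and fin: "finite T" "B \<subseteq> span T"
    and span: "B \<subseteq> span {f * g |f g. f \<in> H \<and> g \<in> H'}" and dim: "dim H * dim H' \<le> dim B"
  defines "C \<equiv> {a \<in> carrier A. \<phi> a \<in> H}" and "C' \<equiv> {a \<in> carrier A. \<phi> a \<in> H'}"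
  shows "tensor_decomposition A C C'"
    and "\<And>D t. D \<in> derivations A \<Longrightarrow> (\<And>a. a \<in> C \<Longrightarrow> D a \<in> C) \<Longrightarrow> (\<And>a. a \<in> C' \<Longrightarrow> D a \<in> C') \<Longrightarrow>
      t \<in> carrier (tensor (restrict_alg A C) (restrict_alg A C')) \<Longrightarrow>
      D (mult_map A t) = mult_map A (tensor_sum (restrict_alg A C) (restrict_alg A C') D D t)"
proof -
  note sA = represents_simps[OF A]
  let ?A = "restrict_alg A C" and ?A' = "restrict_alg A C'"
  let ?w = "\<lambda>k. \<phi> (fst k) * \<phi> (snd k)"
  have R: "represents ?A \<phi> H" unfolding C_def by (rule represents_restrict[OF A H])
  have R': "represents ?A' \<phi> H'" unfolding C'_def by (rule represents_restrict[OF A H'])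
  interpret T: evaluation scale "free_tensor ?A ?A'" "lin_ext ?w" by (rule tensor_evaluation[OF R R'])
  have B: "unital_subalgebra B" by (rule represents_subalgebra[OF A])
  obtain K where K: "K \<subseteq> H" "independent K" "H \<subseteq> span K" "card K = dim H"
    using basis_exists by blast
  obtain K' where K': "K' \<subseteq> H'" "independent K'" "H' \<subseteq> span K'" "card K' = dim H'"
    using basis_exists by blast
  have fK: "finite K" "finite K'"
    using card_le_dim_of_independent[of K H T] card_le_dim_of_independent[of K' H' T]
      K K' fin H(2) H'(2) by blast+
  have "{f * g |f g. f \<in> H \<and> g \<in> H'} \<subseteq> span ((\<lambda>k. fst k * snd k) ` (K \<times> K'))"
  proof clarify
    fix f g assume "f \<in> H" "g \<in> H'"
    then show "f * g \<in> span ((\<lambda>k. fst k * snd k) ` (K \<times> K'))"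
      by (intro span_mult_mem[of f K g K']) (use K K' in \<open>force intro: span_base\<close>)+
  qed
  then have BK: "B \<subseteq> span ((\<lambda>k. fst k * snd k) ` (K \<times> K'))"
    by (intro subset_trans[OF span] span_minimal subspace_span)
  then have "card (K \<times> K') \<le> dim (span ((\<lambda>k. fst k * snd k) ` (K \<times> K')))"
    using dim_mono_finite_span[OF BK subset_refl] dim fK K(4) K'(4)
    by (simp add: card_cartesian_product)
  then have kernel: "tensor_kernel ?A ?A' = T.kernel"
    by (intro tensor_kernel_eq_kernel[OF R R']) (use K K' fK in auto)
  have tensor: "tensor ?A ?A' = quot_alg (free_tensor ?A ?A') T.kernel"
    by (simp add: tensor_def kernel)
  have image: "lin_ext ?w ` carrier (free_tensor ?A ?A') = B" (is "?I = B")
  proof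
    have "\<phi> a \<in> B" if "a \<in> C \<or> a \<in> C'" for a
      using that represents_mem[OF A] by (auto simp: C_def C'_def)
    then show "?I \<subseteq> B"
      unfolding lin_ext_def using unital_subalgebraD[OF B]
      by (force simp: free_tensor_simps intro!: subspace_sum subspace_scale)
    have "{f * g |f g. f \<in> H \<and> g \<in> H'} \<subseteq> ?I"
    proof clarify
      fix f g assume fg: "f \<in> H" "g \<in> H'"
      obtain a b where ab: "a \<in> carrier ?A" "\<phi> a = f" "b \<in> carrier ?A'" "\<phi> b = g"
        using represents_surj[OF R fg(1)] represents_surj[OF R' fg(2)] by blast
      show "f * g \<in> ?I"
        by (rule image_eqI[of _ _ "single (a, b) 1"]) (use ab in \<open>auto simp: free_tensor_simps\<close>)
    qed
    then have "span {f * g |f g. f \<in> H \<and> g \<in> H'} \<subseteq> ?I"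
      by (rule span_minimal) (rule unital_subalgebraD(1)[OF represents_subalgebra[OF T.represents_quotient]])
    then show "B \<subseteq> ?I" using span by blast
  qed
  have rep_T: "represents (tensor ?A ?A') (\<lambda>t. the_elem (lin_ext ?w ` t)) B"
    using T.represents_quotient unfolding tensor image .
  have carrier_T: "\<exists>h\<in>B. t = T.fibre h" if "t \<in> carrier (tensor ?A ?A')" for t
    using that T.quotient_carrier unfolding tensor image by blast
  have mult: "mult_map A (T.fibre h) \<in> carrier A \<and> \<phi> (mult_map A (T.fibre h)) = h" if h: "h \<in> B" for h
  proof -
    obtain a where a: "a \<in> carrier A" "\<phi> a = h" using represents_surj[OF A h] by blast
    have const: "finsum A (\<lambda>k. lookup u k \<odot>\<^bsub>A\<^esub> (fst k \<otimes>\<^bsub>A\<^esub> snd k)) (keys u) = a"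
      if u: "u \<in> T.fibre h" for u
    proof -
      have "u \<in> carrier (free_tensor ?A ?A')" using u by (simp add: T.fibre_def)
      then have k: "fst k \<in> carrier A \<and> snd k \<in> carrier A" if "k \<in> keys u" for k
        using that by (auto simp: free_tensor_simps C_def C'_def)
      have m: "lookup u k \<odot>\<^bsub>A\<^esub> (fst k \<otimes>\<^bsub>A\<^esub> snd k) \<in> carrier A" if "k \<in> keys u" for k
        using k[OF that] by (simp add: sA)
      let ?s = "finsum A (\<lambda>k. lookup u k \<odot>\<^bsub>A\<^esub> (fst k \<otimes>\<^bsub>A\<^esub> snd k)) (keys u)"
      have s: "?s \<in> carrier A" by (rule represents_finsum(1)[OF A finite_keys]) (rule m)
      have "\<phi> ?s = (\<Sum>k\<in>keys u. \<phi> (lookup u k \<odot>\<^bsub>A\<^esub> (fst k \<otimes>\<^bsub>A\<^esub> snd k)))"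
        by (rule represents_finsum(2)[OF A finite_keys]) (rule m)
      also have "\<dots> = lin_ext ?w u"
        unfolding lin_ext_def by (intro sum.cong refl) (use k in \<open>simp add: sA\<close>)
      also have "\<dots> = \<phi> a" using u a(2) by (simp add: T.fibre_def)
      finally show ?thesis by (rule represents_inj[OF A s a(1)])
    qed
    have "T.fibre h \<noteq> {}" using h by (auto simp: T.fibre_def simp flip: image)
    have "mult_map A (T.fibre h) = the_elem ((\<lambda>_. a) ` T.fibre h)"
      unfolding mult_map_def by (intro arg_cong[where f = the_elem] image_cong refl const)
    then have "mult_map A (T.fibre h) = a" using \<open>T.fibre h \<noteq> {}\<close> by (simp add: image_constant_conv)
    then show ?thesis using a by simp
  qed
  have "mult_map A \<in> alg_iso (tensor ?A ?A') A"
  proof (rule alg_iso_if_represents[OF A rep_T])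
    fix t assume "t \<in> carrier (tensor ?A ?A')"
    then obtain h where h: "h \<in> B" "t = T.fibre h" using carrier_T by blast
    then show "mult_map A t \<in> carrier A \<and> \<phi> (mult_map A t) = the_elem (lin_ext ?w ` t)"
      using mult[OF h(1)] T.ev_fibre[of h] image by simp
  qed
  then show "tensor_decomposition A C C'"
    unfolding tensor_decomposition_def
    using represents_subalg[OF A H(1)] represents_subalg[OF A H'(1)] by (simp add: C_def C'_def)

  fix D t
  assume D: "D \<in> derivations A" and DC: "\<And>a. a \<in> C \<Longrightarrow> D a \<in> C" and DC': "\<And>a. a \<in> C' \<Longrightarrow> D a \<in> C'"
    and t: "t \<in> carrier (tensor ?A ?A')"
  obtain h where h: "h \<in> B" "t = T.fibre h" using carrier_T t by blast
  obtain u where u: "u \<in> T.fibre h" using h(1) by (auto simp: T.fibre_def simp flip: image)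
  have CA: "C \<subseteq> carrier A" "C' \<subseteq> carrier A" by (auto simp: C_def C'_def)
  have "u \<in> carrier (free_tensor ?A ?A')" using u by (simp add: T.fibre_def)
  then have "keys u \<subseteq> C \<times> C'" by (simp add: free_tensor_simps)
  then have k: "fst k \<in> carrier A" "snd k \<in> carrier A" if "k \<in> keys u" for k
    using that CA by (fastforce dest!: subsetD[where c = k])+
  let ?v = "\<lambda>k. \<phi> (D (fst k)) * \<phi> (id (snd k))" and ?v' = "\<lambda>k. \<phi> (id (fst k)) * \<phi> (D (snd k))"
  have 1: "tensor_map ?A ?A' D id t = T.fibre (lin_ext ?v u)" "lin_ext ?v u \<in> ?I"
    unfolding h(2) by (rule tensor_map_fibre[OF R R' kernel];
      use u DC CA derivation_simps[OF A D] in \<open>auto simp: subset_iff\<close>)+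
  have 2: "tensor_map ?A ?A' id D t = T.fibre (lin_ext ?v' u)" "lin_ext ?v' u \<in> ?I"
    unfolding h(2) by (rule tensor_map_fibre[OF R R' kernel];
      use u DC' CA derivation_simps[OF A D] in \<open>auto simp: subset_iff\<close>)+
  have sum: "tensor_sum ?A ?A' D D t = T.fibre (lin_ext ?v u + lin_ext ?v' u)"
    unfolding tensor_sum_def tensor 1(1) 2(1) by (rule T.quotient_add[OF 1(2) 2(2)])
  let ?D = "transport A \<phi> D"
  have \<phi>B: "\<phi> (fst k) \<in> B" "\<phi> (snd k) \<in> B" if "k \<in> keys u" for k
    using k[OF that] represents_mem[OF A] by auto
  note lin = transport_linear[OF A D]
  have "lin_ext ?v u + lin_ext ?v' u
      = (\<Sum>k\<in>keys u. ?D (lookup u k *s (\<phi> (fst k) * \<phi> (snd k))))"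
    unfolding lin_ext_def sum.distrib[symmetric]
    by (intro sum.cong refl)
       (use k \<phi>B unital_subalgebraD(3)[OF B] in
         \<open>simp add: linear_onD(3)[OF lin] transport_leibniz[OF A D] transport_eq[OF A D] scale_right_distrib\<close>)
  also have "\<dots> = ?D (lin_ext ?w u)"
    unfolding lin_ext_def using \<phi>B unital_subalgebraD[OF B]
    by (intro linear_on_sum[OF lin, symmetric]) (auto intro: subspace_scale)
  also have "lin_ext ?w u = h" using u by (simp add: T.fibre_def)
  finally have sum': "tensor_sum ?A ?A' D D t = T.fibre (?D h)" using sum by simp
  have "?D h \<in> B" using linear_onD(1)[OF lin h(1)] .
  then have m': "mult_map A (T.fibre (?D h)) \<in> carrier A" "\<phi> (mult_map A (T.fibre (?D h))) = ?D h"
    using mult by blast+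
  have m: "mult_map A (T.fibre h) \<in> carrier A" "\<phi> (mult_map A (T.fibre h)) = h"
    using mult[OF h(1)] by blast+
  have "\<phi> (D (mult_map A (T.fibre h))) = \<phi> (mult_map A (T.fibre (?D h)))"
    using transport_eq[OF A D m(1)] unfolding m(2) m'(2) by (rule sym)
  then show "D (mult_map A t) = mult_map A (tensor_sum ?A ?A' D D t)"
    unfolding sum' unfolding h(2) by (rule represents_inj[OF A derivation_closed[OF A D m(1)] m'(1)])
qed

end

section \<open>A host ring for all truncated polynomial rings\<close>

text \<open>
  The host is the group algebra over the field \<open>'a\<close> of the additive group of finitely supported
  functions \<open>nat \<Rightarrow>\<^sub>0 'a\<close>, in which every element has order dividing the characteristic.
\<close>

definition host_scale :: "'a::field \<Rightarrow> ((nat \<Rightarrow>\<^sub>0 'a) \<Rightarrow>\<^sub>0 'a) \<Rightarrow> ((nat \<Rightarrow>\<^sub>0 'a) \<Rightarrow>\<^sub>0 'a)" where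
  "host_scale c f = single 0 c * f"

definition host_var :: "nat \<Rightarrow> ((nat \<Rightarrow>\<^sub>0 'a::field) \<Rightarrow>\<^sub>0 'a)" where
  "host_var i = single (single i 1) 1 - 1"

interpretation host: commutative_algebra "host_scale :: 'a::field \<Rightarrow> _"
  by unfold_locales
    (simp_all add: host_scale_def distrib_left single_add distrib_right mult_single
      flip: mult.assoc)

lemma group_element_power:
  "single (single i (1::'a::field)) (1::'a) ^ n =
    single (single i (of_nat n)) 1"
  by (induction n) (simp_all add: mult_single flip: single_add)

lemma of_nat_less_CHAR_inj:
  assumes "of_nat a = (of_nat b :: 'a::ring_1)" "a < CHAR('a)" "b < CHAR('a)"
  shows "a = b"
proof -
  have "d \<le> c" if "of_nat c = (of_nat d :: 'a)" "d < CHAR('a)" for c d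
  proof (rule ccontr)
    assume "\<not> d \<le> c"
    then have "(of_nat (d - c) :: 'a) = of_nat d - of_nat c" by (intro of_nat_diff) simp
    then have "CHAR('a) dvd d - c" using that(1) by (simp flip: of_nat_eq_0_iff_char_dvd)
    then show False using \<open>\<not> d \<le> c\<close> that(2) by (auto dest!: dvd_imp_le)
  qed
  from this[of a b] this[of b a] show ?thesis using assms by auto
qed

text \<open>
  The coordinates \<open>g - 1\<close> have \<open>p\<close>-th power \<open>g ^ p - 1 = 0\<close>. Their reduced power products have the same
  span as those of the group elements \<open>g\<close>, which are distinct group elements and hence linearly
  independent.
\<close>

lemma host_coordinates:
  assumes "prime CHAR('a::field)"
  shows "host.truncated_coordinates m host_var
    (host.span (power_product (host_var :: nat \<Rightarrow> (nat \<Rightarrow>\<^sub>0 'a) \<Rightarrow>\<^sub>0 'a) ` reduced CHAR('a) m))"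
proof -
  let ?p = "CHAR('a)"
  let ?g = "\<lambda>i. single (single i (1::'a)) (1::'a)"
  let ?x = "host_var :: nat \<Rightarrow> (nat \<Rightarrow>\<^sub>0 'a) \<Rightarrow>\<^sub>0 'a"
  let ?X = "host.span (power_product ?x ` reduced ?p m)"
  let ?G = "host.span (power_product ?g ` reduced ?p m)"
  have p: "?p > 0" using assms prime_gt_0_nat by blast
  have gp: "?g i ^ ?p = 1" for i by (simp only: group_element_power of_nat_CHAR) simp
  have gx: "?g i = ?x i + 1" for i by (simp add: host_var_def)
  have fd: "?g i ^ ?p = ?x i ^ ?p + 1 ^ ?p" for i
    unfolding gx by (rule freshmans_dream) (use assms in \<open>simp_all add: host.CHAR_eq\<close>)
  have "?x i ^ ?p + 1 = 1" for i using fd[of i] unfolding gp power_one by (rule sym)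
  then have xp: "?x i ^ ?p = 0" for i by simp
  have gp': "\<exists>c. ?g i ^ ?p = host_scale c 1" for i unfolding gp by (intro exI[of _ 1]) (simp add: host_scale_def)
  have xp': "\<exists>c. ?x i ^ ?p = host_scale c 1" for i unfolding xp by (intro exI[of _ 0]) (simp add: host_scale_def)
  note X = host.reduced_span_subalgebra[of m ?x ?p, OF xp' p]
  note G = host.reduced_span_subalgebra[of m ?g ?p, OF gp' p]
  have "?G \<subseteq> ?X"
    using X by (intro host.reduced_span_minimal) (auto simp: gx host.unital_subalgebraD host.subspace_add)
  moreover have "?X \<subseteq> ?G"
    using G by (intro host.reduced_span_minimal)
      (auto simp: host_var_def host.unital_subalgebraD intro: host.subspace_diff)
  ultimately have "?X = ?G" by blast
  moreover have "host.dim ?G = card (reduced ?p m)"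
  proof (rule host.dim_span_family)
    fix c assume c: "(\<Sum>e\<in>reduced ?p m. host_scale (c e) (power_product ?g e)) = 0"
    define \<tau> :: "(nat \<Rightarrow>\<^sub>0 nat) \<Rightarrow> (nat \<Rightarrow>\<^sub>0 'a)" where
      "\<tau> e = (\<Sum>i<m. single i (of_nat (lookup e i)))" for e
    have pp: "power_product ?g e = single (\<tau> e) 1" if "e \<in> reduced ?p m" for e
    proof -
      have "(\<Prod>i\<in>I. single (f i) (1::'a)) = single (\<Sum>i\<in>I. f i) 1"
        for I :: "nat set" and f :: "nat \<Rightarrow> nat \<Rightarrow>\<^sub>0 'a"
        by (induction I rule: infinite_finite_induct) (simp_all add: mult_single)
      then show ?thesis
        using that by (simp add: power_product_superset[of "{..<m}"] reduced_def group_element_power \<tau>_def)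
    qed
    have lookup: "lookup (\<tau> e) i = of_nat (lookup e i)" if "e \<in> reduced ?p m" for e i
    proof -
      have "i \<ge> m \<Longrightarrow> lookup e i = 0"
        using reduced_index_less[OF that, of i] by (auto simp: in_keys_iff)
      then show ?thesis by (auto simp: \<tau>_def lookup_sum lookup_single when_def)
    qed
    have inj: "e = e'" if e: "e \<in> reduced ?p m" "e' \<in> reduced ?p m" "\<tau> e = \<tau> e'" for e e'
    proof (rule poly_mapping_eqI)
      fix i
      have "of_nat (lookup e i) = (of_nat (lookup e' i) :: 'a)"
        using lookup e by metis
      then show "lookup e i = lookup e' i"
        using e by (intro of_nat_less_CHAR_inj) (auto simp: reduced_def)
    qed
    have "0 = (\<Sum>e\<in>reduced ?p m. single (\<tau> e) (c e))"
      unfolding c[symmetric] by (intro sum.cong refl) (simp add: pp host_scale_def mult_single)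
    then have "lookup (\<Sum>e\<in>reduced ?p m. single (\<tau> e) (c e)) (\<tau> e') = 0" for e'
      by (metis lookup_zero)
    moreover have "lookup (\<Sum>e\<in>reduced ?p m. single (\<tau> e) (c e)) (\<tau> e') = c e'"
      if "e' \<in> reduced ?p m" for e'
    proof -
      have "lookup (\<Sum>e\<in>reduced ?p m. single (\<tau> e) (c e)) (\<tau> e')
          = (\<Sum>e\<in>reduced ?p m. if e = e' then c e else 0)"
        unfolding lookup_sum lookup_single when_def by (intro sum.cong refl) (use inj that in auto)
      then show ?thesis using that p by simp
    qed
    ultimately show "\<forall>e\<in>reduced ?p m. c e = 0" by metis
  qed (use p in simp)
  ultimately show ?thesis
    unfolding host.truncated_coordinates_def using xp p by (simp add: card_reduced)
qed

section \<open>The decomposition of a derivation without constants\<close>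

theorem proposition1p2p2:
  fixes m :: nat
    and D :: "'a::alg_closed_field mpoly set \<Rightarrow> 'a mpoly set"
  assumes "CHAR('a) > 3"
    and "m \<ge> 1"
    and "D \<in> derivations (trunc_poly m)"
    and "constants (trunc_poly m) D = scalars (trunc_poly m)"
  shows "\<exists>r B' B'' N S. r \<le> m \<and>
    tensor_decomposition (trunc_poly m) B' B'' \<and>
    alg_iso (restrict_alg (trunc_poly m) B') (trunc_poly r) \<noteq> {} \<and>
    alg_iso (restrict_alg (trunc_poly m) B'') (trunc_poly (m - r)) \<noteq> {} \<and>
    N \<in> derivations (restrict_alg (trunc_poly m) B') \<and>
    S \<in> derivations (restrict_alg (trunc_poly m) B'') \<and>
    regular_nilpotent (restrict_alg (trunc_poly m) B') r N \<and>
    regular_semisimple (restrict_alg (trunc_poly m) B'') (m - r) S \<and>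
    (\<forall>t\<in>carrier (tensor (restrict_alg (trunc_poly m) B') (restrict_alg (trunc_poly m) B'')).
      D (mult_map (trunc_poly m) t) =
        mult_map (trunc_poly m)
          (tensor_sum (restrict_alg (trunc_poly m) B') (restrict_alg (trunc_poly m) B'') N S t))"
proof -
  let ?p = "CHAR('a)" and ?A = "trunc_poly m :: ('a, 'a mpoly set) module"
  let ?x = "host_var :: nat \<Rightarrow> (nat \<Rightarrow>\<^sub>0 'a) \<Rightarrow>\<^sub>0 'a"
  have prime: "prime ?p" using assms(1) prime_CHAR_semidom by force
  define B where "B = host.span (power_product ?x ` reduced ?p m)"
  interpret U: truncated_algebra host_scale ?p m ?x B
    by unfold_locales (use host_coordinates[OF prime] prime in \<open>auto simp: B_def\<close>)
  obtain \<phi> where A: "host.represents ?A \<phi> B" using U.trunc_poly_represents by blast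
  note sA = host.represents_simps[OF A] and surj = host.represents_surj[OF A]
  note D = assms(3)
  let ?D = "host.transport ?A \<phi> D"
  interpret V: alg_closed_truncated_algebra host_scale ?p m ?x B ?D
  proof
    show "U.derivation_on_B ?D"
      using host.transport_linear[OF A D] host.transport_leibniz[OF A D] by (simp add: U.derivation_on_B_def)
    fix b assume b: "b \<in> B" "?D b = 0"
    obtain a where a: "a \<in> carrier ?A" "\<phi> a = b" using surj[OF b(1)] by blast
    then have "\<phi> (D a) = 0" using b host.transport_eq[OF A D] by auto
    then have "D a = \<zero>\<^bsub>?A\<^esub>"
      using host.represents_eq_zero_iff[OF A] host.derivation_closed[OF A D] a by auto
    then have "a \<in> constants ?A D" using a by (simp add: constants_def)
    then obtain c where "a = c \<odot>\<^bsub>?A\<^esub> \<one>\<^bsub>?A\<^esub>" unfolding assms(4) scalars_def by blast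
    then show "\<exists>c. b = host_scale c 1" using a sA by auto
  qed
  obtain r B0 B1 y z where r: "r \<le> m"
    and y: "host.truncated_coordinates r y B0" and z: "host.truncated_coordinates (m - r) z B1"
    and alg: "host.unital_subalgebra B0" "host.unital_subalgebra B1" and sub: "B0 \<subseteq> B" "B1 \<subseteq> B"
    and D0: "\<And>b. b \<in> B0 \<Longrightarrow> ?D b \<in> B0" and D1: "\<And>b. b \<in> B1 \<Longrightarrow> ?D b \<in> B1"
    and span: "B \<subseteq> host.span {f * g |f g. f \<in> B0 \<and> g \<in> B1}"
    and nil: "\<And>b. b \<in> B0 \<Longrightarrow> (?D ^^ (?p ^ r)) b = 0" "\<exists>b\<in>B0. (?D ^^ (?p ^ r - 1)) b \<noteq> 0"
    and ev: "finite {l. \<exists>v\<in>B1. v \<noteq> 0 \<and> ?D v = host_scale l v}"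
      "card {l. \<exists>v\<in>B1. v \<noteq> 0 \<and> ?D v = host_scale l v} = ?p ^ (m - r)"
    by (rule V.splitting, rule that; blast)
  note B0 = alg(1) sub(1) and B1 = alg(2) sub(2)
  define C0 C1 where "C0 = {a \<in> carrier ?A. \<phi> a \<in> B0}" and "C1 = {a \<in> carrier ?A. \<phi> a \<in> B1}"
  interpret Y: truncated_algebra host_scale ?p r y B0
    by unfold_locales (use y prime in auto)
  interpret Z: truncated_algebra host_scale ?p "m - r" z B1
    by unfold_locales (use z prime in auto)
  have R0: "host.represents (restrict_alg ?A C0) \<phi> B0" unfolding C0_def by (rule host.represents_restrict[OF A B0])
  have R1: "host.represents (restrict_alg ?A C1) \<phi> B1" unfolding C1_def by (rule host.represents_restrict[OF A B1])
  have iso: "alg_iso (restrict_alg ?A C0) (trunc_poly r) \<noteq> {}" "alg_iso (restrict_alg ?A C1) (trunc_poly (m - r)) \<noteq> {}"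
    using Y.trunc_poly_represents Z.trunc_poly_represents host.alg_iso_nonempty[OF _ R0] host.alg_iso_nonempty[OF _ R1]
    by blast+
  note closed = host.derivation_closed[OF A D] and teq = host.transport_eq[OF A D]
  have DC: "\<And>a. a \<in> C0 \<Longrightarrow> D a \<in> C0" "\<And>a. a \<in> C1 \<Longrightarrow> D a \<in> C1"
    using closed D0 D1 by (auto simp: C0_def C1_def simp flip: teq)
  have der: "D \<in> derivations (restrict_alg ?A C0)" "D \<in> derivations (restrict_alg ?A C1)"
    using D DC by (auto simp: derivations_def C0_def C1_def)
  obtain T where T: "finite T" "B \<subseteq> host.span T" by (rule U.B_finite_span)
  have dim: "host.dim B0 * host.dim B1 \<le> host.dim B"
    using r by (simp add: U.dim_B Y.dim_B Z.dim_B flip: power_add)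
  note dec = host.tensor_decomposition_of_subalgebras[OF A B0 B1 T span dim, folded C0_def C1_def]
  have pow: "\<phi> ((D ^^ n) a) = (?D ^^ n) (\<phi> a) \<and> (D ^^ n) a \<in> carrier ?A" if "a \<in> carrier ?A" for n a
    using host.transport_funpow[OF A D that] by auto
  have "regular_nilpotent (restrict_alg ?A C0) r D"
  proof -
    obtain b where b: "b \<in> B0" "(?D ^^ (?p ^ r - 1)) b \<noteq> 0" using nil(2) by blast
    obtain a where a: "a \<in> carrier ?A" "\<phi> a = b" using surj b(1) B0(2) by blast
    then have "a \<in> C0" "(D ^^ (?p ^ r - 1)) a \<noteq> \<zero>\<^bsub>?A\<^esub>"
      using b pow[OF a(1), of "?p ^ r - 1"] sA by (auto simp: C0_def)
    moreover have "(D ^^ (?p ^ r)) a = \<zero>\<^bsub>?A\<^esub>" if "a \<in> C0" for a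
      using that nil(1) pow[of a "?p ^ r"] host.represents_eq_zero_iff[OF A] by (auto simp: C0_def)
    ultimately show ?thesis unfolding regular_nilpotent_def by auto
  qed
  moreover have "eigenvalues (restrict_alg ?A C1) D = {l. \<exists>v\<in>B1. v \<noteq> 0 \<and> ?D v = host_scale l v}"
  proof (intro subset_antisym subsetI)
    fix l assume "l \<in> eigenvalues (restrict_alg ?A C1) D"
    then obtain a where "a \<in> C1" "a \<noteq> \<zero>\<^bsub>?A\<^esub>" "D a = l \<odot>\<^bsub>?A\<^esub> a" by (auto simp: eigenvalues_def)
    then have "\<phi> a \<in> B1 \<and> \<phi> a \<noteq> 0 \<and> ?D (\<phi> a) = host_scale l (\<phi> a)"
      using host.represents_eq_zero_iff[OF A] by (auto simp: C1_def teq sA)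
    then show "l \<in> {l. \<exists>v\<in>B1. v \<noteq> 0 \<and> ?D v = host_scale l v}" by blast
  next
    fix l assume "l \<in> {l. \<exists>v\<in>B1. v \<noteq> 0 \<and> ?D v = host_scale l v}"
    then obtain v where v: "v \<in> B1" "v \<noteq> 0" "?D v = host_scale l v" by blast
    obtain a where a: "a \<in> carrier ?A" "\<phi> a = v" using surj v(1) B1(2) by blast
    have "D a = l \<odot>\<^bsub>?A\<^esub> a"
      by (rule host.represents_inj[OF A]) (use a v in \<open>auto simp: closed sA simp flip: teq\<close>)
    then show "l \<in> eigenvalues (restrict_alg ?A C1) D"
      using a v sA by (auto simp: eigenvalues_def C1_def)
  qed
  then have "regular_semisimple (restrict_alg ?A C1) (m - r) D"
    using ev by (simp add: regular_semisimple_def)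
  ultimately show ?thesis
    using r dec(1) dec(2)[OF D DC] iso der
    by (intro exI[of _ r] exI[of _ C0] exI[of _ C1] exI[of _ D]) blast
qed

end
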